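(* Let $M=D_Xu$ be a left $D_X$-module generated by $u$, let $I=\mathrm{Ann}_{D_X}u$, let $f\in K[x]$ be a nonzero polynomial, let $G$ be a finite set of generators of $I$, and let $J$ be the left ideal of $D_Y$ generated by $\{\tau(P)\mid P\in G\}$ and $tf-1$. If $M$ is holonomic on $X_f$, i.e. if $\mathrm{Char}(M)\cap\pi^{-1}(X_f)$ is an $n$-dimensional algebraic set, then $D_Y/J$ is a holonomic $D_Y$-module.
   Context: $K$ is a field of characteristic zero, $K[x]=K[x_1,\dots,x_n]$, $X=K^n$, $D_X$ is the $n$-th Weyl algebra in $x$; $t$ is a new variable, $Y=X\times K$ with coordinates $(x,t)$, and $D_Y$ is the Weyl algebra in $(x,t)$. Put $f_i=\partial f/\partial x_i$. Define $\vartheta_i=\partial_{x_i}-f_i\partial_tt^2\in D_Y$ ($i=1,\dots,n$); these commute with each other and $[\vartheta_i,x_j]=\delta_{ij}$, so there is a ring homomorphism $\tau:D_X\to D_Y$, $\tau(P(x,\partial_x))=P(x,\vartheta_1,\dots,\vartheta_n)$. $X_f=\{x\in X\mid f(x)\neq0\}$, $\pi:T^*X=\{(x,\xi)\}\to X$ is the projection, and $\mathrm{Char}(M)\subset T^*X$ is the characteristic variety of $M$ (dimension in the sense of algebraic geometry, i.e. geometric points over an algebraic closure of $K$ are taken into account). A finitely generated module over a Weyl algebra in $m$ variables is holonomic if it is zero or has dimension $m$. *)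

theory Defs
  imports
    "HOL-Library.Poly_Mapping"
    "HOL-Library.Extended_Real"
    "HOL-Library.Cardinality"
    "HOL-Algebra.Algebraic_Closure_Type"
    "HOL-Algebra.Module"
    "HOL-Analysis.Abstract_Topology"
    "HOL.Hull"
begin

section \<open>Polynomials in finitely many variables\<close>

text \<open>Polynomials over \<open>'k\<close> whose variables are indexed by \<open>'i\<close>; the number of variables is
  \<open>CARD('i)\<close>.\<close>

type_synonym ('k, 'i) mpoly = "('i \<Rightarrow>\<^sub>0 nat) \<Rightarrow>\<^sub>0 'k"

definition mconst :: "'k::comm_ring_1 \<Rightarrow> ('k, 'i) mpoly" where
  "mconst c = Poly_Mapping.single 0 c"

definition mvar :: "'i \<Rightarrow> ('k::comm_ring_1, 'i) mpoly" where
  "mvar i = Poly_Mapping.single (Poly_Mapping.single i 1) 1"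

definition mpderiv :: "'i \<Rightarrow> ('k::comm_ring_1, 'i) mpoly \<Rightarrow> ('k, 'i) mpoly" where
  "mpderiv i p = (\<Sum>m\<in>Poly_Mapping.keys p.
     Poly_Mapping.single (m - Poly_Mapping.single i 1)
       (of_nat (Poly_Mapping.lookup m i) * Poly_Mapping.lookup p m))"

text \<open>The value of \<open>p\<close> at \<open>z\<close>, with the coefficients transported along \<open>\<phi>\<close>.\<close>

definition meval ::
    "('k::comm_ring_1 \<Rightarrow> 'l::comm_ring_1) \<Rightarrow> ('i::finite \<Rightarrow> 'l) \<Rightarrow> ('k, 'i) mpoly \<Rightarrow> 'l" where
  "meval \<phi> z p = (\<Sum>m\<in>Poly_Mapping.keys p.
     \<phi> (Poly_Mapping.lookup p m) * (\<Prod>i\<in>UNIV. z i ^ Poly_Mapping.lookup m i))"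

lemma keys_sum_superset:
  assumes "finite S" "Poly_Mapping.keys p \<subseteq> S" "\<And>m. g m 0 = 0"
  shows "(\<Sum>m\<in>Poly_Mapping.keys p. g m (Poly_Mapping.lookup p m)) =
         (\<Sum>m\<in>S. g m (Poly_Mapping.lookup p m) :: 'b::comm_monoid_add)"
  by (rule sum.mono_neutral_left) (use assms in \<open>auto simp: in_keys_iff\<close>)

lemma keys_sum_add:
  assumes "\<And>m. g m 0 = 0" "\<And>m x y. g m (x + y) = g m x + g m y"
  shows "(\<Sum>m\<in>Poly_Mapping.keys (p + q). g m (Poly_Mapping.lookup (p + q) m)) =
         (\<Sum>m\<in>Poly_Mapping.keys p. g m (Poly_Mapping.lookup p m)) +
         (\<Sum>m\<in>Poly_Mapping.keys q. g m (Poly_Mapping.lookup q m) :: 'b::comm_monoid_add)"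
proof -
  let ?S = "Poly_Mapping.keys p \<union> Poly_Mapping.keys q"
  have "Poly_Mapping.keys (p + q) \<subseteq> ?S" by (rule Poly_Mapping.keys_add)
  then have "(\<Sum>m\<in>Poly_Mapping.keys (p + q). g m (Poly_Mapping.lookup (p + q) m)) =
      (\<Sum>m\<in>?S. g m (Poly_Mapping.lookup (p + q) m))"
    using assms(1) by (intro keys_sum_superset) auto
  also have "\<dots> = (\<Sum>m\<in>?S. g m (Poly_Mapping.lookup p m)) + (\<Sum>m\<in>?S. g m (Poly_Mapping.lookup q m))"
    by (simp add: assms(2) sum.distrib lookup_add)
  also have "(\<Sum>m\<in>?S. g m (Poly_Mapping.lookup p m)) =
      (\<Sum>m\<in>Poly_Mapping.keys p. g m (Poly_Mapping.lookup p m))"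
    using assms(1) by (intro keys_sum_superset[symmetric]) auto
  also have "(\<Sum>m\<in>?S. g m (Poly_Mapping.lookup q m)) =
      (\<Sum>m\<in>Poly_Mapping.keys q. g m (Poly_Mapping.lookup q m))"
    using assms(1) by (intro keys_sum_superset[symmetric]) auto
  finally show ?thesis .
qed

lemma mpderiv_add: "mpderiv i (p + q) = mpderiv i p + mpderiv i q"
  unfolding mpderiv_def
  by (rule keys_sum_add) (simp_all add: distrib_left single_add)


section \<open>Weyl algebras\<close>

text \<open>The Weyl algebra in the variables indexed by \<open>'n\<close> over a field of characteristic zero, as the
  algebra of \<open>'k\<close>-linear operators on the polynomial ring that is generated by the multiplications
  by polynomials and by the partial derivatives.\<close>

inductive_set weyl_ops ::
    "(('k::field_char_0, 'n) mpoly \<Rightarrow> ('k, 'n) mpoly) set" where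
  mult: "(\<lambda>h. g * h) \<in> weyl_ops"
| pderiv: "mpderiv i \<in> weyl_ops"
| add: "A \<in> weyl_ops \<Longrightarrow> B \<in> weyl_ops \<Longrightarrow> (\<lambda>h. A h + B h) \<in> weyl_ops"
| comp: "A \<in> weyl_ops \<Longrightarrow> B \<in> weyl_ops \<Longrightarrow> (\<lambda>h. A (B h)) \<in> weyl_ops"

lemma weyl_ops_additive: "A \<in> weyl_ops \<Longrightarrow> A (h + h') = A h + A h'"
  by (induction arbitrary: h h' rule: weyl_ops.induct)
     (simp_all add: distrib_left mpderiv_add)

lemma weyl_ops_zero: "(\<lambda>h. 0) \<in> weyl_ops"
  using weyl_ops.mult[of 0] by (simp add: lambda_zero)

lemma weyl_ops_one: "(\<lambda>h. h) \<in> weyl_ops"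
  using weyl_ops.mult[of 1] by (simp add: lambda_one)

lemma weyl_ops_uminus: "A \<in> weyl_ops \<Longrightarrow> (\<lambda>h. - A h) \<in> weyl_ops"
  using weyl_ops.comp[OF weyl_ops.mult[of "-1"]] by simp

typedef (overloaded) ('k, 'n) weyl =
    "weyl_ops :: (('k::field_char_0, 'n) mpoly \<Rightarrow> ('k, 'n) mpoly) set"
  morphisms weyl_apply Weyl
  using weyl_ops_zero by blast

lifting_forget poly_mapping.lifting
setup_lifting type_definition_weyl

instantiation weyl :: (field_char_0, type) ring_1
begin

lift_definition zero_weyl :: "('a, 'b) weyl" is "\<lambda>h. 0" by (rule weyl_ops_zero)
lift_definition one_weyl :: "('a, 'b) weyl" is "\<lambda>h. h" by (rule weyl_ops_one)
lift_definition plus_weyl :: "('a, 'b) weyl \<Rightarrow> ('a, 'b) weyl \<Rightarrow> ('a, 'b) weyl"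
  is "\<lambda>A B h. A h + B h" by (rule weyl_ops.add)
lift_definition uminus_weyl :: "('a, 'b) weyl \<Rightarrow> ('a, 'b) weyl"
  is "\<lambda>A h. - A h" by (rule weyl_ops_uminus)
lift_definition minus_weyl :: "('a, 'b) weyl \<Rightarrow> ('a, 'b) weyl \<Rightarrow> ('a, 'b) weyl"
  is "\<lambda>A B h. A h - B h"
  using weyl_ops.add[OF _ weyl_ops_uminus] by fastforce
lift_definition times_weyl :: "('a, 'b) weyl \<Rightarrow> ('a, 'b) weyl \<Rightarrow> ('a, 'b) weyl"
  is "\<lambda>A B h. A (B h)" by (rule weyl_ops.comp)

instance
proof
  show "0 \<noteq> (1 :: ('a, 'b) weyl)"
    by transfer (metis zero_neq_one)
qed (transfer; force simp: fun_eq_iff weyl_ops_additive)+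

end

lift_definition weyl_poly :: "('k::field_char_0, 'n) mpoly \<Rightarrow> ('k, 'n) weyl"
  is "\<lambda>g h. g * h" by (rule weyl_ops.mult)

lift_definition weyl_pd :: "'n \<Rightarrow> ('k::field_char_0, 'n) weyl"
  is mpderiv by (rule weyl_ops.pderiv)

abbreviation weyl_const :: "'k::field_char_0 \<Rightarrow> ('k, 'n) weyl" where
  "weyl_const c \<equiv> weyl_poly (mconst c)"

abbreviation weyl_var :: "'n \<Rightarrow> ('k::field_char_0, 'n) weyl" where
  "weyl_var i \<equiv> weyl_poly (mvar i)"

text \<open>The product of the powers \<open>\<theta> i ^ e i\<close> for pairwise commuting \<open>\<theta>\<close> in a ring that need not be
  commutative.\<close>

definition npow :: "('n::finite \<Rightarrow> 'r::ring_1) \<Rightarrow> ('n \<Rightarrow> nat) \<Rightarrow> 'r" where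
  "npow \<theta> e = Finite_Set.fold (\<lambda>i A. \<theta> i ^ e i * A) 1 UNIV"

text \<open>Polynomials in the variables \<open>'n + 'n\<close> are polynomials in \<open>(x, \<xi>)\<close>, with \<open>Inl i\<close> for
  \<open>x\<^sub>i\<close> and \<open>Inr i\<close> for \<open>\<xi>\<^sub>i\<close>. In \<open>p(z, \<theta>)\<close> the \<open>z\<close> are written to the left of
  the \<open>\<theta>\<close>.\<close>

definition normal_subst ::
    "('k::field_char_0 \<Rightarrow> 'r::ring_1) \<Rightarrow> ('n::finite \<Rightarrow> 'r) \<Rightarrow> ('n \<Rightarrow> 'r) \<Rightarrow>
     ('k, 'n + 'n) mpoly \<Rightarrow> 'r" where
  "normal_subst \<phi> z \<theta> p = (\<Sum>m\<in>Poly_Mapping.keys p. \<phi> (Poly_Mapping.lookup p m) *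
     npow z (\<lambda>i. Poly_Mapping.lookup m (Inl i)) * npow \<theta> (\<lambda>i. Poly_Mapping.lookup m (Inr i)))"

abbreviation "normal_ordered \<equiv> normal_subst weyl_const weyl_var weyl_pd"

text \<open>The total symbol of \<open>P\<close>: the unique polynomial \<open>p\<close> with \<open>P = p(x, \<partial>)\<close>, see
  \<open>ex1_total_symbol\<close> below.\<close>

definition total_symbol :: "('k::field_char_0, 'n::finite) weyl \<Rightarrow> ('k, 'n + 'n) mpoly" where
  "total_symbol P = (THE p. normal_ordered p = P)"

lemma mpoly_induct [case_names single add]:
  fixes p :: "'a \<Rightarrow>\<^sub>0 'b::comm_monoid_add"
  assumes "\<And>m c. Q (Poly_Mapping.single m c)" "\<And>p q. Q p \<Longrightarrow> Q q \<Longrightarrow> Q (p + q)"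
  shows "Q p"
proof -
  have eq: "p = (\<Sum>m\<in>Poly_Mapping.keys p. Poly_Mapping.single m (Poly_Mapping.lookup p m))"
    by (rule poly_mapping_eqI) (simp add: lookup_sum lookup_single when_def in_keys_iff)
  have "Q (\<Sum>m\<in>A. Poly_Mapping.single m (Poly_Mapping.lookup p m))" if "finite A" for A
    using that
  proof induction
    case empty
    show ?case using assms(1)[of _ 0] by simp
  next
    case (insert x A)
    then show ?case using assms by simp
  qed
  then show ?thesis using eq by (metis finite_keys)
qed

lemma mpderiv_single:
  "mpderiv i (Poly_Mapping.single m c) =
   Poly_Mapping.single (m - Poly_Mapping.single i 1) (of_nat (Poly_Mapping.lookup m i) * c)"
  by (cases "c = 0") (simp_all add: mpderiv_def)

lemma mpderiv_mult: "mpderiv i (g * h) = g * mpderiv i h + mpderiv i g * h"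
proof (induction g rule: mpoly_induct)
  case (single m c)
  show ?case
  proof (induction h rule: mpoly_induct)
    case (single m' c')
    let ?e = "Poly_Mapping.single i (1::nat)"
    have *: "m + m' - ?e = m + (m' - ?e)" if "Poly_Mapping.lookup m' i \<noteq> 0"
      by (rule poly_mapping_eqI) (use that in \<open>auto simp: lookup_add lookup_minus lookup_single when_def\<close>)
    have **: "m + m' - ?e = (m - ?e) + m'" if "Poly_Mapping.lookup m i \<noteq> 0"
      by (rule poly_mapping_eqI) (use that in \<open>auto simp: lookup_add lookup_minus lookup_single when_def\<close>)
    let ?x = "c * (of_nat (Poly_Mapping.lookup m' i) * c')"
    let ?y = "of_nat (Poly_Mapping.lookup m i) * c * c'"
    have "mpderiv i (Poly_Mapping.single m c * Poly_Mapping.single m' c') =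
        Poly_Mapping.single (m + m' - ?e) (?x + ?y)"
      unfolding mult_single mpderiv_single by (simp add: lookup_add algebra_simps)
    also have "\<dots> = Poly_Mapping.single (m + m' - ?e) ?x + Poly_Mapping.single (m + m' - ?e) ?y"
      by (rule single_add)
    also have "Poly_Mapping.single (m + m' - ?e) ?x = Poly_Mapping.single (m + (m' - ?e)) ?x"
      using * by (cases "Poly_Mapping.lookup m' i = 0") simp_all
    also have "Poly_Mapping.single (m + m' - ?e) ?y = Poly_Mapping.single (m - ?e + m') ?y"
      using ** by (cases "Poly_Mapping.lookup m i = 0") simp_all
    finally show ?case
      unfolding mpderiv_single mult_single .
  qed (simp add: mpderiv_add algebra_simps)
qed (simp add: mpderiv_add algebra_simps)

lemma weyl_eqI: "(\<And>h. weyl_apply P h = weyl_apply Q h) \<Longrightarrow> P = Q"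
  by (simp add: weyl_apply_inject[symmetric] fun_eq_iff)

lemmas weyl_apply_simps =
  zero_weyl.rep_eq one_weyl.rep_eq plus_weyl.rep_eq minus_weyl.rep_eq uminus_weyl.rep_eq
  times_weyl.rep_eq weyl_poly.rep_eq weyl_pd.rep_eq

lemma weyl_apply_sum: "weyl_apply (sum P A) h = (\<Sum>a\<in>A. weyl_apply (P a) h)"
  by (induction A rule: infinite_finite_induct) (simp_all add: weyl_apply_simps)

lemma weyl_poly_add: "weyl_poly (g + h) = weyl_poly g + weyl_poly h"
  by (rule weyl_eqI) (simp add: weyl_apply_simps algebra_simps)

lemma weyl_poly_mult: "weyl_poly (g * h) = weyl_poly g * weyl_poly h"
  by (rule weyl_eqI) (simp add: weyl_apply_simps algebra_simps)

lemma weyl_poly_1: "weyl_poly 1 = 1"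
  by (rule weyl_eqI) (simp add: weyl_apply_simps)

lemma weyl_poly_0: "weyl_poly 0 = 0"
  by (rule weyl_eqI) (simp add: weyl_apply_simps)

lemma weyl_poly_power: "weyl_poly (g ^ n) = weyl_poly g ^ n"
  by (induction n) (simp_all add: weyl_poly_1 weyl_poly_mult)

lemma weyl_pd_poly: "weyl_pd i * weyl_poly g = weyl_poly g * weyl_pd i + weyl_poly (mpderiv i g)"
  by (rule weyl_eqI) (simp add: weyl_apply_simps mpderiv_mult algebra_simps)

lemma weyl_pd_commute: "weyl_pd i * weyl_pd j = (weyl_pd j * weyl_pd i :: ('k::field_char_0, 'n) weyl)"
proof (rule weyl_eqI)
  fix h :: "('k, 'n) mpoly"
  have "mpderiv i (mpderiv j h) = mpderiv j (mpderiv i h)"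
  proof (induction h rule: mpoly_induct)
    case (single m c)
    have "m - Poly_Mapping.single i 1 - Poly_Mapping.single j 1 =
        m - Poly_Mapping.single j 1 - Poly_Mapping.single i (1::nat)"
      by (rule poly_mapping_eqI) (simp add: lookup_minus)
    then show ?case
      by (cases "i = j") (simp_all add: mpderiv_single lookup_minus lookup_single algebra_simps)
  qed (simp add: mpderiv_add)
  then show "weyl_apply (weyl_pd i * weyl_pd j) h = weyl_apply (weyl_pd j * weyl_pd i) h"
    by (simp add: weyl_apply_simps)
qed

lemma power_commute_aux:
  fixes a b :: "'r::monoid_mult"
  assumes "a * b = b * a"
  shows "a ^ k * b ^ l = b ^ l * a ^ k"
proof -
  have "a ^ k * b = b * a ^ k" for k
    by (induction k) (simp_all add: assms mult.assoc, metis assms mult.assoc)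
  then show ?thesis
    by (induction l) (simp_all, metis mult.assoc)
qed

lemma nfold_commute:
  fixes \<theta> :: "'n \<Rightarrow> 'r::ring_1"
  assumes "\<And>i j. \<theta> i * \<theta> j = \<theta> j * \<theta> i"
  shows "comp_fun_commute (\<lambda>i A. \<theta> i ^ e i * A)"
proof
  show "(\<lambda>A. \<theta> j ^ e j * A) \<circ> (\<lambda>A. \<theta> i ^ e i * A) = (\<lambda>A. \<theta> i ^ e i * A) \<circ> (\<lambda>A. \<theta> j ^ e j * A)" for i j
    using power_commute_aux[OF assms, of i "e i" j "e j"]
    by (simp add: fun_eq_iff mult.assoc[symmetric])
qed

lemma npow_Suc:
  assumes "\<And>i j. \<theta> i * \<theta> j = \<theta> j * \<theta> i"
  shows "\<theta> j * npow \<theta> e = npow \<theta> (e(j := Suc (e j)))"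
proof -
  interpret a: comp_fun_commute "\<lambda>i A. \<theta> i ^ e i * A" by (rule nfold_commute[OF assms])
  let ?e = "e(j := Suc (e j))"
  interpret b: comp_fun_commute "\<lambda>i A. \<theta> i ^ ?e i * A" by (rule nfold_commute[OF assms])
  have "npow \<theta> e = \<theta> j ^ e j * Finite_Set.fold (\<lambda>i A. \<theta> i ^ e i * A) 1 (UNIV - {j})"
    unfolding npow_def by (rule a.fold_rec) auto
  moreover have "npow \<theta> ?e = \<theta> j ^ ?e j * Finite_Set.fold (\<lambda>i A. \<theta> i ^ ?e i * A) 1 (UNIV - {j})"
    unfolding npow_def by (rule b.fold_rec) auto
  moreover have "Finite_Set.fold (\<lambda>i A. \<theta> i ^ ?e i * A) 1 B = Finite_Set.fold (\<lambda>i A. \<theta> i ^ e i * A) 1 B"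
    if "finite B" "j \<notin> B" for B
    using that
  proof (induction B)
    case (insert x B)
    have "Finite_Set.fold (\<lambda>i A. \<theta> i ^ ?e i * A) 1 (insert x B) =
        \<theta> x ^ ?e x * Finite_Set.fold (\<lambda>i A. \<theta> i ^ ?e i * A) 1 B"
      by (rule b.fold_insert) (use insert in auto)
    moreover have "Finite_Set.fold (\<lambda>i A. \<theta> i ^ e i * A) 1 (insert x B) =
        \<theta> x ^ e x * Finite_Set.fold (\<lambda>i A. \<theta> i ^ e i * A) 1 B"
      by (rule a.fold_insert) (use insert in auto)
    moreover have "x \<noteq> j" using insert by blast
    ultimately show ?case using insert by simp
  qed simp
  ultimately show ?thesis by (simp add: mult.assoc)
qed

lemma npow_0: "npow \<theta> (\<lambda>_. 0) = 1"
proof -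
  have c: "comp_fun_commute_on UNIV (\<lambda>i A. \<theta> i ^ 0 * A)"
    by standard (simp add: fun_eq_iff)
  have "Finite_Set.fold (\<lambda>i A. \<theta> i ^ 0 * A) 1 B = 1" if "finite B" for B
    using that
  proof induction
    case empty
    show ?case by (rule Finite_Set.fold_empty)
  next
    case (insert x B)
    have "Finite_Set.fold (\<lambda>i A. \<theta> i ^ 0 * A) 1 (insert x B) =
        \<theta> x ^ 0 * Finite_Set.fold (\<lambda>i A. \<theta> i ^ 0 * A) 1 B"
      by (rule comp_fun_commute_on.fold_insert[OF c subset_UNIV insert.hyps])
    then show ?case using insert.IH by (simp only: power_0 mult_1)
  qed
  from this[OF finite] show ?thesis unfolding npow_def .
qed

lemma npow_weyl_var:
  "npow (weyl_var :: 'n::finite \<Rightarrow> ('k::field_char_0, 'n) weyl) e = weyl_poly (\<Prod>i\<in>UNIV. mvar i ^ e i)"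
proof -
  have c: "weyl_var i * weyl_var j = (weyl_var j * weyl_var i :: ('k, 'n) weyl)" for i j
    by (simp add: mult.commute flip: weyl_poly_mult)
  interpret comp_fun_commute "\<lambda>i A. (weyl_var i :: ('k, 'n) weyl) ^ e i * A"
    by (rule nfold_commute[OF c])
  have "Finite_Set.fold (\<lambda>i A. (weyl_var i :: ('k, 'n) weyl) ^ e i * A) 1 B = weyl_poly (\<Prod>i\<in>B. mvar i ^ e i)"
    if "finite B" for B
    using that by (induction B) (simp_all add: weyl_poly_1 weyl_poly_mult weyl_poly_power)
  then show ?thesis by (simp add: npow_def)
qed

lemma single_power_one:
  "Poly_Mapping.single (Poly_Mapping.single i (1::nat)) (1::'k::comm_ring_1) ^ n =
   Poly_Mapping.single (Poly_Mapping.single i n) 1"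
  by (induction n) (simp_all add: mult_single flip: single_add)

definition of_exponents :: "('n::finite \<Rightarrow> nat) \<Rightarrow> 'n \<Rightarrow>\<^sub>0 nat" where
  "of_exponents e = (\<Sum>i\<in>UNIV. Poly_Mapping.single i (e i))"

lemma lookup_of_exponents [simp]: "Poly_Mapping.lookup (of_exponents e) = e"
  by (rule ext) (simp add: of_exponents_def lookup_sum lookup_single when_def)

lemma of_exponents_lookup [simp]: "of_exponents (Poly_Mapping.lookup m) = m"
  by (rule poly_mapping_eqI) simp

lemma prod_mvar: "(\<Prod>i\<in>UNIV. mvar i ^ e i) = Poly_Mapping.single (of_exponents e) (1::'k::comm_ring_1)"
proof -
  have "(\<Prod>i\<in>B. mvar i ^ e i) = Poly_Mapping.single (\<Sum>i\<in>B. Poly_Mapping.single i (e i)) (1::'k)"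
    if "finite B" for B
    using that by (induction B) (simp_all add: mvar_def single_power_one[unfolded One_nat_def] mult_single)
  then show ?thesis by (simp add: of_exponents_def)
qed

lemma const_npow_weyl_var:
  "weyl_const c * npow weyl_var e = weyl_poly (Poly_Mapping.single (of_exponents e) c)"
  by (simp add: npow_weyl_var prod_mvar mconst_def mult_single flip: weyl_poly_mult)

lemma normal_ordered_alt:
  "normal_ordered p = (\<Sum>m\<in>Poly_Mapping.keys p.
     weyl_poly (Poly_Mapping.single (of_exponents (\<lambda>i. Poly_Mapping.lookup m (Inl i))) (Poly_Mapping.lookup p m)) *
     npow weyl_pd (\<lambda>i. Poly_Mapping.lookup m (Inr i)))"
  by (simp add: normal_subst_def const_npow_weyl_var)

lemma normal_ordered_add: "normal_ordered (p + q) = normal_ordered p + normal_ordered q"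
  unfolding normal_ordered_alt
  by (rule keys_sum_add) (simp_all add: weyl_poly_0 single_add weyl_poly_add distrib_right)

lemma normal_ordered_single:
  "normal_ordered (Poly_Mapping.single m c) =
     weyl_poly (Poly_Mapping.single (of_exponents (\<lambda>i. Poly_Mapping.lookup m (Inl i))) c) *
     npow weyl_pd (\<lambda>i. Poly_Mapping.lookup m (Inr i))"
  by (cases "c = 0") (simp_all add: normal_ordered_alt weyl_poly_0)

lemma weyl_poly_npow_in_range: "weyl_poly g * npow weyl_pd e \<in> range normal_ordered"
proof (induction g rule: mpoly_induct)
  case (single m c)
  have "weyl_poly (Poly_Mapping.single m c) * npow weyl_pd e =
    normal_ordered (Poly_Mapping.single (of_exponents (case_sum (Poly_Mapping.lookup m) e)) c)"
    by (simp add: normal_ordered_single)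
  then show ?case by blast
next
  case (add p q)
  then obtain a b where "weyl_poly p * npow weyl_pd e = normal_ordered a"
      "weyl_poly q * npow weyl_pd e = normal_ordered b" by blast
  then have "weyl_poly (p + q) * npow weyl_pd e = normal_ordered (a + b)"
    by (simp add: normal_ordered_add weyl_poly_add distrib_right)
  then show ?case by blast
qed

lemma range_normal_ordered_add:
  "P \<in> range normal_ordered \<Longrightarrow> Q \<in> range normal_ordered \<Longrightarrow> P + Q \<in> range normal_ordered"
  by (elim rangeE, hypsubst) (simp only: normal_ordered_add[symmetric] rangeI)

lemma weyl_mult_in_range:
  "A \<in> weyl_ops \<Longrightarrow> Q \<in> range normal_ordered \<Longrightarrow> Weyl A * Q \<in> range normal_ordered"
proof (induction arbitrary: Q rule: weyl_ops.induct)
  case (mult g)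
  have W: "Weyl (\<lambda>h. g * h) = weyl_poly g" by (simp add: weyl_poly_def)
  from mult obtain q where q: "Q = normal_ordered q" by blast
  have "weyl_poly g * normal_ordered q \<in> range normal_ordered"
  proof (induction q rule: mpoly_induct)
    case (single m c)
    show ?case
      unfolding normal_ordered_single mult.assoc[symmetric] weyl_poly_mult[symmetric]
      by (rule weyl_poly_npow_in_range)
  next
    case (add p q)
    then show ?case by (simp add: normal_ordered_add distrib_left range_normal_ordered_add)
  qed
  then show ?case by (simp add: W q)
next
  case (pderiv i)
  have W: "Weyl (mpderiv i) = weyl_pd i" by (simp add: weyl_pd_def)
  from pderiv obtain q where q: "Q = normal_ordered q" by blast
  have "weyl_pd i * normal_ordered q \<in> range normal_ordered"
  proof (induction q rule: mpoly_induct)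
    case (single m c)
    have *: "weyl_pd i * (weyl_poly g * npow weyl_pd e) =
      weyl_poly g * npow weyl_pd (e(i := Suc (e i))) + weyl_poly (mpderiv i g) * npow weyl_pd e"
      for g e
    proof -
      have "weyl_pd i * (weyl_poly g * npow weyl_pd e) =
        weyl_poly g * (weyl_pd i * npow weyl_pd e) + weyl_poly (mpderiv i g) * npow weyl_pd e"
        by (simp add: weyl_pd_poly algebra_simps flip: mult.assoc)
      then show ?thesis by (simp add: npow_Suc weyl_pd_commute)
    qed
    show ?case
      unfolding normal_ordered_single *
      by (intro range_normal_ordered_add weyl_poly_npow_in_range)
  next
    case (add p q)
    then show ?case by (simp add: normal_ordered_add distrib_left range_normal_ordered_add)
  qed
  then show ?case by (simp add: W q)
next
  case (add A B)
  have eq: "Weyl (\<lambda>h. A h + B h) = Weyl A + Weyl B"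
    by (rule plus_weyl.abs_eq[symmetric]) (simp_all add: eq_onp_def add.hyps)
  show ?case
    unfolding eq distrib_right
    by (rule range_normal_ordered_add[OF add.IH(1)[OF add.prems] add.IH(2)[OF add.prems]])
next
  case (comp A B)
  have eq: "Weyl (\<lambda>h. A (B h)) = Weyl A * Weyl B"
    by (rule times_weyl.abs_eq[symmetric]) (simp_all add: eq_onp_def comp.hyps)
  show ?case
    unfolding eq mult.assoc by (rule comp.IH(1)[OF comp.IH(2)[OF comp.prems]])
qed

lemma surj_normal_ordered:
  "surj (normal_ordered :: _ \<Rightarrow> ('k::field_char_0, 'n::finite) weyl)"
proof -
  have "npow weyl_pd (\<lambda>_. 0) = (1 :: ('k, 'n) weyl)"
    by (rule npow_0)
  then have one: "(1 :: ('k, 'n) weyl) \<in> range normal_ordered"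
    using weyl_poly_npow_in_range[of "1 :: ('k, 'n) mpoly" "\<lambda>_. 0"]
    by (simp only: weyl_poly_1 mult_1)
  have "P \<in> range normal_ordered" for P :: "('k, 'n) weyl"
    using weyl_mult_in_range[OF weyl_apply one, of P] by (simp only: weyl_apply_inverse mult_1_right)
  then show ?thesis by (rule UNIV_eq_I[symmetric])
qed

lemma weyl_apply_pd_power:
  "weyl_apply (weyl_pd i ^ k) (Poly_Mapping.single m c) =
   Poly_Mapping.single (m - Poly_Mapping.single i k)
     ((\<Prod>l<k. of_nat (Poly_Mapping.lookup m i - l)) * c)"
proof (induction k)
  case (Suc k)
  have "m - Poly_Mapping.single i k - Poly_Mapping.single i 1 = m - Poly_Mapping.single i (Suc k)"
    by (rule poly_mapping_eqI) (simp add: lookup_minus lookup_single when_def)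
  with Suc show ?case
    by (simp add: weyl_apply_simps mpderiv_single lookup_minus algebra_simps)
qed (simp add: weyl_apply_simps)

lemma weyl_apply_npow_pd:
  fixes c :: "'k::field_char_0" and m :: "'n::finite \<Rightarrow>\<^sub>0 nat"
  shows "weyl_apply (npow weyl_pd e) (Poly_Mapping.single m c) =
   Poly_Mapping.single (m - of_exponents e)
     ((\<Prod>i\<in>UNIV. \<Prod>l<e i. of_nat (Poly_Mapping.lookup m i - l)) * c)"
proof -
  interpret comp_fun_commute "\<lambda>i A. (weyl_pd i :: ('k, 'n) weyl) ^ e i * A"
    by (rule nfold_commute) (rule weyl_pd_commute)
  have "weyl_apply (Finite_Set.fold (\<lambda>i A. weyl_pd i ^ e i * A) 1 B) (Poly_Mapping.single m c) =
   Poly_Mapping.single (m - (\<Sum>i\<in>B. Poly_Mapping.single i (e i)))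
     ((\<Prod>i\<in>B. \<Prod>l<e i. of_nat (Poly_Mapping.lookup m i - l)) * c)" if "finite B" for B
    using that
  proof induction
    case (insert i B)
    have "Poly_Mapping.lookup (\<Sum>j\<in>B. Poly_Mapping.single j (e j)) i = 0"
      using insert.hyps by (auto simp: lookup_sum lookup_single when_def intro!: sum.neutral)
    moreover have "m - (\<Sum>j\<in>B. Poly_Mapping.single j (e j)) - Poly_Mapping.single i (e i) =
        m - (Poly_Mapping.single i (e i) + (\<Sum>j\<in>B. Poly_Mapping.single j (e j)))"
      by (rule poly_mapping_eqI) (simp add: lookup_minus lookup_add)
    ultimately show ?case
      using insert
      by (simp add: weyl_apply_simps weyl_apply_pd_power lookup_minus mult.assoc)
  qed (simp add: weyl_apply_simps)
  then show ?thesis by (simp add: npow_def of_exponents_def)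
qed

lemma normal_ordered_eq_0:
  fixes p :: "('k::field_char_0, 'n::finite + 'n) mpoly"
  assumes "normal_ordered p = 0"
  shows "p = 0"
proof (rule ccontr)
  assume "p \<noteq> 0"
  define ex where "ex m = (\<lambda>i :: 'n. Poly_Mapping.lookup m (Inl i :: 'n + 'n) :: nat)" for m
  define ez where "ez m = (\<lambda>i :: 'n. Poly_Mapping.lookup m (Inr i :: 'n + 'n) :: nat)" for m
  define deg where "deg m = (\<Sum>i\<in>UNIV. ez m i)" for m
  obtain m0 where m0: "m0 \<in> Poly_Mapping.keys p"
      "\<And>m. m \<in> Poly_Mapping.keys p \<Longrightarrow> deg m0 \<le> deg m"
    using \<open>p \<noteq> 0\<close> ex_has_least_nat[of "\<lambda>m. m \<in> Poly_Mapping.keys p" _ deg]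
    by (metis keys_eq_empty ex_in_conv)
  define F :: 'k where "F = (\<Prod>i\<in>UNIV. \<Prod>l<ez m0 i. of_nat (ez m0 i - l))"
  have "F \<noteq> 0" by (auto simp: F_def)
  have coef: "Poly_Mapping.lookup (weyl_apply (weyl_poly (Poly_Mapping.single (of_exponents (ex m)) c) *
        npow weyl_pd (ez m)) (Poly_Mapping.single (of_exponents (ez m0)) 1)) (of_exponents (ex m0)) =
      (if m = m0 then c * F else 0)" if mk: "m \<in> Poly_Mapping.keys p" for m c
  proof (cases "ez m = ez m0")
    case True
    have "ex m = ex m0 \<longleftrightarrow> m = m0"
    proof
      assume *: "ex m = ex m0"
      show "m = m0"
      proof (rule poly_mapping_eqI)
        show "Poly_Mapping.lookup m k = Poly_Mapping.lookup m0 k" for k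
          using fun_cong[OF *] fun_cong[OF True] by (cases k) (auto simp: ex_def ez_def)
      qed
    qed simp
    moreover have "of_exponents (ex m) = of_exponents (ex m0) \<longleftrightarrow> ex m = ex m0"
      by (metis lookup_of_exponents)
    ultimately show ?thesis
      by (simp add: weyl_apply_simps weyl_apply_npow_pd True mult_single F_def lookup_single when_def)
  next
    case False
    obtain i where i: "ez m i > ez m0 i"
    proof (rule ccontr)
      assume "\<not> thesis"
      then have le: "ez m i \<le> ez m0 i" for i using that by (meson not_le)
      moreover from False obtain j where "ez m j \<noteq> ez m0 j" by blast
      ultimately have "ez m j < ez m0 j" by (simp add: le_neq_implies_less)
      then have "deg m < deg m0"
        unfolding deg_def using le by (intro sum_strict_mono_ex1) auto
      with m0(2)[OF mk] show False by simp
    qed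
    have "(\<Prod>l<ez m i. of_nat (ez m0 i - l)) = (0::'k)"
      using i by (intro prod_zero) auto
    then have "(\<Prod>i\<in>UNIV. \<Prod>l<ez m i. of_nat (ez m0 i - l)) = (0::'k)"
      by (intro prod_zero) auto
    then have "weyl_apply (npow weyl_pd (ez m)) (Poly_Mapping.single (of_exponents (ez m0)) 1) =
        (0 :: ('k, 'n) mpoly)"
      by (simp only: weyl_apply_npow_pd lookup_of_exponents mult_zero_left single_zero)
    with False show ?thesis
      by (auto simp: weyl_apply_simps)
  qed
  have "0 = Poly_Mapping.lookup (weyl_apply (normal_ordered p)
      (Poly_Mapping.single (of_exponents (ez m0)) 1)) (of_exponents (ex m0))"
    using assms by (simp add: weyl_apply_simps)
  also have "\<dots> = (\<Sum>m\<in>Poly_Mapping.keys p. if m = m0 then Poly_Mapping.lookup p m * F else 0)"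
    unfolding normal_ordered_alt weyl_apply_sum lookup_sum
    by (rule sum.cong[OF refl]) (use coef in \<open>simp only: ex_def ez_def\<close>)
  also have "\<dots> = Poly_Mapping.lookup p m0 * F"
    using m0(1) by simp
  finally show False
    using \<open>F \<noteq> 0\<close> m0(1) by (simp add: in_keys_iff)
qed

lemma ex1_total_symbol:
  fixes P :: "('k::field_char_0, 'n::finite) weyl"
  shows "\<exists>!p. normal_ordered p = P"
proof -
  obtain p where p: "normal_ordered p = P"
    using surj_normal_ordered[THEN surjD, of P] by metis
  have "q = p" if "normal_ordered q = P" for q
  proof -
    have "normal_ordered (q + (- p)) + normal_ordered p = normal_ordered q"
      by (simp flip: normal_ordered_add)
    then have "normal_ordered (q + (- p)) = 0"
      using that p by simp
    from normal_ordered_eq_0[OF this] show ?thesis by simp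
  qed
  then show ?thesis by (intro ex1I[of _ p] p)
qed

section \<open>Left modules over Weyl algebras\<close>

locale left_module = abelian_group M for M :: "('r::ring_1, 'm) module" (structure) +
  assumes smult_closed: "x \<in> carrier M \<Longrightarrow> a \<odot> x \<in> carrier M"
    and smult_l_distr: "x \<in> carrier M \<Longrightarrow> (a + b) \<odot> x = a \<odot> x \<oplus> b \<odot> x"
    and smult_r_distr: "x \<in> carrier M \<Longrightarrow> y \<in> carrier M \<Longrightarrow> a \<odot> (x \<oplus> y) = a \<odot> x \<oplus> a \<odot> y"
    and smult_assoc: "x \<in> carrier M \<Longrightarrow> (a * b) \<odot> x = a \<odot> (b \<odot> x)"
    and smult_one: "x \<in> carrier M \<Longrightarrow> 1 \<odot> x = x"

definition annihilator :: "('r::ring_1, 'm) module \<Rightarrow> 'm \<Rightarrow> 'r set" where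
  "annihilator M u = {P. P \<odot>\<^bsub>M\<^esub> u = \<zero>\<^bsub>M\<^esub>}"

definition left_ideal :: "'r::ring_1 set \<Rightarrow> bool" where
  "left_ideal J \<longleftrightarrow> 0 \<in> J \<and> (\<forall>a\<in>J. \<forall>b\<in>J. a + b \<in> J) \<and> (\<forall>r. \<forall>a\<in>J. r * a \<in> J)"

text \<open>For a left ideal \<open>J\<close> of a ring \<open>R\<close>: the left module \<open>R / J\<close>, whose elements are the cosets
  of \<open>J\<close>. The multiplicative fields of the record have no meaning for a module.\<close>

definition quotient_module :: "'r::ring_1 set \<Rightarrow> ('r, 'r set) module" where
  "quotient_module J =
     \<lparr>carrier = {(\<lambda>j. a + j) ` J |a. True},
      monoid.mult = undefined, one = undefined,
      zero = J, add = (\<lambda>A B. {a + b |a b. a \<in> A \<and> b \<in> B}),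
      module.smult = (\<lambda>r A. {r * a + j |a j. a \<in> A \<and> j \<in> J})\<rparr>"

text \<open>The elements \<open>\<Sum>s\<in>S. P\<^sub>s s\<close> of \<open>M\<close> with scalars \<open>P\<^sub>s\<close> from \<open>F\<close>.\<close>

definition combinations :: "('r::ring_1, 'm) module \<Rightarrow> 'r set \<Rightarrow> 'm set \<Rightarrow> 'm set" where
  "combinations M F S = {\<Oplus>\<^bsub>M\<^esub>s\<in>S. P s \<odot>\<^bsub>M\<^esub> s |P. P \<in> S \<rightarrow> F}"

definition generating_set :: "('r::ring_1, 'm) module \<Rightarrow> 'm set \<Rightarrow> bool" where
  "generating_set M S \<longleftrightarrow> finite S \<and> S \<subseteq> carrier M \<and> carrier M = combinations M UNIV S"

text \<open>The filtration by the order of differential operators, which is \<open>{0}\<close> in negative degrees.\<close>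

definition order_filtration :: "int \<Rightarrow> ('k::field_char_0, 'n::finite) weyl set" where
  "order_filtration k = {P. \<forall>m\<in>Poly_Mapping.keys (total_symbol P).
     (\<Sum>i\<in>UNIV. int (Poly_Mapping.lookup m (Inr i))) \<le> k}"

text \<open>The class of \<open>P \<in> order_filtration k\<close> in the degree \<open>k\<close> part of the graded ring \<open>K[x, \<xi>]\<close> of the
  Weyl algebra; it is \<open>0\<close> if \<open>P\<close> has order less than \<open>k\<close>.\<close>

definition symbol ::
    "int \<Rightarrow> ('k::field_char_0, 'n::finite) weyl \<Rightarrow> ('k, 'n + 'n) mpoly" where
  "symbol k P = (\<Sum>m\<in>{m \<in> Poly_Mapping.keys (total_symbol P).
       (\<Sum>i\<in>UNIV. int (Poly_Mapping.lookup m (Inr i))) = k}.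
     Poly_Mapping.single m (Poly_Mapping.lookup (total_symbol P) m))"

text \<open>Geometric points, over an algebraic closure of \<open>'k\<close>. With the coordinates \<open>'n + 'n\<close> these are
  the points \<open>(x, \<xi>)\<close> of \<open>T\<^sup>*X\<close>.\<close>

type_synonym ('k, 'i) point = "'i \<Rightarrow> 'k alg_closure"

text \<open>The homogeneous elements of degree \<open>j\<close> of the annihilator of the graded module of \<open>M\<close>, with
  respect to the good filtration \<open>M\<^sub>k = \<Sum>s\<in>S. F\<^sub>k s\<close> given by the generating set \<open>S\<close>, are the symbols of
  the operators \<open>P\<close> of order at most \<open>j\<close> with \<open>P M\<^sub>k \<subseteq> M\<^bsub>k+j-1\<^esub>\<close> for all \<open>k\<close>.\<close>

definition gr_annihilator ::
    "(('k::field_char_0, 'n::finite) weyl, 'm) module \<Rightarrow> 'm set \<Rightarrow> ('k, 'n + 'n) mpoly set" where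
  "gr_annihilator M S = {symbol j P |j P. P \<in> order_filtration j \<and>
     (\<forall>k. \<forall>x\<in>combinations M (order_filtration k) S.
        P \<odot>\<^bsub>M\<^esub> x \<in> combinations M (order_filtration (k + j - 1)) S)}"

text \<open>The characteristic variety of a finitely generated module, as the set of its geometric points;
  it does not depend on the choice of the generating set.\<close>

definition char_variety ::
    "(('k::field_char_0, 'n::finite) weyl, 'm) module \<Rightarrow> ('k, 'n + 'n) point set" where
  "char_variety M =
     {z. \<forall>a\<in>gr_annihilator M (SOME S. generating_set M S). meval to_ac z a = 0}"


section \<open>Dimension\<close>

definition zero_locus :: "('l::field, 'i::finite) mpoly set \<Rightarrow> ('i \<Rightarrow> 'l) set" where
  "zero_locus A = {z. \<forall>p\<in>A. meval (\<lambda>c. c) z p = 0}"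

definition zariski :: "('i::finite \<Rightarrow> 'l::field) topology" where
  "zariski = topology (\<lambda>U. \<exists>A. U = - zero_locus A)"

lemma meval_mult:
  fixes p q :: "('l::comm_ring_1, 'i::finite) mpoly"
  shows "meval (\<lambda>c. c) z (p * q) = meval (\<lambda>c. c) z p * meval (\<lambda>c. c) z q"
proof -
  have add: "meval (\<lambda>c. c) z (p + q) = meval (\<lambda>c. c) z p + meval (\<lambda>c. c) z q" for p q :: "('l, 'i) mpoly"
    unfolding meval_def by (rule keys_sum_add) (simp_all add: distrib_right)
  have eval_single: "meval (\<lambda>c. c) z (Poly_Mapping.single m c) = c * (\<Prod>i\<in>UNIV. z i ^ Poly_Mapping.lookup m i)"
    for m and c :: 'l
    by (cases "c = 0") (simp_all add: meval_def)
  show ?thesis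
  proof (induction p rule: mpoly_induct)
    case (single m c)
    show ?case
    proof (induction q rule: mpoly_induct)
      case (single m' c')
      show ?case
        by (simp add: mult_single eval_single lookup_add power_add prod.distrib algebra_simps)
    qed (simp add: add algebra_simps)
  qed (simp add: add algebra_simps)
qed

lemma closedin_zariski:
  fixes V :: "('i::finite \<Rightarrow> 'l::field) set"
  shows "closedin zariski V \<longleftrightarrow> (\<exists>A. V = zero_locus A)"
proof -
  have "istopology (\<lambda>U :: ('i \<Rightarrow> 'l) set. \<exists>A. U = - zero_locus A)"
    unfolding istopology_def
  proof (intro conjI allI impI)
    fix S T :: "('i \<Rightarrow> 'l) set"
    assume "\<exists>A. S = - zero_locus A" "\<exists>A. T = - zero_locus A"
    then obtain A B where "S = - zero_locus A" "T = - zero_locus B" by blast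
    then have "S \<inter> T = - zero_locus {p * q |p q. p \<in> A \<and> q \<in> B}"
      by (fastforce simp: zero_locus_def meval_mult)
    then show "\<exists>A. S \<inter> T = - zero_locus A" by blast
  next
    fix K :: "('i \<Rightarrow> 'l) set set"
    assume "\<forall>U\<in>K. \<exists>A. U = - zero_locus A"
    then obtain A where "\<forall>U\<in>K. U = - zero_locus (A U)" by metis
    then have "\<Union>K = - zero_locus (\<Union>U\<in>K. A U)"
      by (auto simp: zero_locus_def)
    then show "\<exists>A. \<Union>K = - zero_locus A" by blast
  qed
  then have op: "openin zariski U \<longleftrightarrow> (\<exists>A. U = - zero_locus A)" for U :: "('i \<Rightarrow> 'l) set"
    by (simp add: zariski_def)
  have "zero_locus {1 :: ('l, 'i) mpoly} = {}"
    by (simp add: zero_locus_def meval_def)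
  then have "openin zariski (UNIV :: ('i \<Rightarrow> 'l) set)"
    unfolding op by (metis Compl_empty_eq)
  then have top: "topspace zariski = (UNIV :: ('i \<Rightarrow> 'l) set)"
    by (metis openin_subset top.extremum_uniqueI)
  have "closedin zariski V \<longleftrightarrow> openin zariski (- V)"
    by (simp add: closedin_def top Compl_eq_Diff_UNIV)
  then show ?thesis
    by (simp only: op Compl_eq_Compl_iff)
qed

definition irreducible_closed :: "'a topology \<Rightarrow> 'a set \<Rightarrow> bool" where
  "irreducible_closed T Z \<longleftrightarrow> closedin T Z \<and> Z \<noteq> {} \<and>
     (\<forall>A B. closedin T A \<and> closedin T B \<and> Z = A \<union> B \<longrightarrow> Z = A \<or> Z = B)"

text \<open>The Krull dimension of a topological space; it is \<open>-\<infinity>\<close> for the empty space.\<close>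

definition krull_dim :: "'a topology \<Rightarrow> ereal" where
  "krull_dim T = Sup {ereal (real d) |d. \<exists>Z :: nat \<Rightarrow> 'a set.
     (\<forall>i\<le>d. irreducible_closed T (Z i)) \<and> (\<forall>i<d. Z i \<subset> Z (Suc i))}"

definition alg_dim :: "('i::finite \<Rightarrow> 'l::field) set \<Rightarrow> ereal" where
  "alg_dim V = krull_dim (subtopology zariski V)"

text \<open>The dimension of a module is that of its characteristic variety.\<close>

definition holonomic :: "(('k::field_char_0, 'n::finite) weyl, 'm) module \<Rightarrow> bool" where
  "holonomic M \<longleftrightarrow> left_module M \<and> (\<exists>S. generating_set M S) \<and>
     (carrier M = {\<zero>\<^bsub>M\<^esub>} \<or> alg_dim (char_variety M) = ereal (real CARD('n)))"

definition cotangent_proj :: "('k::field, 'n + 'n) point \<Rightarrow> ('k, 'n) point" where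
  "cotangent_proj z = (\<lambda>i. z (Inl i))"

definition principal_open :: "('k::field, 'n::finite) mpoly \<Rightarrow> ('k, 'n) point set" where
  "principal_open f = {x. meval to_ac x f \<noteq> 0}"

text \<open>The intersection has to have dimension exactly \<open>CARD('n)\<close>; in particular it is not empty.\<close>

definition holonomic_on_open ::
    "('k::field_char_0, 'n::finite) mpoly \<Rightarrow> (('k, 'n) weyl, 'm) module \<Rightarrow> bool" where
  "holonomic_on_open f M \<longleftrightarrow>
     alg_dim (char_variety M \<inter> cotangent_proj -` principal_open f) = ereal (real CARD('n))"


section \<open>The homomorphism from \<open>D\<^sub>X\<close> to \<open>D\<^sub>Y\<close>\<close>

text \<open>The variables of \<open>Y = X \<times> K\<close> are indexed by \<open>'n option\<close>, with \<open>Some i\<close> for \<open>x\<^sub>i\<close> and \<open>None\<close>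
  for \<open>t\<close>.\<close>

abbreviation weyl_t :: "('k::field_char_0, 'n option) weyl" where
  "weyl_t \<equiv> weyl_var None"

definition weyl_pullback ::
    "('k::field_char_0, 'n::finite) mpoly \<Rightarrow> ('k, 'n option) weyl" where
  "weyl_pullback g = weyl_poly (meval mconst (\<lambda>i. mvar (Some i)) g)"

definition vartheta ::
    "('k::field_char_0, 'n::finite) mpoly \<Rightarrow> 'n \<Rightarrow> ('k, 'n option) weyl" where
  "vartheta f i = weyl_pd (Some i) - weyl_pullback (mpderiv i f) * weyl_pd None * weyl_t ^ 2"

text \<open>\<open>\<tau>(P(x, \<partial>)) = P(x, \<vartheta>)\<close>; the \<open>\<vartheta>\<^sub>i\<close> commute with each other.\<close>

definition tau ::
    "('k::field_char_0, 'n::finite) mpoly \<Rightarrow> ('k, 'n) weyl \<Rightarrow> ('k, 'n option) weyl" where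
  "tau f P = normal_subst weyl_const (\<lambda>i. weyl_var (Some i)) (vartheta f) (total_symbol P)"

end

theory Submission
  imports Defs
begin

text \<open>
  The module \<open>D\<^sub>Y/J\<close> is the direct image of the localization \<open>M[1/f]\<close> under the closed embedding
  \<open>x \<mapsto> (x, 1/f(x))\<close> of \<open>X\<^sub>f\<close> into \<open>Y\<close>, and its characteristic variety can be computed directly. Every
  element of \<open>D\<^sub>Y\<close> is a combination of the \<open>\<partial>\<^sub>t\<^sup>k t\<^sup>l \<tau>(P)\<close>; for an element of \<open>J\<close> the coefficients
  \<open>\<Sum>\<^sub>l t\<^sup>l P\<^sub>k\<^sub>l\<close> of the \<open>\<partial>\<^sub>t\<^sup>k\<close> belong to \<open>I\<close> after substituting \<open>t = 1/f\<close> and clearing denominators, and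
  comparing leading symbols shows that they respect the order filtration. Therefore the
  characteristic variety of \<open>D\<^sub>Y/J\<close> consists of the \<open>(x, t, \<xi>, \<tau>)\<close> with \<open>t f(x) = 1\<close> and
  \<open>(x, \<xi> - t\<^sup>2 \<tau> df(x))\<close> in the characteristic variety of \<open>M\<close>, and is a trivial line bundle over the
  part of the latter above \<open>X\<^sub>f\<close>. So its dimension is exactly \<open>n + 1\<close>, and Bernstein's inequality is
  not needed.

  That a line bundle raises the Krull dimension by exactly one rests on the fact that the dimension is
  the transcendence degree. A chain of prime ideals yields algebraically independent elements, whose
  number is bounded by the growth of the number of independent monomials. Conversely, generic points
  of a coordinate space lift to the variety, which provides a chain of primes as long as the number
  of independent coordinates.
\<close>

section \<open>Transcendence degree by counting monomials\<close>

text \<open>Write \<open>\<delta>\<close> for the delta function along t = 1/f. On the generator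
  \<open>u \<delta>\<close> of the direct image, t acts as 1/f. Since 1/f has derivative
  \<open>- f\<^sub>i / f\<^sup>2\<close>, differentiation in \<open>x\<^sub>i\<close> sends
  \<open>u \<delta>\<close> to \<open>(\<partial>\<^sub>i u) \<delta>\<close> plus
  \<open>f\<^sub>i \<partial>\<^sub>t t\<^sup>2 (u \<delta>)\<close>. Hence
  \<open>vartheta f i\<close> differentiates only \<open>u\<close>, and \<open>tau f P\<close> acts
  on \<open>u \<delta>\<close> as \<open>P\<close> acts on \<open>u\<close>. The obstacle is that
  the symbols of generators of an ideal bound its characteristic variety only from above; for
  equality the symbol of every element of \<open>J\<close> must be understood. The terms of a normal
  form cannot cancel in leading order, because over a given \<open>(x, \<xi>)\<close> the
  coordinates t and \<open>\<tau>\<close> may still be chosen freely. The dimension theory stays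
  inside polynomial rings: relations are read modulo a prime ideal, and an element outside the ideal
  serves as a denominator. The set above \<open>X\<^sub>f\<close> is only locally closed, so an
  element \<open>b\<close> outside the primes is carried through the constructions to keep points
  and chains where f is nonzero.\<close>

text \<open>The elements of degree at most \<open>k\<close> in the subalgebra generated by \<open>C\<close>.\<close>

inductive falg_rel :: "('l \<Rightarrow> 'r::comm_ring_1) \<Rightarrow> 'r set \<Rightarrow> nat \<Rightarrow> 'r \<Rightarrow> bool" for \<kappa> C where
  const: "falg_rel \<kappa> C k (\<kappa> c)"
| gen: "g \<in> C \<Longrightarrow> falg_rel \<kappa> C (Suc k) g"
| add: "falg_rel \<kappa> C k x \<Longrightarrow> falg_rel \<kappa> C k y \<Longrightarrow> falg_rel \<kappa> C k (x + y)"
| mult: "falg_rel \<kappa> C k x \<Longrightarrow> falg_rel \<kappa> C l y \<Longrightarrow> falg_rel \<kappa> C (k + l) (x * y)"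

definition falg :: "('l \<Rightarrow> 'r::comm_ring_1) \<Rightarrow> 'r set \<Rightarrow> nat \<Rightarrow> 'r set" where
  "falg \<kappa> C k = {x. falg_rel \<kappa> C k x}"

lemma falg_const: "\<kappa> c \<in> falg \<kappa> C k"
  and falg_gen: "g \<in> C \<Longrightarrow> g \<in> falg \<kappa> C (Suc k)"
  and falg_add: "x \<in> falg \<kappa> C k \<Longrightarrow> y \<in> falg \<kappa> C k \<Longrightarrow> x + y \<in> falg \<kappa> C k"
  and falg_mult: "x \<in> falg \<kappa> C k \<Longrightarrow> y \<in> falg \<kappa> C l \<Longrightarrow> x * y \<in> falg \<kappa> C (k + l)"
  by (auto simp: falg_def intro: falg_rel.intros)

lemmas falg_intros = falg_const falg_gen falg_add falg_mult

lemma falg_induct [consumes 1, case_names const gen add mult, induct set: falg]: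
  assumes "x \<in> falg \<kappa> C k"
    and "\<And>k c. P k (\<kappa> c)" "\<And>g k. g \<in> C \<Longrightarrow> P (Suc k) g"
    and "\<And>k x y. x \<in> falg \<kappa> C k \<Longrightarrow> P k x \<Longrightarrow> y \<in> falg \<kappa> C k \<Longrightarrow> P k y \<Longrightarrow> P k (x + y)"
    and "\<And>k x l y. x \<in> falg \<kappa> C k \<Longrightarrow> P k x \<Longrightarrow> y \<in> falg \<kappa> C l \<Longrightarrow> P l y \<Longrightarrow> P (k + l) (x * y)"
  shows "P k x"
proof -
  from assms(1) have "falg_rel \<kappa> C k x" by (simp add: falg_def)
  then show ?thesis
    by induction (auto intro: assms(2-) simp: falg_def)
qed

lemma falg_mono:
  assumes "x \<in> falg \<kappa> C k" "C \<subseteq> C'" "k \<le> l"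
  shows "x \<in> falg \<kappa> C' l"
  using assms
proof (induction arbitrary: l rule: falg_induct)
  case (gen g k)
  then obtain l' where "l = Suc l'" by (cases l) auto
  with gen show ?case by (auto intro: falg_gen)
next
  case (mult k x m y)
  have "x * y \<in> falg \<kappa> C' (k + (l - k))"
    by (rule falg_mult) (use mult in \<open>auto\<close>)
  with mult.prems show ?case by simp
qed (auto intro: falg_intros)

lemma falg_add_ex: "x \<in> falg \<kappa> C k \<Longrightarrow> y \<in> falg \<kappa> C l \<Longrightarrow> \<exists>m. x + y \<in> falg \<kappa> C m"
  by (rule exI[of _ "max k l"], rule falg_add) (auto intro: falg_mono)

locale scalars =
  fixes \<kappa> :: "'l::field \<Rightarrow> 'r::comm_ring_1"
  assumes k_add: "\<kappa> (a + b) = \<kappa> a + \<kappa> b" and k_mult: "\<kappa> (a * b) = \<kappa> a * \<kappa> b"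
    and k_1: "\<kappa> 1 = 1"
begin

lemma k_0: "\<kappa> 0 = 0"
  using k_add[of 0 0] by simp

lemma k_uminus: "\<kappa> (- a) = - \<kappa> a"
  using k_add[of a "- a"] by (simp add: k_0 eq_neg_iff_add_eq_0 add.commute)

lemma falg_0: "0 \<in> falg \<kappa> C k" using falg_const[of \<kappa> 0] by (simp add: k_0)
lemma falg_1: "1 \<in> falg \<kappa> C k" using falg_const[of \<kappa> 1] by (simp add: k_1)

lemma falg_uminus: "x \<in> falg \<kappa> C k \<Longrightarrow> - x \<in> falg \<kappa> C k"
  using falg_mult[OF falg_const[of \<kappa> "-1" C 0]] by (fastforce simp: k_uminus k_1)

lemma falg_diff: "x \<in> falg \<kappa> C k \<Longrightarrow> y \<in> falg \<kappa> C k \<Longrightarrow> x - y \<in> falg \<kappa> C k"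
  using falg_add[OF _ falg_uminus] by fastforce

lemma falg_power: "x \<in> falg \<kappa> C k \<Longrightarrow> x ^ n \<in> falg \<kappa> C (n * k)"
  by (induction n) (auto intro: falg_1 falg_mult)

lemma falg_sum: "(\<And>a. a \<in> A \<Longrightarrow> f a \<in> falg \<kappa> C k) \<Longrightarrow> sum f A \<in> falg \<kappa> C k"
  by (induction A rule: infinite_finite_induct) (auto intro: falg_0 falg_add)

lemma falg_prod:
  "(\<And>a. a \<in> A \<Longrightarrow> f a \<in> falg \<kappa> C k) \<Longrightarrow> prod f A \<in> falg \<kappa> C (card A * k)"
  by (induction A rule: infinite_finite_induct) (auto intro: falg_1 falg_mult)

inductive_set powers_span :: "'r set \<Rightarrow> 'r \<Rightarrow> nat \<Rightarrow> 'r set" for C c k where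
  base: "r \<in> falg \<kappa> C k \<Longrightarrow> i \<le> k \<Longrightarrow> r * c ^ i \<in> powers_span C c k"
| add: "x \<in> powers_span C c k \<Longrightarrow> y \<in> powers_span C c k \<Longrightarrow> x + y \<in> powers_span C c k"

lemma powers_span_mult:
  assumes "x \<in> powers_span C c k" "y \<in> powers_span C c l"
  shows "x * y \<in> powers_span C c (k + l)"
  using assms(1)
proof induction
  case (base r i)
  note b = base
  show ?case using assms(2)
  proof induction
    case (base s j)
    have "(r * s) * c ^ (i + j) \<in> powers_span C c (k + l)"
      by (intro powers_span.base falg_mult) (use b base in auto)
    then show ?case by (simp add: power_add algebra_simps)
  qed (auto simp: distrib_left intro: powers_span.add)
qed (auto simp: distrib_right intro: powers_span.add)

text \<open>The exponent of \<open>c\<close> and the degree of its coefficient are bounded by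
  \<open>k\<close> separately, not together. This is generous, but it multiplies the number of
  spanning elements only by \<open>k + 1\<close>, which is what \<open>growth_insert\<close>
  allows.\<close>

lemma falg_insert_powers_span:
  "x \<in> falg \<kappa> (insert c C) k \<Longrightarrow> x \<in> powers_span C c k"
proof (induction rule: falg_induct)
  case (const k a)
  have "\<kappa> a * c ^ 0 \<in> powers_span C c k"
    by (intro powers_span.base falg_const) simp
  then show ?case by simp
next
  case (gen g k)
  have "1 * c ^ 1 \<in> powers_span C c (Suc k)"
    by (intro powers_span.base falg_1) simp
  moreover have "g * c ^ 0 \<in> powers_span C c (Suc k)" if "g \<in> C"
    using that by (intro powers_span.base falg_gen) auto
  ultimately show ?case using gen by auto
qed (auto intro: powers_span.add powers_span_mult)

text \<open>The generators index their own exponents, so independent elements form a set and need no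
  enumeration. The exponents used later lie in \<open>S \<rightarrow>\<^sub>E UNIV\<close>, so that
  distinct functions stand for distinct monomials.\<close>

definition monom_sum :: "'r set \<Rightarrow> ('r \<Rightarrow> nat) set \<Rightarrow> (('r \<Rightarrow> nat) \<Rightarrow> 'l) \<Rightarrow> 'r" where
  "monom_sum S F c = (\<Sum>\<alpha>\<in>F. \<kappa> (c \<alpha>) * (\<Prod>i\<in>S. i ^ \<alpha> i))"

end

text \<open>Gaussian elimination for a homogeneous system with more unknowns \<open>a\<close> than
  equations \<open>e\<close>: each induction step removes one equation and at most one
  unknown.\<close>

lemma linear_dependency:
  fixes m :: "'a \<Rightarrow> 'b \<Rightarrow> 'l::field"
  assumes "finite E" "finite F" "card E < card F"
  shows "\<exists>c. (\<exists>a\<in>F. c a \<noteq> 0) \<and> (\<forall>e\<in>E. (\<Sum>a\<in>F. c a * m a e) = 0)"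
  using assms
proof (induction E arbitrary: F m rule: finite_induct)
  case empty
  then have "F \<noteq> {}" by auto
  then show ?case by (intro exI[of _ "\<lambda>_. 1"]) auto
next
  case (insert e E)
  show ?case
  proof (cases "\<forall>a\<in>F. m a e = 0")
    case True
    have "card E < card F" using insert by simp
    from insert.IH[OF insert.prems(1) this, of m] obtain c
      where "\<exists>a\<in>F. c a \<noteq> 0" "\<forall>e\<in>E. (\<Sum>a\<in>F. c a * m a e) = 0" by blast
    with True show ?thesis by (intro exI[of _ c]) auto
  next
    case False
    then obtain b where b: "b \<in> F" "m b e \<noteq> 0" by blast
    \<comment> \<open>\<open>m'\<close> is the system after the equation \<open>e\<close> with pivot
      \<open>m b e\<close> has eliminated the unknown \<open>b\<close>; \<open>\<mu>\<close> below
      solves that equation for \<open>b\<close>.\<close>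
    define m' where "m' a e' = m a e' - m a e / m b e * m b e'" for a e'
    have "card E < card (F - {b})" using insert b by simp
    from insert.IH[OF _ this, of m'] insert.prems obtain c
      where l: "\<exists>a\<in>F-{b}. c a \<noteq> 0" "\<forall>e\<in>E. (\<Sum>a\<in>F-{b}. c a * m' a e) = 0" by auto
    define \<mu> where "\<mu> a = (if a = b then - (\<Sum>a\<in>F-{b}. c a * (m a e / m b e)) else c a)" for a
    have *: "(\<Sum>a\<in>F. \<mu> a * m a e') = (\<Sum>a\<in>F-{b}. c a * m' a e')" for e'
    proof -
      have "(\<Sum>a\<in>F. \<mu> a * m a e') = \<mu> b * m b e' + (\<Sum>a\<in>F-{b}. \<mu> a * m a e')"
        using b insert.prems by (simp add: sum.remove)
      also have "(\<Sum>a\<in>F-{b}. \<mu> a * m a e') = (\<Sum>a\<in>F-{b}. c a * m a e')"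
        by (rule sum.cong) (auto simp: \<mu>_def)
      also have "\<mu> b * m b e' = - (\<Sum>a\<in>F-{b}. c a * (m a e / m b e) * m b e')"
        by (simp add: \<mu>_def sum_distrib_right)
      finally show ?thesis
        by (simp add: m'_def right_diff_distrib sum_subtractf mult.assoc)
    qed
    have "m' a e = 0" for a using b by (simp add: m'_def)
    with l * have "\<forall>e'\<in>insert e E. (\<Sum>a\<in>F. \<mu> a * m a e') = 0" by simp
    moreover from l have "\<exists>a\<in>F. \<mu> a \<noteq> 0" by (auto simp: \<mu>_def)
    ultimately show ?thesis by blast
  qed
qed

section \<open>Subalgebras modulo a prime ideal and their growth\<close>

locale prime_ideal = scalars \<kappa> for \<kappa> :: "'l::field \<Rightarrow> 'r::comm_ring_1" +
  fixes I :: "'r set"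
  assumes zero_mem: "0 \<in> I" and add_mem: "x \<in> I \<Longrightarrow> y \<in> I \<Longrightarrow> x + y \<in> I"
    and mult_mem: "x \<in> I \<Longrightarrow> r * x \<in> I"
    and one_notin: "1 \<notin> I"
    and prime: "x * y \<in> I \<Longrightarrow> x \<in> I \<or> y \<in> I"
begin

lemma uminus_mem: "x \<in> I \<Longrightarrow> - x \<in> I"
  using mult_mem[of x "-1"] by simp

lemma diff_mem: "x \<in> I \<Longrightarrow> y \<in> I \<Longrightarrow> x - y \<in> I"
  using add_mem[OF _ uminus_mem] by fastforce

lemma mult_mem': "x \<in> I \<Longrightarrow> x * r \<in> I"
  using mult_mem[of x r] by (simp add: mult.commute)

lemma sum_mem: "(\<And>a. a \<in> A \<Longrightarrow> f a \<in> I) \<Longrightarrow> sum f A \<in> I"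
  by (induction A rule: infinite_finite_induct) (auto intro: zero_mem add_mem)

lemma power_notin: "x \<notin> I \<Longrightarrow> x ^ n \<notin> I"
  by (induction n) (use one_notin prime in auto)

inductive_set span_mod :: "'r set \<Rightarrow> 'r set" for E where
  ideal: "x \<in> I \<Longrightarrow> x \<in> span_mod E"
| gen: "e \<in> E \<Longrightarrow> \<kappa> c * e \<in> span_mod E"
| add: "x \<in> span_mod E \<Longrightarrow> y \<in> span_mod E \<Longrightarrow> x + y \<in> span_mod E"

lemma span_mod_coeffs:
  assumes "finite E" "x \<in> span_mod E"
  shows "\<exists>c. x - (\<Sum>e\<in>E. \<kappa> (c e) * e) \<in> I"
  using assms(2)
proof induction
  case (ideal x)
  then show ?case by (intro exI[of _ "\<lambda>_. 0"]) (simp add: k_0)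
next
  case (gen e c)
  have "(\<Sum>e'\<in>E. \<kappa> (if e' = e then c else 0) * e') = (\<Sum>e'\<in>E. if e' = e then \<kappa> c * e' else 0)"
    by (rule sum.cong) (auto simp: k_0)
  also have "\<dots> = \<kappa> c * e" using gen assms by simp
  finally show ?case
    by (intro exI[of _ "\<lambda>e'. if e' = e then c else 0"]) (simp add: zero_mem)
next
  case (add x y)
  then obtain c \<mu> where "x - (\<Sum>e\<in>E. \<kappa> (c e) * e) \<in> I" "y - (\<Sum>e\<in>E. \<kappa> (\<mu> e) * e) \<in> I" by blast
  from add_mem[OF this] show ?case
    by (intro exI[of _ "\<lambda>e. c e + \<mu> e"]) (simp add: k_add distrib_right sum.distrib algebra_simps)
qed

text \<open>The elements of degree at most \<open>k\<close> in \<open>C\<close> span modulo \<open>I\<close>, up to a common denominator, a space of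
  dimension \<open>O(k\<^sup>s)\<close>; thus \<open>s\<close> bounds the transcendence degree.\<close>

definition spans :: "'r set \<Rightarrow> nat \<Rightarrow> nat \<Rightarrow> bool" where
  "spans C k n \<longleftrightarrow> (\<exists>E a. finite E \<and> card E \<le> n \<and> a \<notin> I \<and> (\<forall>x\<in>falg \<kappa> C k. a * x \<in> span_mod E))"

definition growth :: "'r set \<Rightarrow> nat \<Rightarrow> bool" where
  "growth C s \<longleftrightarrow> (\<exists>B. \<forall>k. spans C k (B * (k + 1) ^ s))"

lemma growth_empty: "growth {} 0"
proof -
  have "x \<in> span_mod {1}" if "x \<in> falg \<kappa> {} k" for x k
  proof -
    from that have "x \<in> range \<kappa>"
      by induction (auto simp flip: k_add k_mult)
    then show ?thesis using span_mod.gen[of 1 "{1}"] by auto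
  qed
  then show ?thesis
    unfolding growth_def spans_def
    by (intro exI[of _ 1] allI exI[of _ "{1}"] exI[of _ 1]) (auto simp: one_notin)
qed

lemma card_products:
  assumes "finite E"
  shows "finite {e * c ^ i |e i. e \<in> E \<and> i < n}"
    and "card {e * c ^ i |e i. e \<in> E \<and> i < n} \<le> card E * n"
proof -
  have eq: "{e * c ^ i |e i. e \<in> E \<and> i < n} = (\<lambda>(e, i). e * c ^ i) ` (E \<times> {..<n})" by auto
  show "finite {e * c ^ i |e i. e \<in> E \<and> i < n}" unfolding eq using assms by simp
  show "card {e * c ^ i |e i. e \<in> E \<and> i < n} \<le> card E * n"
    unfolding eq using card_image_le[of "E \<times> {..<n}"] assms by fastforce
qed

lemma span_mod_times_power:
  assumes "x \<in> span_mod E" "i < n"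
  shows "x * c ^ i \<in> span_mod {e * c ^ i |e i. e \<in> E \<and> i < n}"
  using assms(1)
proof induction
  case (ideal x)
  then show ?case by (intro span_mod.ideal mult_mem')
next
  case (gen e a)
  have "\<kappa> a * (e * c ^ i) \<in> span_mod {e * c ^ i |e i. e \<in> E \<and> i < n}"
    by (rule span_mod.gen) (use gen assms in auto)
  then show ?case by (simp add: mult.assoc)
qed (auto simp: distrib_right intro: span_mod.add)

lemma growth_insert:
  assumes "growth C s"
  shows "growth (insert c C) (Suc s)"
proof -
  obtain B where B: "\<And>k. spans C k (B * (k + 1) ^ s)"
    using assms unfolding growth_def by blast
  show ?thesis
    unfolding growth_def
  proof (intro exI[of _ B] allI)
    fix k
    obtain E a where E: "finite E" "card E \<le> B * (k + 1) ^ s" "a \<notin> I"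
      "\<And>x. x \<in> falg \<kappa> C k \<Longrightarrow> a * x \<in> span_mod E" using B[of k] unfolding spans_def by blast
    let ?E = "{e * c ^ i |e i. e \<in> E \<and> i < Suc k}"
    have "card ?E \<le> card E * Suc k" by (rule card_products(2)[OF E(1)])
    also have "\<dots> \<le> B * (k + 1) ^ s * Suc k" using E(2) by (rule mult_le_mono1)
    finally have card: "card ?E \<le> B * (k + 1) ^ Suc s" by (simp add: algebra_simps)
    have "a * x \<in> span_mod ?E" if "x \<in> falg \<kappa> (insert c C) k" for x
      using falg_insert_powers_span[OF that]
    proof induction
      case (base r i)
      have "a * r * c ^ i \<in> span_mod ?E"
        by (rule span_mod_times_power) (use E base in auto)
      then show ?case by (simp add: mult.assoc)
    qed (auto simp: distrib_left intro: span_mod.add)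
    with E(3) card card_products(1)[OF E(1)]
    show "spans (insert c C) k (B * (k + 1) ^ Suc s)"
      unfolding spans_def by (intro exI[of _ ?E] exI[of _ a]) auto
  qed
qed

text \<open>Degree zero is excluded implicitly, as the last two conditions contradict each other for
  \<open>d = 0\<close>. The leading coefficient is nonzero modulo \<open>I\<close> but need not be
  invertible, which is why \<open>spans\<close> admits a denominator.\<close>

definition algebraic_over :: "'r set \<Rightarrow> 'r \<Rightarrow> bool" where
  "algebraic_over C c \<longleftrightarrow> (\<exists>D d q. (\<forall>i\<le>d. q i \<in> falg \<kappa> C D) \<and> q d \<notin> I \<and> (\<Sum>i\<le>d. q i * c ^ i) \<in> I)"

inductive_set low_span :: "'r set \<Rightarrow> 'r \<Rightarrow> nat \<Rightarrow> nat \<Rightarrow> 'r set" for C c d k where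
  ideal: "x \<in> I \<Longrightarrow> x \<in> low_span C c d k"
| base: "r \<in> falg \<kappa> C k \<Longrightarrow> i < d \<Longrightarrow> r * c ^ i \<in> low_span C c d k"
| add: "x \<in> low_span C c d k \<Longrightarrow> y \<in> low_span C c d k \<Longrightarrow> x + y \<in> low_span C c d k"

lemma low_span_sum: "(\<And>a. a \<in> A \<Longrightarrow> f a \<in> low_span C c d k) \<Longrightarrow> sum f A \<in> low_span C c d k"
  by (induction A rule: infinite_finite_induct) (auto intro: low_span.intros zero_mem)

lemma low_span_mult:
  assumes "x \<in> low_span C c d k" "r \<in> falg \<kappa> C l"
  shows "r * x \<in> low_span C c d (l + k)"
  using assms(1)
proof induction
  case (ideal x)
  then show ?case by (intro low_span.ideal mult_mem)
next
  case (base s i)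
  have "(r * s) * c ^ i \<in> low_span C c d (l + k)"
    by (intro low_span.base falg_mult) (use assms base in auto)
  then show ?case by (simp add: mult.assoc)
qed (auto simp: distrib_left intro: low_span.add)

text \<open>Multiplication by \<open>c\<close> can only create the power \<open>c ^ d\<close>, and
  the relation rewrites \<open>q d * c ^ d\<close> in lower powers. The price is one factor
  \<open>q d\<close> and \<open>D\<close> more degrees in the coefficients.\<close>

lemma low_span_step:
  assumes q: "\<And>i. i \<le> d \<Longrightarrow> q i \<in> falg \<kappa> C D" "(\<Sum>i\<le>d. q i * c ^ i) \<in> I"
    and x: "x \<in> low_span C c d k"
  shows "q d * c * x \<in> low_span C c d (D + k)"
  using x
proof induction
  case (ideal x)
  then show ?case by (intro low_span.ideal mult_mem)
next
  case (base r i)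
  show ?case
  proof (cases "Suc i < d")
    case True
    have "(q d * r) * c ^ Suc i \<in> low_span C c d (D + k)"
      by (intro low_span.base falg_mult) (use q base True in auto)
    then show ?thesis by (simp add: algebra_simps)
  next
    case False
    then have d: "d = Suc i" using base by simp
    have "q d * c * (r * c ^ i) = r * (\<Sum>i\<le>d. q i * c ^ i) + (\<Sum>j<d. (- r * q j) * c ^ j)"
      by (simp add: d lessThan_Suc_atMost sum_distrib_left algebra_simps sum_negf)
    moreover have "(- r * q j) * c ^ j \<in> low_span C c d (D + k)" if "j < d" for j
    proof -
      have "q j * (- r) * c ^ j \<in> low_span C c d (D + k)"
        by (intro low_span.base falg_mult q(1) falg_uminus base(1)) (use that in auto)
      moreover have "q j * (- r) = - r * q j" by (rule mult.commute)
      ultimately show ?thesis by (simp only:)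
    qed
    ultimately show ?thesis
      using low_span_sum[of "{..<d}" "\<lambda>j. (- r * q j) * c ^ j" C c d "D + k"]
        low_span.ideal[OF mult_mem[OF q(2), of r], of C c d "D + k"]
      by (auto intro: low_span.add)
  qed
qed (auto simp: distrib_left intro: low_span.add)

lemma low_span_power:
  assumes q: "\<And>i. i \<le> d \<Longrightarrow> q i \<in> falg \<kappa> C D" "(\<Sum>i\<le>d. q i * c ^ i) \<in> I" and d: "d > 0"
  shows "q d ^ i * c ^ i \<in> low_span C c d (D * i)"
proof (induction i)
  case 0
  have "1 * c ^ 0 \<in> low_span C c d (D * 0)"
    by (intro low_span.base falg_1 d)
  then show ?case by simp
next
  case (Suc i)
  from low_span_step[OF q this] show ?case by (simp add: algebra_simps)
qed

lemma low_span_span_mod: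
  assumes "x \<in> low_span C c d k" "\<And>x. x \<in> falg \<kappa> C k \<Longrightarrow> a * x \<in> span_mod E"
  shows "a * x \<in> span_mod {e * c ^ i |e i. e \<in> E \<and> i < d}"
  using assms(1)
proof induction
  case (ideal x)
  then show ?case by (intro span_mod.ideal mult_mem)
next
  case (base r i)
  have "(a * r) * c ^ i \<in> span_mod {e * c ^ i |e i. e \<in> E \<and> i < d}"
    by (rule span_mod_times_power) (use assms base in auto)
  then show ?case by (simp add: mult.assoc)
qed (auto simp: distrib_left intro: span_mod.add)

lemma low_span_mono:
  assumes "x \<in> low_span C c d k" "k \<le> l" shows "x \<in> low_span C c d l"
  using assms(1) by induction (use assms(2) in \<open>auto intro: low_span.intros falg_mono\<close>)

text \<open>After multiplication by \<open>q d ^ k\<close>, an element of degree \<open>k\<close>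
  becomes a polynomial in \<open>c\<close> of degree below the fixed \<open>d\<close>. So the
  exponent \<open>s\<close> survives and only the constant grows.\<close>

lemma growth_insert_algebraic:
  assumes "growth C s" "algebraic_over C c"
  shows "growth (insert c C) s"
proof -
  obtain D d q where q: "\<And>i. i \<le> d \<Longrightarrow> q i \<in> falg \<kappa> C D" "q d \<notin> I" "(\<Sum>i\<le>d. q i * c ^ i) \<in> I"
    using assms(2) unfolding algebraic_over_def by blast
  have d: "d > 0" using q(2,3) by (cases d) auto
  obtain B where B: "\<And>k. spans C k (B * (k + 1) ^ s)"
    using assms(1) unfolding growth_def by blast
  show ?thesis
    unfolding growth_def
  \<comment> \<open>The coefficients have degree at most \<open>(D + 1) * k\<close>:
    \<open>k\<close> from the element itself and at most \<open>D * k\<close> from the factors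
    \<open>q d\<close>. The factor \<open>d\<close> counts the remaining powers of
    \<open>c\<close>.\<close>
  proof (intro exI[of _ "B * (D + 1) ^ s * d"] allI)
    fix k
    let ?K = "(D + 1) * k"
    obtain E a where E: "finite E" "card E \<le> B * (?K + 1) ^ s" "a \<notin> I"
      "\<And>x. x \<in> falg \<kappa> C ?K \<Longrightarrow> a * x \<in> span_mod E" using B[of ?K] unfolding spans_def by blast
    let ?E = "{e * c ^ i |e i. e \<in> E \<and> i < d}"
    have "(?K + 1) ^ s \<le> ((D + 1) * (k + 1)) ^ s" by (rule power_mono) auto
    then have "card E \<le> B * ((D + 1) ^ s * (k + 1) ^ s)"
      using E(2) by (simp only: power_mult_distrib) (meson le_trans mult_le_mono2)
    then have "card ?E \<le> B * ((D + 1) ^ s * (k + 1) ^ s) * d"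
      using card_products(2)[OF E(1), of c d] by (meson le_trans mult_le_mono1)
    then have card: "card ?E \<le> B * (D + 1) ^ s * d * (k + 1) ^ s" by (simp add: algebra_simps)
    have low: "q d ^ k * x \<in> low_span C c d ?K" if "x \<in> falg \<kappa> (insert c C) k" for x
      using falg_insert_powers_span[OF that]
    proof induction
      case (base r i)
      have r: "r * q d ^ (k - i) \<in> falg \<kappa> C (k + (k - i) * D)"
        by (intro falg_mult falg_power q base) simp
      have le: "k + (k - i) * D + D * i \<le> ?K"
        proof -
        have "(k - i) * D + D * i = D * k"
          using base(2) by (metis add_mult_distrib le_add_diff_inverse2 mult.commute)
        then show ?thesis by (simp add: algebra_simps)
      qed
      have "(r * q d ^ (k - i)) * (q d ^ i * c ^ i) \<in> low_span C c d ?K"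
        by (rule low_span_mono[OF low_span_mult[OF low_span_power[OF q(1,3) d] r] le])
      moreover have "q d ^ (k - i) * q d ^ i = q d ^ k" using base(2) by (simp flip: power_add)
      ultimately show ?case by (simp add: ac_simps)
    qed (auto simp: distrib_left intro: low_span.add)
    have "(a * q d ^ k) * x \<in> span_mod ?E" if "x \<in> falg \<kappa> (insert c C) k" for x
      using low_span_span_mod[OF low[OF that] E(4)] by (simp add: mult.assoc)
    moreover have "a * q d ^ k \<notin> I" using E(3) power_notin[OF q(2)] prime by blast
    ultimately show "spans (insert c C) k (B * (D + 1) ^ s * d * (k + 1) ^ s)"
      unfolding spans_def using card card_products(1)[OF E(1)] by (intro exI[of _ ?E] exI[of _ "a * q d ^ k"]) auto
  qed
qed

section \<open>Algebraic independence modulo a prime ideal\<close>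

definition alg_indep :: "'r set \<Rightarrow> bool" where
  "alg_indep S \<longleftrightarrow> (\<forall>F c. finite F \<longrightarrow> F \<subseteq> (S \<rightarrow>\<^sub>E UNIV) \<longrightarrow> monom_sum S F c \<in> I \<longrightarrow> (\<forall>\<alpha>\<in>F. c \<alpha> = 0))"

text \<open>There are \<open>(k + 1) ^ card S\<close> monomials with exponents up to
  \<open>k\<close>, but up to a denominator they lie in a span of size \<open>O(k ^ s)\<close>. If
  \<open>card S\<close> exceeded \<open>s\<close>, linear algebra would produce a relation among
  them for large \<open>k\<close>.\<close>

lemma alg_indep_card_le:
  assumes "growth C s" "alg_indep S" "finite S" "\<And>i. i \<in> S \<Longrightarrow> i \<in> falg \<kappa> C D"
  shows "card S \<le> s"
proof (rule ccontr)
  assume "\<not> card S \<le> s"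
  then have s: "Suc s \<le> card S" by simp
  obtain B where B: "\<And>k. spans C k (B * (k + 1) ^ s)"
    using assms(1) unfolding growth_def by blast
  \<comment> \<open>Chosen so that the spanning set has at most \<open>k * (k + 1) ^ s\<close>
    elements, which is less than \<open>(k + 1) ^ Suc s\<close>.\<close>
  define k where "k = B * (card S * D + 1) ^ s"
  define F where "F = (S \<rightarrow>\<^sub>E {..k})"
  let ?K = "card S * (k * D)"
  define m where "m \<alpha> = (\<Prod>i\<in>S. i ^ \<alpha> i)" for \<alpha> :: "'r \<Rightarrow> nat"
  obtain E a where E: "finite E" "card E \<le> B * (?K + 1) ^ s" "a \<notin> I"
      "\<And>x. x \<in> falg \<kappa> C ?K \<Longrightarrow> a * x \<in> span_mod E" using B[of ?K] unfolding spans_def by blast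
  have F: "finite F" "card F = Suc k ^ card S"
    using assms(3) by (auto simp: F_def card_PiE finite_PiE)
  have "(?K + 1) ^ s \<le> ((card S * D + 1) * (k + 1)) ^ s"
    by (rule power_mono) (auto simp: algebra_simps)
  then have "card E \<le> B * ((card S * D + 1) * (k + 1)) ^ s"
    using E(2) by (meson le_trans mult_le_mono2)
  also have "\<dots> = k * (k + 1) ^ s" by (simp only: power_mult_distrib k_def mult.assoc)
  also have "\<dots> < Suc k ^ Suc s" by simp
  also have "\<dots> \<le> card F" using s by (simp only: F(2)) (rule power_increasing, auto)
  finally have less: "card E < card F" .
  have "a * m \<alpha> \<in> span_mod E" if "\<alpha> \<in> F" for \<alpha>
  proof -
    have "i ^ \<alpha> i \<in> falg \<kappa> C (k * D)" if "i \<in> S" for i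
    proof (rule falg_mono[OF falg_power[OF assms(4)[OF that]] subset_refl])
      show "\<alpha> i * D \<le> k * D" using \<open>\<alpha> \<in> F\<close> that by (auto simp: F_def)
    qed
    then show ?thesis unfolding m_def by (intro E(4) falg_prod) auto
  qed
  then have "\<exists>M. \<forall>\<alpha>\<in>F. a * m \<alpha> - (\<Sum>e\<in>E. \<kappa> (M \<alpha> e) * e) \<in> I"
    using span_mod_coeffs[OF E(1)] by (intro bchoice) blast
  then obtain M where M: "\<And>\<alpha>. \<alpha> \<in> F \<Longrightarrow> a * m \<alpha> - (\<Sum>e\<in>E. \<kappa> (M \<alpha> e) * e) \<in> I" by blast
  obtain c where l: "\<exists>\<alpha>\<in>F. c \<alpha> \<noteq> 0" "\<And>e. e \<in> E \<Longrightarrow> (\<Sum>\<alpha>\<in>F. c \<alpha> * M \<alpha> e) = 0"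
    using linear_dependency[OF E(1) F(1) less, of M] by blast
  have ks: "\<kappa> (sum h A) = (\<Sum>x\<in>A. \<kappa> (h x))" for h and A :: "('r \<Rightarrow> nat) set"
    by (induction A rule: infinite_finite_induct) (simp_all add: k_0 k_add)
  have "(\<Sum>\<alpha>\<in>F. \<kappa> (c \<alpha>) * (a * m \<alpha> - (\<Sum>e\<in>E. \<kappa> (M \<alpha> e) * e))) \<in> I"
    by (intro sum_mem mult_mem M)
  also have "(\<Sum>\<alpha>\<in>F. \<kappa> (c \<alpha>) * (a * m \<alpha> - (\<Sum>e\<in>E. \<kappa> (M \<alpha> e) * e))) =
      a * (\<Sum>\<alpha>\<in>F. \<kappa> (c \<alpha>) * m \<alpha>) - (\<Sum>\<alpha>\<in>F. \<Sum>e\<in>E. \<kappa> (c \<alpha> * M \<alpha> e) * e)"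
    by (simp add: sum_subtractf right_diff_distrib sum_distrib_left k_mult mult.assoc mult.left_commute)
  also have "(\<Sum>\<alpha>\<in>F. \<Sum>e\<in>E. \<kappa> (c \<alpha> * M \<alpha> e) * e) = (\<Sum>e\<in>E. \<kappa> (\<Sum>\<alpha>\<in>F. c \<alpha> * M \<alpha> e) * e)"
    by (subst sum.swap) (simp add: ks sum_distrib_right)
  also have "\<dots> = 0" by (simp add: l k_0)
  finally have "(\<Sum>\<alpha>\<in>F. \<kappa> (c \<alpha>) * m \<alpha>) \<in> I" using prime E(3) by auto
  then have "\<forall>\<alpha>\<in>F. c \<alpha> = 0"
    using assms(2) F(1) unfolding alg_indep_def monom_sum_def m_def F_def by blast
  with l show False by blast
qed

lemma monom_mem_falg: "(\<Prod>i\<in>S. i ^ \<alpha> i) \<in> (\<Union>k. falg \<kappa> S k)"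
proof (induction S rule: infinite_finite_induct)
  case (insert j S)
  then obtain k where k: "(\<Prod>i\<in>S. i ^ \<alpha> i) \<in> falg \<kappa> S k" by blast
  have "j ^ \<alpha> j * (\<Prod>i\<in>S. i ^ \<alpha> i) \<in> falg \<kappa> (insert j S) (\<alpha> j * 1 + k)"
    by (intro falg_mult falg_power) (auto intro: falg_gen[of _ _ _ 0, simplified] falg_mono[OF k])
  then show ?case using insert by auto
qed (auto intro: falg_1)

lemma falg_common_degree:
  assumes "finite A" "\<And>a. a \<in> A \<Longrightarrow> \<exists>k. f a \<in> falg \<kappa> C k"
  shows "\<exists>k. \<forall>a\<in>A. f a \<in> falg \<kappa> C k"
proof -
  obtain n where n: "\<And>a. a \<in> A \<Longrightarrow> f a \<in> falg \<kappa> C (n a)" using assms(2) by metis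
  have "f a \<in> falg \<kappa> C (Max (n ` A))" if "a \<in> A" for a
    using falg_mono[OF n[OF that] subset_refl] assms(1) that by simp
  then show ?thesis by blast
qed

text \<open>Once the exponent of \<open>j\<close> is fixed, restriction to \<open>S\<close> is
  injective, so the coefficient of a power of \<open>j\<close> is a combination of distinct
  monomials in \<open>S\<close>. It is applied to the highest power in one place and to the lowest
  in another.\<close>

lemma alg_indep_fiber:
  assumes "alg_indep S" "finite F" "F \<subseteq> insert j S \<rightarrow>\<^sub>E UNIV" "\<And>\<alpha>. \<alpha> \<in> F \<Longrightarrow> \<alpha> j = d"
    and "(\<Sum>\<alpha>\<in>F. \<kappa> (c \<alpha>) * (\<Prod>i\<in>S. i ^ \<alpha> i)) \<in> I"
  shows "\<forall>\<alpha>\<in>F. c \<alpha> = 0"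
proof -
  let ?r = "\<lambda>\<alpha>::_ \<Rightarrow> nat. restrict \<alpha> S"
  have inj: "inj_on ?r F"
  proof (rule inj_onI)
    fix \<alpha> \<beta> assume *: "\<alpha> \<in> F" "\<beta> \<in> F" "?r \<alpha> = ?r \<beta>"
    then have "\<alpha> i = \<beta> i" if "i \<in> insert j S" for i
    proof (cases "i = j")
      case False
      then have "i \<in> S" using that by simp
      with fun_cong[OF *(3), of i] show ?thesis by (simp only: restrict_apply if_True)
    qed (use *(1,2) assms(4) in auto)
    moreover have "\<alpha> i = \<beta> i" if "i \<notin> insert j S" for i
    proof -
      have "\<alpha> \<in> insert j S \<rightarrow>\<^sub>E UNIV" "\<beta> \<in> insert j S \<rightarrow>\<^sub>E UNIV" using * assms(3) by auto
      from PiE_arb[OF this(1) that] PiE_arb[OF this(2) that] show ?thesis by simp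
    qed
    ultimately show "\<alpha> = \<beta>" by blast
  qed
  define \<mu> where "\<mu> \<beta> = c (the_inv_into F ?r \<beta>)" for \<beta>
  have mu: "\<mu> (?r \<alpha>) = c \<alpha>" if "\<alpha> \<in> F" for \<alpha>
    unfolding \<mu>_def by (subst the_inv_into_f_f[OF inj that]) simp
  have "monom_sum S (?r ` F) \<mu> = (\<Sum>\<alpha>\<in>F. \<kappa> (c \<alpha>) * (\<Prod>i\<in>S. i ^ \<alpha> i))"
    unfolding monom_sum_def sum.reindex[OF inj] comp_def
    by (rule sum.cong) (use mu in auto)
  with assms(5) have "monom_sum S (?r ` F) \<mu> \<in> I" by simp
  moreover have "finite (?r ` F)" "?r ` F \<subseteq> S \<rightarrow>\<^sub>E UNIV" using assms(2) by auto
  ultimately have "\<forall>\<beta>\<in>?r ` F. \<mu> \<beta> = 0"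
    using assms(1) unfolding alg_indep_def by blast
  then show ?thesis using mu by auto
qed

text \<open>Sort a nontrivial relation by powers of \<open>j\<close>. The coefficient of the highest
  power is a nontrivial combination of monomials in \<open>S\<close>, and the independence of
  \<open>S\<close> keeps it outside \<open>I\<close>.\<close>

lemma algebraic_over_of_dependent:
  assumes "alg_indep S" "\<not> alg_indep (insert j S)" "j \<notin> S" "finite S"
  shows "algebraic_over S j"
proof -
  obtain F0 c where F0: "finite F0" "F0 \<subseteq> (insert j S \<rightarrow>\<^sub>E UNIV)" "monom_sum (insert j S) F0 c \<in> I"
    "\<not> (\<forall>\<alpha>\<in>F0. c \<alpha> = 0)" using assms(2) unfolding alg_indep_def by blast
  \<comment> \<open>With the zero terms discarded, some term of maximal exponent \<open>d\<close>
    has a nonzero coefficient.\<close>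
  define F where "F = {\<alpha>\<in>F0. c \<alpha> \<noteq> 0}"
  have F: "finite F" "F \<subseteq> (insert j S \<rightarrow>\<^sub>E UNIV)" "F \<noteq> {}" using F0 by (auto simp: F_def)
  have "monom_sum (insert j S) F0 c = monom_sum (insert j S) F c"
    unfolding monom_sum_def F_def by (rule sum.mono_neutral_right) (use F0 in \<open>auto simp: k_0\<close>)
  with F0 have rel: "monom_sum (insert j S) F c \<in> I" by simp
  define d where "d = Max ((\<lambda>\<alpha>. \<alpha> j) ` F)"
  have dmax: "\<alpha> j \<le> d" if "\<alpha> \<in> F" for \<alpha> using that F unfolding d_def by auto
  have "d \<in> (\<lambda>\<alpha>. \<alpha> j) ` F" unfolding d_def using F by (intro Max_in) auto
  then obtain \<alpha>0 where \<alpha>0: "\<alpha>0 \<in> F" "\<alpha>0 j = d" by auto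
  define q where "q i = (\<Sum>\<alpha>\<in>{\<alpha>\<in>F. \<alpha> j = i}. \<kappa> (c \<alpha>) * (\<Prod>i\<in>S. i ^ \<alpha> i))" for i
  have "monom_sum (insert j S) F c = (\<Sum>\<alpha>\<in>F. \<kappa> (c \<alpha>) * (\<Prod>i\<in>S. i ^ \<alpha> i) * j ^ \<alpha> j)"
    unfolding monom_sum_def
    by (rule sum.cong) (simp_all add: prod.insert[OF assms(4,3)] mult.assoc mult.commute)
  also have "\<dots> = (\<Sum>i\<le>d. \<Sum>\<alpha>\<in>{\<alpha>\<in>F. \<alpha> j = i}. \<kappa> (c \<alpha>) * (\<Prod>i\<in>S. i ^ \<alpha> i) * j ^ \<alpha> j)"
    by (rule sum.group[symmetric]) (use F dmax in auto)
  also have "\<dots> = (\<Sum>i\<le>d. q i * j ^ i)" by (simp add: q_def sum_distrib_right)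
  finally have rel: "(\<Sum>i\<le>d. q i * j ^ i) \<in> I" using rel by simp
  have "q d \<notin> I"
  proof
    assume "q d \<in> I"
    then have "\<forall>\<alpha>\<in>{\<alpha>\<in>F. \<alpha> j = d}. c \<alpha> = 0"
      unfolding q_def by (intro alg_indep_fiber[OF assms(1), of _ j d]) (use F in auto)
    moreover have "\<alpha>0 \<in> {\<alpha>\<in>F. \<alpha> j = d}" using \<alpha>0 by simp
    ultimately have "c \<alpha>0 = 0" by blast
    then show False using \<alpha>0(1) by (simp add: F_def)
  qed
  have "\<exists>k. \<forall>\<alpha>\<in>F. (\<Prod>i\<in>S. i ^ \<alpha> i) \<in> falg \<kappa> S k"
    by (rule falg_common_degree[OF F(1)]) (use monom_mem_falg in auto)
  then obtain k where k: "\<And>\<alpha>. \<alpha> \<in> F \<Longrightarrow> (\<Prod>i\<in>S. i ^ \<alpha> i) \<in> falg \<kappa> S k" by blast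
  have "q i \<in> falg \<kappa> S k" for i
    unfolding q_def
  proof (rule falg_sum)
    fix \<alpha> assume "\<alpha> \<in> {\<alpha>\<in>F. \<alpha> j = i}"
    then have "\<kappa> (c \<alpha>) * (\<Prod>i\<in>S. i ^ \<alpha> i) \<in> falg \<kappa> S (0 + k)"
      by (intro falg_mult falg_const k) simp
    then show "\<kappa> (c \<alpha>) * (\<Prod>i\<in>S. i ^ \<alpha> i) \<in> falg \<kappa> S k" by simp
  qed
  with rel \<open>q d \<notin> I\<close> show ?thesis unfolding algebraic_over_def by blast
qed

lemma alg_indep_empty: "alg_indep {}"
  unfolding alg_indep_def
proof (intro allI impI ballI)
  fix F c \<alpha>
  assume F: "F \<subseteq> {} \<rightarrow>\<^sub>E (UNIV :: nat set)" "monom_sum {} F c \<in> I" "\<alpha> \<in> F"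
  then have "F = {\<alpha>}" by auto
  with F have "\<kappa> (c \<alpha>) \<in> I" by (simp add: monom_sum_def)
  show "c \<alpha> = 0"
  proof (rule ccontr)
    assume "c \<alpha> \<noteq> 0"
    then have "\<kappa> (inverse (c \<alpha>)) * \<kappa> (c \<alpha>) = 1" by (simp flip: k_mult add: k_1)
    with mult_mem[OF \<open>\<kappa> (c \<alpha>) \<in> I\<close>] one_notin show False by metis
  qed
qed

lemma growth_finite: "finite S \<Longrightarrow> growth S (card S)"
  by (induction S rule: finite_induct) (use growth_empty growth_insert in auto)

lemma algebraic_over_mono:
  assumes "algebraic_over C c" "C \<subseteq> C'"
  shows "algebraic_over C' c"
  using assms falg_mono[OF _ assms(2) order_refl] unfolding algebraic_over_def by blast

lemma growth_Un_algebraic: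
  assumes "finite T" "growth C s" "\<And>c. c \<in> T \<Longrightarrow> algebraic_over C c"
  shows "growth (T \<union> C) s"
  using assms(1,3)
proof (induction T rule: finite_induct)
  case (insert c T)
  have "algebraic_over (T \<union> C) c" by (rule algebraic_over_mono[of C]) (use insert in auto)
  with insert show ?case by (auto intro: growth_insert_algebraic)
qed (use assms in simp)

text \<open>The multiple \<open>r\<close> of \<open>b\<close> is the lowest nonzero coefficient of an algebraic equation for \<open>b\<close>.\<close>

lemma algebraic_divides:
  assumes "alg_indep S" "finite S" "growth C (card S)" "S \<subseteq> C" "b \<in> falg \<kappa> C D" "b \<notin> I"
  shows "\<exists>r h k. r \<in> falg \<kappa> S k \<and> h \<in> falg \<kappa> (insert b S) k \<and> r \<notin> I \<and> r - b * h \<in> I"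
proof (cases "b \<in> S")
  case True
  then show ?thesis using falg_gen[of b S \<kappa> 0] falg_1[of "insert b S"] assms(6) zero_mem
    by (intro exI[of _ b] exI[of _ 1] exI[of _ 1]) auto
next
  case False
  \<comment> \<open>One more independent element would exceed the bound that the growth of
    \<open>C\<close> puts on independent sets.\<close>
  have "\<not> alg_indep (insert b S)"
  proof
    assume "alg_indep (insert b S)"
    then have "card (insert b S) \<le> card S"
      by (rule alg_indep_card_le[OF assms(3), of _ "max D 1"])
        (use assms falg_mono[OF assms(5) subset_refl] falg_mono[OF falg_gen[of _ C \<kappa> 0] subset_refl] in auto)
    with False assms(2) show False by simp
  qed
  from algebraic_over_of_dependent[OF assms(1) this False assms(2)]
  obtain D' d q where q: "\<And>i. i \<le> d \<Longrightarrow> q i \<in> falg \<kappa> S D'" "q d \<notin> I" "(\<Sum>i\<le>d. q i * b ^ i) \<in> I"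
    unfolding algebraic_over_def by blast
  define n where "n = (LEAST i. q i \<notin> I)"
  have n: "q n \<notin> I" unfolding n_def by (rule LeastI[of _ d]) (rule q(2))
  have n_le: "n \<le> d" unfolding n_def by (rule Least_le) (rule q(2))
  have less: "q i \<in> I" if "i < n" for i using not_less_Least[of i "\<lambda>i. q i \<notin> I"] that unfolding n_def by blast
  \<comment> \<open>Dropping the terms below \<open>n\<close>, whose coefficients lie in
    \<open>I\<close>, and cancelling \<open>b ^ n\<close> leaves \<open>q n - b * h\<close>.\<close>
  define h where "h = - (\<Sum>i\<in>{n<..d}. q i * b ^ (i - Suc n))"
  have "(\<Sum>i\<le>d. q i * b ^ i) = (\<Sum>i\<in>{..<n}. q i * b ^ i) + (\<Sum>i\<in>{n..d}. q i * b ^ i)"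
    using n_le by (subst sum.union_disjoint[symmetric]) (auto intro!: sum.cong)
  moreover have "(\<Sum>i\<in>{..<n}. q i * b ^ i) \<in> I" by (intro sum_mem mult_mem' less) auto
  ultimately have "(\<Sum>i\<in>{n..d}. q i * b ^ i) \<in> I" using q(3) diff_mem by fastforce
  also have "(\<Sum>i\<in>{n..d}. q i * b ^ i) = q n * b ^ n + (\<Sum>i\<in>{n<..d}. q i * b ^ i)"
    using n_le by (simp add: sum.head)
  also have "(\<Sum>i\<in>{n<..d}. q i * b ^ i) = (\<Sum>i\<in>{n<..d}. b ^ n * (b * (q i * b ^ (i - Suc n))))"
  proof (rule sum.cong)
    fix i assume "i \<in> {n<..d}"
    then have "b ^ i = b ^ n * (b * b ^ (i - Suc n))"
      by (simp flip: power_add power_Suc)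
    then show "q i * b ^ i = b ^ n * (b * (q i * b ^ (i - Suc n)))" by (simp add: ac_simps)
  qed simp
  also have "q n * b ^ n + \<dots> = b ^ n * (q n - b * h)"
    by (simp add: h_def sum_distrib_left algebra_simps)
  finally have "q n - b * h \<in> I" using prime power_notin[OF assms(6)] by blast
  moreover have "q n \<in> falg \<kappa> S (D' + d)" by (rule falg_mono[OF q(1)[OF n_le]]) auto
  moreover have "h \<in> falg \<kappa> (insert b S) (D' + d)"
    unfolding h_def
  proof (intro falg_uminus falg_sum)
    fix i assume i: "i \<in> {n<..d}"
    have b1: "b \<in> falg \<kappa> (insert b S) 1" using falg_gen[of b _ \<kappa> 0] by simp
    have "q i * b ^ (i - Suc n) \<in> falg \<kappa> (insert b S) (D' + (i - Suc n) * 1)"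
      by (rule falg_mult[OF falg_mono[OF q(1)] falg_power[OF b1]]) (use i in auto)
    then show "q i * b ^ (i - Suc n) \<in> falg \<kappa> (insert b S) (D' + d)"
      by (rule falg_mono) (use i in auto)
  qed
  ultimately show ?thesis using n by blast
qed

end

text \<open>Passing from a prime ideal to a strictly smaller one, any element of the difference is
  transcendental over the elements that are independent modulo the larger ideal.\<close>

lemma alg_indep_of_chain:
  assumes "\<And>i. i \<le> d \<Longrightarrow> prime_ideal \<kappa> (Q i)" "\<And>i. i < d \<Longrightarrow> Q (Suc i) \<subset> Q i"
  shows "\<exists>S. finite S \<and> card S = d \<and> prime_ideal.alg_indep \<kappa> (Q d) S"
  using assms
proof (induction d)
  case 0
  then show ?case using prime_ideal.alg_indep_empty by fastforce
next
  case (Suc d)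
  interpret P: prime_ideal \<kappa> "Q d" by (rule Suc.prems) simp
  interpret P': prime_ideal \<kappa> "Q (Suc d)" by (rule Suc.prems) simp
  obtain S where S: "finite S" "card S = d" "P.alg_indep S" using Suc by auto
  obtain h where h: "h \<in> Q d" "h \<notin> Q (Suc d)" using Suc.prems(2)[of d] by auto
  have sub: "Q (Suc d) \<subseteq> Q d" using Suc.prems(2)[of d] by auto
  \<comment> \<open>Modulo \<open>Q d\<close> the element \<open>h\<close> is zero, so its presence
    in \<open>S\<close> would already be a relation.\<close>
  have "h \<notin> S"
  proof
    assume hS: "h \<in> S"
    let ?\<alpha> = "\<lambda>x\<in>S. if x = h then 1 else 0 :: nat"
    have "(\<Prod>x\<in>S. x ^ ?\<alpha> x) = (\<Prod>x\<in>S. if x = h then x else 1)" by (rule prod.cong) auto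
    also have "\<dots> = h" using hS S(1) by simp
    finally have "P.monom_sum S {?\<alpha>} (\<lambda>_. 1) \<in> Q d" using h by (simp add: P.monom_sum_def P.k_1)
    moreover have "{?\<alpha>} \<subseteq> S \<rightarrow>\<^sub>E UNIV" by auto
    ultimately have "\<forall>\<alpha>\<in>{?\<alpha>}. (1::'a) = 0"
      using S(3) unfolding P.alg_indep_def by (metis finite.emptyI finite.insertI)
    then show False by simp
  qed
  have "P'.alg_indep (insert h S)"
    unfolding P'.alg_indep_def
  proof (intro allI impI, rule ccontr)
    fix F0 c
    assume F0: "finite F0" "F0 \<subseteq> insert h S \<rightarrow>\<^sub>E UNIV" "P.monom_sum (insert h S) F0 c \<in> Q (Suc d)"
      "\<not> (\<forall>\<alpha>\<in>F0. c \<alpha> = 0)"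
    define F where "F = {\<alpha>\<in>F0. c \<alpha> \<noteq> 0}"
    have F: "finite F" "F \<subseteq> (insert h S \<rightarrow>\<^sub>E UNIV)" "F \<noteq> {}" using F0 by (auto simp: F_def)
    \<comment> \<open>The lowest power of \<open>h\<close> is split off. Since \<open>h ^ n\<close>
      is outside the prime \<open>Q (Suc d)\<close>, the cofactor lies in it and hence in
      \<open>Q d\<close>, where all terms that still contain \<open>h\<close> vanish.\<close>
    define n where "n = Min ((\<lambda>\<alpha>. \<alpha> h) ` F)"
    have nmin: "n \<le> \<alpha> h" if "\<alpha> \<in> F" for \<alpha> using that F unfolding n_def by auto
    have "n \<in> (\<lambda>\<alpha>. \<alpha> h) ` F" unfolding n_def using F by (intro Min_in) auto
    then obtain \<alpha>0 where \<alpha>0: "\<alpha>0 \<in> F" "\<alpha>0 h = n" by auto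
    let ?m = "\<lambda>\<alpha>. \<kappa> (c \<alpha>) * (\<Prod>i\<in>S. i ^ \<alpha> i)"
    have "P.monom_sum (insert h S) F0 c = P.monom_sum (insert h S) F c"
      unfolding P.monom_sum_def F_def by (rule sum.mono_neutral_right) (use F0 in \<open>auto simp: P.k_0\<close>)
    also have "\<dots> = (\<Sum>\<alpha>\<in>F. h ^ n * (?m \<alpha> * h ^ (\<alpha> h - n)))"
      unfolding P.monom_sum_def
    proof (rule sum.cong)
      fix \<alpha> assume "\<alpha> \<in> F"
      then have "h ^ \<alpha> h = h ^ n * h ^ (\<alpha> h - n)" using nmin by (simp flip: power_add)
      then show "\<kappa> (c \<alpha>) * (\<Prod>i\<in>insert h S. i ^ \<alpha> i) = h ^ n * (?m \<alpha> * h ^ (\<alpha> h - n))"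
        using S(1) \<open>h \<notin> S\<close> by (simp add: ac_simps)
    qed simp
    finally have "h ^ n * (\<Sum>\<alpha>\<in>F. ?m \<alpha> * h ^ (\<alpha> h - n)) \<in> Q (Suc d)"
      using F0 by (simp add: sum_distrib_left)
    then have "(\<Sum>\<alpha>\<in>F. ?m \<alpha> * h ^ (\<alpha> h - n)) \<in> Q d"
      using P'.prime P'.power_notin[OF h(2)] sub by blast
    also have "(\<Sum>\<alpha>\<in>F. ?m \<alpha> * h ^ (\<alpha> h - n)) =
        (\<Sum>\<alpha>\<in>{\<alpha>\<in>F. \<alpha> h = n}. ?m \<alpha> * h ^ (\<alpha> h - n)) + (\<Sum>\<alpha>\<in>{\<alpha>\<in>F. \<alpha> h \<noteq> n}. ?m \<alpha> * h ^ (\<alpha> h - n))"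
      using F(1) by (subst sum.union_disjoint[symmetric]) (auto intro!: sum.cong)
    also have "(\<Sum>\<alpha>\<in>{\<alpha>\<in>F. \<alpha> h = n}. ?m \<alpha> * h ^ (\<alpha> h - n)) = (\<Sum>\<alpha>\<in>{\<alpha>\<in>F. \<alpha> h = n}. ?m \<alpha>)"
      by (rule sum.cong) auto
    finally have *: "(\<Sum>\<alpha>\<in>{\<alpha>\<in>F. \<alpha> h = n}. ?m \<alpha>) + (\<Sum>\<alpha>\<in>{\<alpha>\<in>F. \<alpha> h \<noteq> n}. ?m \<alpha> * h ^ (\<alpha> h - n)) \<in> Q d" .
    have "(\<Sum>\<alpha>\<in>{\<alpha>\<in>F. \<alpha> h \<noteq> n}. ?m \<alpha> * h ^ (\<alpha> h - n)) \<in> Q d"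
    proof (rule P.sum_mem)
      fix \<alpha> assume "\<alpha> \<in> {\<alpha>\<in>F. \<alpha> h \<noteq> n}"
      then have "\<alpha> h - n = Suc (\<alpha> h - n - 1)" using nmin[of \<alpha>] by auto
      then have "h ^ (\<alpha> h - n) = h ^ (\<alpha> h - n - 1) * h" by (metis power_Suc2)
      then show "?m \<alpha> * h ^ (\<alpha> h - n) \<in> Q d"
        using P.mult_mem[OF h(1), of "?m \<alpha> * h ^ (\<alpha> h - n - 1)"] by (simp only: mult.assoc)
    qed
    from P.diff_mem[OF * this] have "(\<Sum>\<alpha>\<in>{\<alpha>\<in>F. \<alpha> h = n}. ?m \<alpha>) \<in> Q d" by simp
    then have "\<forall>\<alpha>\<in>{\<alpha>\<in>F. \<alpha> h = n}. c \<alpha> = 0"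
      by (intro P.alg_indep_fiber[OF S(3), of _ h n]) (use F in auto)
    moreover have "\<alpha>0 \<in> {\<alpha>\<in>F. \<alpha> h = n}" using \<alpha>0 by simp
    ultimately have "c \<alpha>0 = 0" by blast
    then show False using \<alpha>0(1) by (simp add: F_def)
  qed
  with S \<open>h \<notin> S\<close> show ?case by (intro exI[of _ "insert h S"]) auto
qed

section \<open>Prime ideals of polynomial rings\<close>

context scalars
begin

lemma meval_add: "meval \<kappa> z (p + q) = meval \<kappa> z p + meval \<kappa> z q"
  unfolding meval_def by (rule keys_sum_add) (simp_all add: k_0 k_add distrib_right)

lemma meval_single: "meval \<kappa> z (Poly_Mapping.single m c) = \<kappa> c * (\<Prod>i\<in>UNIV. z i ^ Poly_Mapping.lookup m i)"
  by (cases "c = 0") (simp_all add: meval_def k_0)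

lemma meval_times: "meval \<kappa> z (p * q) = meval \<kappa> z p * meval \<kappa> z q"
proof (induction p rule: mpoly_induct)
  case (single m c)
  show ?case
  proof (induction q rule: mpoly_induct)
    case (single m' c')
    show ?case
      by (simp add: mult_single meval_single lookup_add power_add prod.distrib k_mult ac_simps)
  qed (simp add: meval_add algebra_simps)
qed (simp add: meval_add algebra_simps)

lemma meval_mconst: "meval \<kappa> z (mconst c) = \<kappa> c"
  by (simp add: mconst_def meval_single)

lemma meval_mvar: "meval \<kappa> z (mvar i) = z i"
proof -
  have "(\<Prod>j\<in>UNIV. z j ^ Poly_Mapping.lookup (Poly_Mapping.single i (1::nat)) j) = (\<Prod>j\<in>UNIV. if j = i then z j else 1)"
    by (rule prod.cong) (auto simp: lookup_single)
  then show ?thesis by (simp add: mvar_def meval_single k_1)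
qed

lemma meval_1: "meval \<kappa> z 1 = 1"
  using meval_mconst[of z 1] by (simp add: mconst_def k_1)

lemma meval_0: "meval \<kappa> z 0 = 0"
  by (simp add: meval_def)

lemma meval_uminus: "meval \<kappa> z (- p) = - meval \<kappa> z p"
  using meval_add[of z p "- p"] by (simp add: meval_0 eq_neg_iff_add_eq_0 add.commute)

lemma meval_diff: "meval \<kappa> z (p - q) = meval \<kappa> z p - meval \<kappa> z q"
  using meval_add[of z p "- q"] by (simp add: meval_uminus)

lemma meval_sum: "meval \<kappa> z (sum f A) = (\<Sum>a\<in>A. meval \<kappa> z (f a))"
  by (induction A rule: infinite_finite_induct) (simp_all add: meval_0 meval_add)

lemma meval_power: "meval \<kappa> z (p ^ n) = meval \<kappa> z p ^ n"
  by (induction n) (simp_all add: meval_1 meval_times)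

lemmas meval_simps = meval_add meval_times meval_mconst meval_mvar meval_1 meval_0 meval_uminus
  meval_diff meval_sum meval_power

end

lemma mpoly_generators_induct [case_names const var add mult]:
  fixes p :: "('l::comm_ring_1, 'i::finite) mpoly"
  assumes "\<And>c. P (mconst c)" "\<And>i. P (mvar i)" "\<And>p q. P p \<Longrightarrow> P q \<Longrightarrow> P (p + q)"
    "\<And>p q. P p \<Longrightarrow> P q \<Longrightarrow> P (p * q)"
  shows "P p"
proof (induction p rule: mpoly_induct)
  case (single m c)
  have one: "P 1" using assms(1)[of 1] by (simp add: mconst_def)
  have pow: "P (mvar i ^ n)" for i n by (induction n) (use one assms in auto)
  have "P (\<Prod>i\<in>A. mvar i ^ Poly_Mapping.lookup m i)" for A
    by (induction A rule: infinite_finite_induct) (use one pow assms in auto)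
  from assms(4)[OF assms(1)[of c] this[of UNIV]]
  show ?case by (simp add: prod_mvar mconst_def mult_single)
qed (rule assms)

interpretation mconst: scalars "mconst :: 'l::field \<Rightarrow> ('l, 'i) mpoly"
  by standard (simp_all add: mconst_def single_add mult_single)

interpretation idc: scalars "\<lambda>c :: 'l::field. c"
  by standard simp_all

interpretation ac: scalars "to_ac :: 'k::field \<Rightarrow> 'k alg_closure"
  by standard simp_all

lemma (in scalars) meval_subst:
  "meval \<kappa> w (meval mconst z p) = meval \<kappa> (\<lambda>i. meval \<kappa> w (z i)) p"
  by (induction p rule: mpoly_generators_induct) (simp_all add: meval_simps mconst.meval_simps)

text \<open>One variable at a time: \<open>z\<close> is first chosen for the terms that share one
  power of \<open>j\<close>. This makes the polynomial in the remaining variable nonzero, and an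
  infinite field contains a value that is not a root.\<close>

lemma monomials_nonvanishing_point:
  fixes c :: "('i \<Rightarrow> nat) \<Rightarrow> 'l::field_char_0"
  assumes "finite T" "finite F" "\<exists>m\<in>F. c m \<noteq> 0"
    and "\<And>m m'. m \<in> F \<Longrightarrow> m' \<in> F \<Longrightarrow> (\<And>i. i \<in> T \<Longrightarrow> m i = m' i) \<Longrightarrow> m = m'"
  shows "\<exists>z. (\<Sum>m\<in>F. c m * (\<Prod>i\<in>T. z i ^ m i)) \<noteq> 0"
  using assms
proof (induction T arbitrary: F rule: finite_induct)
  case empty
  then obtain m where "m \<in> F" "c m \<noteq> 0" by blast
  moreover from this empty have "F = {m}" by blast
  ultimately show ?case by auto
next
  case (insert j T)
  obtain m0 where m0: "m0 \<in> F" "c m0 \<noteq> 0" using insert.prems by blast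
  let ?F = "{m\<in>F. m j = m0 j}"
  have "\<exists>z. (\<Sum>m\<in>?F. c m * (\<Prod>i\<in>T. z i ^ m i)) \<noteq> 0"
  proof (rule insert.IH)
    show "m = m'" if "m \<in> ?F" "m' \<in> ?F" "\<And>i. i \<in> T \<Longrightarrow> m i = m' i" for m m'
      by (rule insert.prems(3)) (use that in auto)
  qed (use insert.prems m0 in auto)
  then obtain z where z: "(\<Sum>m\<in>?F. c m * (\<Prod>i\<in>T. z i ^ m i)) \<noteq> 0" by blast
  define q where "q = (\<Sum>m\<in>F. monom (c m * (\<Prod>i\<in>T. z i ^ m i)) (m j))"
  have "coeff q (m0 j) = (\<Sum>m\<in>F. if m j = m0 j then c m * (\<Prod>i\<in>T. z i ^ m i) else 0)"
    by (simp add: q_def coeff_sum)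
  also have "\<dots> = (\<Sum>m\<in>?F. c m * (\<Prod>i\<in>T. z i ^ m i))"
    using insert.prems by (simp add: sum.inter_filter)
  finally have "q \<noteq> 0" using z by auto
  then have "finite {s. poly q s = 0}" by (rule poly_roots_finite)
  then obtain s where s: "poly q s \<noteq> 0"
    using ex_new_if_finite[OF infinite_UNIV_char_0] by blast
  have "(\<Prod>i\<in>T. (z(j := s)) i ^ m i) = (\<Prod>i\<in>T. z i ^ m i)" for m :: "'i \<Rightarrow> nat"
    by (rule prod.cong) (use insert.hyps in auto)
  then have "(\<Sum>m\<in>F. c m * (\<Prod>i\<in>insert j T. (z(j := s)) i ^ m i)) = poly q s"
    using insert.hyps by (simp add: q_def poly_sum poly_monom ac_simps)
  with s show ?case by metis
qed

lemma (in scalars) k_eq_0: "\<kappa> c = 0 \<Longrightarrow> (1::'r) \<noteq> 0 \<Longrightarrow> c = 0"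
  using k_mult[of c "inverse c"] k_1 by (cases "c = 0") auto

lemma mpoly_nonvanishing_point:
  fixes \<kappa> :: "'k::field \<Rightarrow> 'l::field_char_0" and p :: "('k, 'i::finite) mpoly"
  assumes "scalars \<kappa>" "p \<noteq> 0"
  shows "\<exists>z. meval \<kappa> z p \<noteq> 0"
proof -
  interpret scalars \<kappa> by fact
  let ?F = "Poly_Mapping.lookup ` Poly_Mapping.keys p"
  have inj: "inj_on Poly_Mapping.lookup (Poly_Mapping.keys p)"
    by (auto intro: inj_onI poly_mapping_eqI)
  obtain m where m: "m \<in> Poly_Mapping.keys p" using assms(2) by (metis keys_eq_empty ex_in_conv)
  have "\<exists>z. (\<Sum>e\<in>?F. \<kappa> (Poly_Mapping.lookup p (of_exponents e)) * (\<Prod>i\<in>UNIV. z i ^ e i)) \<noteq> 0"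
    by (rule monomials_nonvanishing_point) (use m k_eq_0 in \<open>auto simp: in_keys_iff intro!: bexI[of _ m]\<close>)
  then show ?thesis
    unfolding meval_def sum.reindex[OF inj] by simp
qed

lemma meval_line:
  fixes y y' :: "'i::finite \<Rightarrow> 'l::field"
  shows "\<exists>P. \<forall>s. meval (\<lambda>c. c) (\<lambda>i. y i + s * (y' i - y i)) p = poly P s"
proof (induction p rule: mpoly_generators_induct)
  case (const c)
  show ?case by (rule exI[of _ "[:c:]"]) (simp add: idc.meval_simps)
next
  case (var i)
  show ?case by (rule exI[of _ "[:y i, y' i - y i:]"]) (simp add: idc.meval_simps)
next
  case (add p q)
  then obtain P Q where "\<forall>s. meval (\<lambda>c. c) (\<lambda>i. y i + s * (y' i - y i)) p = poly P s"
    "\<forall>s. meval (\<lambda>c. c) (\<lambda>i. y i + s * (y' i - y i)) q = poly Q s" by blast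
  then show ?case by (intro exI[of _ "P + Q"]) (simp add: idc.meval_simps)
next
  case (mult p q)
  then obtain P Q where "\<forall>s. meval (\<lambda>c. c) (\<lambda>i. y i + s * (y' i - y i)) p = poly P s"
    "\<forall>s. meval (\<lambda>c. c) (\<lambda>i. y i + s * (y' i - y i)) q = poly Q s" by blast
  then show ?case by (intro exI[of _ "P * Q"]) (simp add: idc.meval_simps)
qed

text \<open>Both polynomials stay nonzero on the line through \<open>y\<close> and
  \<open>y'\<close>, so together they have finitely many zeros there. The line is kept in the
  conclusion because coordinates on which \<open>y\<close> and \<open>y'\<close> agree are constant
  along it.\<close>

lemma common_nonvanishing_point:
  fixes y y' :: "'i::finite \<Rightarrow> 'l::field_char_0"
  assumes "meval (\<lambda>c. c) y p \<noteq> 0" "meval (\<lambda>c. c) y' p' \<noteq> 0"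
  shows "\<exists>s. meval (\<lambda>c. c) (\<lambda>i. y i + s * (y' i - y i)) p \<noteq> 0 \<and>
    meval (\<lambda>c. c) (\<lambda>i. y i + s * (y' i - y i)) p' \<noteq> 0"
proof -
  obtain P where P: "\<And>s. meval (\<lambda>c. c) (\<lambda>i. y i + s * (y' i - y i)) p = poly P s"
    using meval_line by metis
  obtain P' where P': "\<And>s. meval (\<lambda>c. c) (\<lambda>i. y i + s * (y' i - y i)) p' = poly P' s"
    using meval_line by metis
  have "poly P 0 \<noteq> 0" "poly P' 1 \<noteq> 0"
    using assms P[of 0] P'[of 1] by auto
  then have "P * P' \<noteq> 0" by auto
  then have "finite {s. poly (P * P') s = 0}" by (rule poly_roots_finite)
  then obtain s where "poly (P * P') s \<noteq> 0"
    using ex_new_if_finite[OF infinite_UNIV_char_0] by blast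
  then show ?thesis by (intro exI[of _ s]) (simp add: P P')
qed

lemma mpoly_mult_neq_0:
  fixes p q :: "('l::field_char_0, 'i::finite) mpoly"
  assumes "p \<noteq> 0" "q \<noteq> 0" shows "p * q \<noteq> 0"
proof -
  obtain y y' where "meval (\<lambda>c. c) y p \<noteq> 0" "meval (\<lambda>c. c) y' q \<noteq> 0"
    using mpoly_nonvanishing_point[OF idc.scalars_axioms] assms by metis
  from common_nonvanishing_point[OF this] obtain z where "meval (\<lambda>c. c) z (p * q) \<noteq> 0"
    unfolding idc.meval_times by fastforce
  then show ?thesis by (auto simp: idc.meval_0)
qed

text \<open>Krull's argument: Zorn's lemma gives an ideal maximal among those that contain
  \<open>A\<close> and avoid \<open>M\<close>. Adjoining any further element makes it meet the
  multiplicative set \<open>M\<close>, and this forces primality.\<close>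

lemma exists_prime_ideal:
  fixes A M :: "'r::comm_ring_1 set"
  assumes A: "0 \<in> A" "\<And>x y. x \<in> A \<Longrightarrow> y \<in> A \<Longrightarrow> x + y \<in> A" "\<And>r x. x \<in> A \<Longrightarrow> r * x \<in> A"
    and M: "1 \<in> M" "\<And>x y. x \<in> M \<Longrightarrow> y \<in> M \<Longrightarrow> x * y \<in> M" and disj: "A \<inter> M = {}"
    and "scalars \<kappa>"
  shows "\<exists>I. prime_ideal \<kappa> I \<and> A \<subseteq> I \<and> I \<inter> M = {}"
proof -
  define ideal where "ideal I \<longleftrightarrow> 0 \<in> I \<and> (\<forall>x\<in>I. \<forall>y\<in>I. x + y \<in> I) \<and> (\<forall>r. \<forall>x\<in>I. r * x \<in> I)" for I :: "'r set"
  define \<I> where "\<I> = {I. ideal I \<and> A \<subseteq> I \<and> I \<inter> M = {}}"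
  have "A \<in> \<I>" using A disj by (auto simp: \<I>_def ideal_def)
  moreover have "\<Union>\<C> \<in> \<I>" if C: "\<C> \<noteq> {}" "subset.chain \<I> \<C>" for \<C>
  proof -
    have sub: "\<And>I. I \<in> \<C> \<Longrightarrow> I \<in> \<I>" and ch: "\<And>I J. I \<in> \<C> \<Longrightarrow> J \<in> \<C> \<Longrightarrow> I \<subseteq> J \<or> J \<subseteq> I"
      using C(2) by (auto simp: subset.chain_def)
    have "x + y \<in> \<Union>\<C>" if xy: "x \<in> \<Union>\<C>" "y \<in> \<Union>\<C>" for x y
    proof -
      obtain I J where "I \<in> \<C>" "J \<in> \<C>" "x \<in> I" "y \<in> J" using xy by blast
      then obtain K where "K \<in> \<C>" "x \<in> K" "y \<in> K" using ch by blast
      with sub show ?thesis unfolding \<I>_def ideal_def by blast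
    qed
    moreover have "r * x \<in> \<Union>\<C>" if "x \<in> \<Union>\<C>" for x r
      using that sub unfolding \<I>_def ideal_def by blast
    moreover have "0 \<in> \<Union>\<C>" "A \<subseteq> \<Union>\<C>" "\<Union>\<C> \<inter> M = {}"
      using sub C(1) unfolding \<I>_def ideal_def by blast+
    ultimately show ?thesis by (simp add: \<I>_def ideal_def)
  qed
  ultimately obtain I where I: "I \<in> \<I>" and max: "\<And>J. J \<in> \<I> \<Longrightarrow> I \<subseteq> J \<Longrightarrow> J = I"
    using subset_Zorn_nonempty[of \<I>] by blast
  have Iid: "0 \<in> I" "\<And>x y. x \<in> I \<Longrightarrow> y \<in> I \<Longrightarrow> x + y \<in> I" "\<And>r x. x \<in> I \<Longrightarrow> r * x \<in> I"
    "A \<subseteq> I" "I \<inter> M = {}"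
    using I by (auto simp: \<I>_def ideal_def)
  have ext: "\<exists>i\<in>I. \<exists>r. i + r * x \<in> M" if "x \<notin> I" for x
  proof (rule ccontr)
    assume no: "\<not> ?thesis"
    let ?J = "{i + r * x |i r. i \<in> I}"
    have "ideal ?J"
      unfolding ideal_def
    proof (intro conjI ballI allI)
      show "0 \<in> ?J" using Iid(1) by (intro CollectI exI[of _ 0]) simp
      fix a b assume "a \<in> ?J" "b \<in> ?J"
      then obtain i r j s where "a = i + r * x" "b = j + s * x" "i \<in> I" "j \<in> I" by blast
      then show "a + b \<in> ?J" using Iid(2)
        by (intro CollectI exI[of _ "i + j"] exI[of _ "r + s"]) (simp add: algebra_simps)
    next
      fix s a assume "a \<in> ?J"
      then obtain i r where "a = i + r * x" "i \<in> I" by blast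
      then show "s * a \<in> ?J" using Iid(3)
        by (intro CollectI exI[of _ "s * i"] exI[of _ "s * r"]) (simp add: algebra_simps)
    qed
    moreover have IJ: "I \<subseteq> ?J"
    proof
      fix i assume "i \<in> I"
      then show "i \<in> ?J" by (intro CollectI exI[of _ i] exI[of _ 0]) simp
    qed
    moreover have "?J \<inter> M = {}" using no by auto
    ultimately have "?J = I" using max[of ?J] Iid(4) by (auto simp: \<I>_def)
    moreover have "x \<in> ?J" using Iid(1) by (intro CollectI exI[of _ 0] exI[of _ 1]) simp
    ultimately show False using that by simp
  qed
  have prime: "x \<in> I \<or> y \<in> I" if xy: "x * y \<in> I" for x y
  proof (rule ccontr)
    assume "\<not> ?thesis"
    then obtain i r j s where *: "i \<in> I" "i + r * x \<in> M" "j \<in> I" "j + s * y \<in> M"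
      using ext by blast
    have "(i + r * x) * (j + s * y) = (j + s * y) * i + ((r * x) * j + (r * s) * (x * y))"
      by (simp add: algebra_simps)
    then have "(i + r * x) * (j + s * y) \<in> I"
      using * xy Iid(2,3) by simp
    with M(2)[OF *(2,4)] Iid(5) show False by blast
  qed
  interpret scalars \<kappa> by fact
  have "prime_ideal \<kappa> I"
    by standard (use Iid prime M(1) in auto)
  with Iid show ?thesis by blast
qed

section \<open>Elements of a subalgebra as polynomials in the generators\<close>

context scalars
begin

inductive_set monomials_span :: "'r set \<Rightarrow> 'r set" for S where
  base: "\<alpha> \<in> S \<rightarrow>\<^sub>E UNIV \<Longrightarrow> \<kappa> c * (\<Prod>x\<in>S. x ^ \<alpha> x) \<in> monomials_span S"
| add: "x \<in> monomials_span S \<Longrightarrow> y \<in> monomials_span S \<Longrightarrow> x + y \<in> monomials_span S"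

lemma monomials_span_mult:
  assumes "x \<in> monomials_span S" "y \<in> monomials_span S"
  shows "x * y \<in> monomials_span S"
  using assms(1)
proof induction
  case (base \<alpha> c)
  show ?case using assms(2)
  proof induction
    case (base \<beta> d)
    let ?\<gamma> = "\<lambda>x\<in>S. \<alpha> x + \<beta> x"
    have "(\<Prod>x\<in>S. x ^ ?\<gamma> x) = (\<Prod>x\<in>S. x ^ \<alpha> x * x ^ \<beta> x)"
      by (rule prod.cong) (auto simp: power_add)
    then have "\<kappa> c * (\<Prod>x\<in>S. x ^ \<alpha> x) * (\<kappa> d * (\<Prod>x\<in>S. x ^ \<beta> x)) = \<kappa> (c * d) * (\<Prod>x\<in>S. x ^ ?\<gamma> x)"
      by (simp add: prod.distrib k_mult ac_simps)
    moreover have "\<kappa> (c * d) * (\<Prod>x\<in>S. x ^ ?\<gamma> x) \<in> monomials_span S"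
      by (rule monomials_span.base) auto
    ultimately show ?case by simp
  qed (auto simp: distrib_left intro: monomials_span.add)
qed (auto simp: distrib_right intro: monomials_span.add)

lemma falg_monomials_span:
  assumes "finite S" "x \<in> falg \<kappa> S k"
  shows "x \<in> monomials_span S"
  using assms(2)
proof induction
  case (const k c)
  have "\<kappa> c * (\<Prod>x\<in>S. x ^ (\<lambda>x\<in>S. 0) x) \<in> monomials_span S"
    by (rule monomials_span.base) auto
  then show ?case by simp
next
  case (gen g k)
  let ?\<alpha> = "\<lambda>x\<in>S. if x = g then 1 else 0 :: nat"
  have "(\<Prod>x\<in>S. x ^ ?\<alpha> x) = (\<Prod>x\<in>S. if x = g then x else 1)" by (rule prod.cong) auto
  also have "\<dots> = g" using gen assms(1) by simp
  finally have "\<kappa> 1 * (\<Prod>x\<in>S. x ^ ?\<alpha> x) = g" by (simp add: k_1)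
  moreover have "\<kappa> 1 * (\<Prod>x\<in>S. x ^ ?\<alpha> x) \<in> monomials_span S"
    by (rule monomials_span.base) auto
  ultimately show ?case by simp
qed (auto intro: monomials_span.add monomials_span_mult)

lemma monomials_span_monom_sum:
  assumes "x \<in> monomials_span S"
  shows "\<exists>F c. finite F \<and> F \<subseteq> S \<rightarrow>\<^sub>E UNIV \<and> x = monom_sum S F c"
  using assms
proof induction
  case (base \<alpha> c)
  then show ?case
    by (intro exI[of _ "{\<alpha>}"] exI[of _ "\<lambda>_. c"]) (auto simp: monom_sum_def)
next
  case (add x y)
  then obtain F c G d where F: "finite F" "F \<subseteq> S \<rightarrow>\<^sub>E UNIV" "x = monom_sum S F c"
    and G: "finite G" "G \<subseteq> S \<rightarrow>\<^sub>E UNIV" "y = monom_sum S G d" by blast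
  let ?e = "\<lambda>\<alpha>. (if \<alpha> \<in> F then c \<alpha> else 0) + (if \<alpha> \<in> G then d \<alpha> else 0)"
  have "x = monom_sum S (F \<union> G) (\<lambda>\<alpha>. if \<alpha> \<in> F then c \<alpha> else 0)"
    unfolding F(3) monom_sum_def by (rule sum.mono_neutral_cong_left) (use F G in \<open>auto simp: k_0\<close>)
  moreover have "y = monom_sum S (F \<union> G) (\<lambda>\<alpha>. if \<alpha> \<in> G then d \<alpha> else 0)"
    unfolding G(3) monom_sum_def by (rule sum.mono_neutral_cong_left) (use F G in \<open>auto simp: k_0\<close>)
  ultimately have "x + y = monom_sum S (F \<union> G) ?e"
    by (simp add: monom_sum_def k_add distrib_right sum.distrib del: if_split)
  with F G show ?case by (intro exI[of _ "F \<union> G"] exI[of _ ?e]) auto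
qed

lemma powers_span_sum:
  assumes "x \<in> powers_span C c k"
  shows "\<exists>a. (\<forall>i. a i \<in> falg \<kappa> C k) \<and> x = (\<Sum>i<Suc k. a i * c ^ i)"
  using assms
proof induction
  case (base r i)
  have "(\<Sum>j<Suc k. (if j = i then r else 0) * c ^ j) = (\<Sum>j<Suc k. if j = i then r * c ^ j else 0)"
    by (rule sum.cong) auto
  also have "\<dots> = r * c ^ i" using base(2) by (subst sum.delta) auto
  finally show ?case
    using base(1) falg_0 by (intro exI[of _ "\<lambda>j. if j = i then r else 0"]) auto
next
  case (add x y)
  then obtain a b where "\<forall>i. a i \<in> falg \<kappa> C k" "x = (\<Sum>i<Suc k. a i * c ^ i)"
    "\<forall>i. b i \<in> falg \<kappa> C k" "y = (\<Sum>i<Suc k. b i * c ^ i)" by blast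
  then show ?case
    by (intro exI[of _ "\<lambda>i. a i + b i"])
      (simp add: falg_add distrib_right sum.distrib del: sum.lessThan_Suc)
qed

lemma falg_trans:
  assumes "x \<in> falg \<kappa> C' k" "\<And>c. c \<in> C' \<Longrightarrow> \<exists>k. c \<in> falg \<kappa> C k"
  shows "\<exists>k. x \<in> falg \<kappa> C k"
  using assms(1)
proof induction
  case (add k x y)
  then show ?case using falg_add_ex by blast
qed (auto intro: falg_const assms(2) falg_mult)

end

text \<open>Such an \<open>x\<close> is a sum of distinct monomials in \<open>S\<close> with scalar
  coefficients, and membership in \<open>I\<close> forces all of these coefficients to
  vanish.\<close>

lemma (in prime_ideal) alg_indep_eq_0:
  assumes "alg_indep S" "finite S" "x \<in> falg \<kappa> S k" "x \<in> I"
  shows "x = 0"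
proof -
  obtain F c where F: "finite F" "F \<subseteq> S \<rightarrow>\<^sub>E UNIV" "x = monom_sum S F c"
    using monomials_span_monom_sum[OF falg_monomials_span[OF assms(2,3)]] by blast
  with assms(1,4) have "\<forall>\<alpha>\<in>F. c \<alpha> = 0" unfolding alg_indep_def by blast
  with F(3) show ?thesis by (simp add: monom_sum_def k_0)
qed

lemma (in prime_ideal) alg_indep_subset:
  assumes "alg_indep S" "finite S" "T \<subseteq> S"
  shows "alg_indep T"
  unfolding alg_indep_def
proof (intro allI impI)
  fix F c assume F: "finite F" "F \<subseteq> T \<rightarrow>\<^sub>E UNIV" "monom_sum T F c \<in> I"
  let ?e = "\<lambda>\<alpha>::'r \<Rightarrow> nat. \<lambda>x\<in>S. if x \<in> T then \<alpha> x else 0"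
  let ?u = "\<lambda>\<alpha>::'r \<Rightarrow> nat. restrict \<alpha> T"
  have ue: "?u (?e \<alpha>) = \<alpha>" if "\<alpha> \<in> F" for \<alpha>
  proof (rule ext)
    fix x
    have "\<alpha> x = undefined" if "x \<notin> T"
      using F(2) \<open>\<alpha> \<in> F\<close> that by (auto dest: PiE_arb)
    then show "?u (?e \<alpha>) x = \<alpha> x" using assms(3) by (cases "x \<in> T") auto
  qed
  have inj: "inj_on ?e F" by (rule inj_on_inverseI[of _ ?u]) (rule ue)
  have "(\<Prod>x\<in>S. x ^ ?e \<alpha> x) = (\<Prod>x\<in>T. x ^ \<alpha> x)" for \<alpha>
    by (rule prod.mono_neutral_cong_right) (use assms in auto)
  then have "monom_sum S (?e ` F) (c \<circ> ?u) = monom_sum T F c"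
    unfolding monom_sum_def sum.reindex[OF inj] comp_def
    by (intro sum.cong) (simp_all only: ue)
  with F(3) have "monom_sum S (?e ` F) (c \<circ> ?u) \<in> I" by simp
  moreover have "finite (?e ` F)" "?e ` F \<subseteq> S \<rightarrow>\<^sub>E UNIV" using F(1) by auto
  ultimately have "\<forall>\<beta>\<in>?e ` F. (c \<circ> ?u) \<beta> = 0"
    using assms(1) unfolding alg_indep_def by blast
  then show "\<forall>\<alpha>\<in>F. c \<alpha> = 0" using ue by auto
qed

section \<open>Evaluation at points, lifting of generic points and the Nullstellensatz\<close>

abbreviation ev :: "('i::finite \<Rightarrow> 'l::comm_ring_1) \<Rightarrow> ('l, 'i) mpoly \<Rightarrow> 'l" where
  "ev \<equiv> meval (\<lambda>c. c)"

lemma ev_falg_cong: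
  fixes p :: "('l::field, 'i::finite) mpoly"
  assumes "p \<in> falg mconst C k" "\<And>x. x \<in> C \<Longrightarrow> ev w x = ev y x"
  shows "ev w p = ev y p"
  using assms(1) by induction (simp_all add: idc.meval_simps assms(2))

lemma falg_mvar_exhaust:
  fixes p :: "('l::field, 'i::finite) mpoly"
  shows "\<exists>k. p \<in> falg mconst (range mvar) k"
proof (induction p rule: mpoly_generators_induct)
  case (add p q)
  then show ?case using falg_add_ex by blast
next
  case (mult p q)
  then show ?case using falg_mult by blast
qed (auto intro: falg_const falg_gen)

lemma (in scalars) meval_mem_falg:
  assumes "\<And>c. \<kappa> c \<in> range \<kappa>'" "\<And>i. z i \<in> C"
  shows "\<exists>k. meval \<kappa> z p \<in> falg \<kappa>' C k"
proof (induction p rule: mpoly_generators_induct)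
  case (const c)
  obtain d where "\<kappa> c = \<kappa>' d" using assms(1)[of c] by blast
  then show ?case by (auto simp: meval_mconst intro: falg_const)
next
  case (var i)
  show ?case unfolding meval_mvar using falg_gen[OF assms(2)] by blast
next
  case (add p q)
  then show ?case unfolding meval_add using falg_add_ex by blast
next
  case (mult p q)
  then show ?case unfolding meval_times using falg_mult by blast
qed

locale affine_prime = prime_ideal mconst I
  for I :: "('l::{alg_closed_field, field_char_0}, 'i::finite) mpoly set"
begin

text \<open>Maximality makes every other variable algebraic over \<open>S\<close>, and algebraic
  generators do not raise the exponent.\<close>

lemma growth_range_mvar:
  assumes "S \<subseteq> range mvar" "alg_indep S" "\<And>x. x \<in> range mvar - S \<Longrightarrow> \<not> alg_indep (insert x S)"
  shows "growth (range mvar) (card S)"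
proof -
  have fin: "finite S" by (rule finite_subset[OF assms(1)]) simp
  have "growth ((range mvar - S) \<union> S) (card S)"
    by (intro growth_Un_algebraic growth_finite fin algebraic_over_of_dependent assms) auto
  then show ?thesis using assms(1) by (simp add: Un_absorb2)
qed

lemma exists_maximal_indep:
  assumes "S0 \<subseteq> V" "alg_indep S0" "finite V"
  shows "\<exists>S. S0 \<subseteq> S \<and> S \<subseteq> V \<and> alg_indep S \<and> (\<forall>x\<in>V - S. \<not> alg_indep (insert x S))"
proof -
  let ?A = "{S. S \<subseteq> V \<and> alg_indep S}"
  have "finite ?A" using assms(3) by simp
  from finite_has_maximal2[OF this, of S0] assms
  obtain S where S: "S \<in> ?A" "S0 \<subseteq> S" "\<And>T. T \<in> ?A \<Longrightarrow> S \<subseteq> T \<Longrightarrow> S = T" by auto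
  have "\<not> alg_indep (insert x S)" if "x \<in> V - S" for x
    using S(3)[of "insert x S"] S(1) that by blast
  with S show ?thesis by blast
qed

text \<open>Generic points of the coordinate space \<open>S\<close> lift to common zeros of the elements of \<open>I\<close> that
  only involve the variables \<open>T\<close>: one new coordinate \<open>x\<close> at a time, as a root of a relation of
  minimal degree in \<open>x\<close>.\<close>

lemma lifting:
  assumes S: "S \<subseteq> range mvar" "alg_indep S" "growth (range mvar) (card S)"
    and U: "finite U" "U \<subseteq> range mvar" "U \<inter> S = {}" "\<And>x. x \<in> U \<Longrightarrow> algebraic_over S x"
  shows "\<exists>g k. g \<in> falg mconst S k \<and> g \<notin> I \<and>
    (\<forall>y. ev y g \<noteq> 0 \<longrightarrow> (\<exists>w. (\<forall>x\<in>S. ev w x = ev y x) \<and>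
      (\<forall>q\<in>I. \<forall>k. q \<in> falg mconst (S \<union> U) k \<longrightarrow> ev w q = 0)))"
  using U
proof (induction U rule: finite_induct)
  case empty
  have "finite S" by (rule finite_subset[OF S(1)]) simp
  then have "ev y q = 0" if "q \<in> I" "q \<in> falg mconst S k" for y q k
  proof -
    have "q = 0" by (rule alg_indep_eq_0[OF S(2) \<open>finite S\<close> that(2,1)])
    then show ?thesis by (simp add: idc.meval_0)
  qed
  then have "\<exists>w. (\<forall>x\<in>S. ev w x = ev y x) \<and> (\<forall>q\<in>I. \<forall>k. q \<in> falg mconst (S \<union> {}) k \<longrightarrow> ev w q = 0)" for y
    by (intro exI[of _ y]) simp
  with falg_1[of S 0] one_notin show ?case by blast
next
  case (insert x U)
  have finS: "finite S" by (rule finite_subset[OF S(1)]) simp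
  let ?T = "S \<union> U"
  obtain g l where g: "g \<in> falg mconst S l" "g \<notin> I"
    and lift: "\<And>y. ev y g \<noteq> 0 \<Longrightarrow> \<exists>w. (\<forall>x\<in>S. ev w x = ev y x) \<and>
      (\<forall>q\<in>I. \<forall>k. q \<in> falg mconst ?T k \<longrightarrow> ev w q = 0)"
  proof -
    have "U \<subseteq> range mvar" "U \<inter> S = {}" "\<And>x. x \<in> U \<Longrightarrow> algebraic_over S x"
      using insert.prems by auto
    from insert.IH[OF this] show ?thesis using that by blast
  qed
  obtain j where j: "x = mvar j" using insert.prems by auto
  have xT: "x \<notin> ?T" using insert by auto
  define rel where "rel d \<longleftrightarrow> (\<exists>q k. (\<forall>i\<le>d. q i \<in> falg mconst ?T k) \<and> q d \<notin> I \<and> (\<Sum>i\<le>d. q i * x ^ i) \<in> I)" for d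
  have "algebraic_over ?T x"
    by (rule algebraic_over_mono[of S]) (use insert.prems in auto)
  then have "\<exists>d. rel d" unfolding algebraic_over_def rel_def by blast
  define d where "d = (LEAST d. rel d)"
  have "rel d" unfolding d_def using \<open>\<exists>d. rel d\<close> by (rule LeastI_ex)
  then obtain q k where q: "\<And>i. i \<le> d \<Longrightarrow> q i \<in> falg mconst ?T k" "q d \<notin> I" "(\<Sum>i\<le>d. q i * x ^ i) \<in> I"
    unfolding rel_def by blast
  have d: "d > 0" using q(2,3) by (cases d) auto
  obtain k' where "q d \<in> falg mconst (range mvar) k'" using falg_mvar_exhaust by blast
  \<comment> \<open>The leading coefficient \<open>q d\<close> may involve variables of
    \<open>U\<close>, but its multiple \<open>r\<close> modulo \<open>I\<close> involves only
    \<open>S\<close>. So nonvanishing of \<open>r\<close> can be imposed on \<open>y\<close>, and it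
    makes \<open>q d\<close> nonzero at the lifted point.\<close>
  from algebraic_divides[OF S(2) finS S(3,1) this q(2)]
  obtain r h m where r: "r \<in> falg mconst S m" "h \<in> falg mconst (insert (q d) S) m" "r \<notin> I" "r - q d * h \<in> I"
    by blast
  have "\<exists>k. h \<in> falg mconst ?T k"
    by (rule falg_trans[OF r(2)]) (use q(1)[of d] falg_gen[of _ ?T mconst 0] in auto)
  then obtain k'' where k'': "h \<in> falg mconst ?T k''" by blast
  have "r - q d * h \<in> falg mconst ?T (m + (k + k''))"
    by (intro falg_diff falg_mono[OF r(1)] falg_mono[OF falg_mult[OF q(1)[of d] k'']]) auto
  note rT = this
  show ?case
  proof (intro exI[of _ "g * r"] exI[of _ "l + m"] conjI allI impI)
    show "g * r \<in> falg mconst S (l + m)" by (intro falg_mult g r)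
    show "g * r \<notin> I" using prime g r by blast
    fix y assume "ev y (g * r) \<noteq> 0"
    then have y: "ev y g \<noteq> 0" "ev y r \<noteq> 0" by (auto simp: idc.meval_simps)
    obtain w where w: "\<And>x. x \<in> S \<Longrightarrow> ev w x = ev y x" "\<And>q k. q \<in> I \<Longrightarrow> q \<in> falg mconst ?T k \<Longrightarrow> ev w q = 0"
      using lift[OF y(1)] by blast
    have "ev w r = ev y r" by (rule ev_falg_cong[OF r(1) w(1)])
    moreover have "ev w (r - q d * h) = 0" by (rule w(2)[OF r(4) rT])
    ultimately have qd: "ev w (q d) \<noteq> 0" using y(2) by (auto simp: idc.meval_simps)
    obtain \<zeta> where \<zeta>: "(\<Sum>i\<le>d. ev w (q i) * \<zeta> ^ i) = 0"
      using alg_closed[of d "\<lambda>i. ev w (q i)"] d qd by blast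
    define w' where "w' = w(j := \<zeta>)"
    have w'T: "ev w' z = ev w z" if "z \<in> ?T" for z
    proof -
      have "z \<in> range mvar" using that S(1) insert.prems(1) by auto
      then obtain i where "z = mvar i" by blast
      moreover from this have "i \<noteq> j" using xT j that by auto
      ultimately show ?thesis by (simp add: w'_def idc.meval_simps)
    qed
    have w'x: "ev w' x = \<zeta>" by (simp add: j w'_def idc.meval_simps)
    have w'eq: "ev w' p = ev w p" if "p \<in> falg mconst ?T k" for p k
      by (rule ev_falg_cong[OF that w'T])
    have root: "ev w' (\<Sum>i\<le>d. q i * x ^ i) = 0"
      using \<zeta> w'eq[OF q(1)] by (simp add: idc.meval_simps w'x)
    \<comment> \<open>Pseudo-division by the relation of minimal degree. A top coefficient in
      \<open>I\<close> vanishes at \<open>w'\<close> and is dropped. Otherwise minimality gives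
      \<open>d \<le> n\<close>, and \<open>q d\<close> times the element minus a multiple of the
      relation has fewer terms; at \<open>w'\<close> the relation is zero and \<open>q d\<close> is
      not.\<close>
    have kill: "ev w' (\<Sum>i<n. a i * x ^ i) = 0"
      if "\<forall>i<n. a i \<in> falg mconst ?T k0" "(\<Sum>i<n. a i * x ^ i) \<in> I" for n a k0
      using that
    proof (induction n arbitrary: a k0)
      case 0
      then show ?case by (simp add: idc.meval_0)
    next
      case (Suc n)
      show ?case
      proof (cases "a n \<in> I")
        case True
        have "(\<Sum>i<n. a i * x ^ i) \<in> I"
          using diff_mem[OF Suc.prems(2) mult_mem'[OF True, of "x ^ n"]] by simp
        then have "ev w' (\<Sum>i<n. a i * x ^ i) = 0" using Suc.IH Suc.prems(1) by (meson less_SucI)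
        moreover have "ev w' (a n) = 0"
          using w'eq[of "a n" k0] w(2)[OF True, of k0] Suc.prems(1) by simp
        ultimately show ?thesis by (simp add: idc.meval_add idc.meval_times)
      next
        case False
        then have "rel n" unfolding rel_def using Suc.prems
          by (intro exI[of _ a] exI[of _ k0]) (simp add: lessThan_Suc_atMost less_Suc_eq_le)
        then have dn: "d \<le> n" unfolding d_def by (rule Least_le)
        define b where "b i = q d * a i - (if n - d \<le> i then a n * q (i - (n - d)) else 0)" for i
        have shift: "(\<Sum>i<Suc n. (if n - d \<le> i then a n * q (i - (n - d)) else 0) * x ^ i) =
            a n * x ^ (n - d) * (\<Sum>i\<le>d. q i * x ^ i)"
        proof -
          have "(\<Sum>i<Suc n. (if n - d \<le> i then a n * q (i - (n - d)) else 0) * x ^ i) =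
              (\<Sum>i\<in>{n - d..n}. a n * q (i - (n - d)) * x ^ i)"
            by (rule sum.mono_neutral_cong_right) auto
          also have "\<dots> = (\<Sum>i\<le>d. a n * q i * x ^ (n - d + i))"
            by (rule sum.reindex_bij_witness[of _ "\<lambda>i. n - d + i" "\<lambda>i. i - (n - d)"]) (use dn in auto)
          also have "\<dots> = a n * x ^ (n - d) * (\<Sum>i\<le>d. q i * x ^ i)"
            by (simp add: sum_distrib_left power_add ac_simps)
          finally show ?thesis .
        qed
        have "b n = 0" using dn by (simp add: b_def mult.commute)
        then have "(\<Sum>i<n. b i * x ^ i) = (\<Sum>i<Suc n. b i * x ^ i)" by simp
        also have "\<dots> = q d * (\<Sum>i<Suc n. a i * x ^ i) -
            (\<Sum>i<Suc n. (if n - d \<le> i then a n * q (i - (n - d)) else 0) * x ^ i)"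
          unfolding b_def by (simp only: left_diff_distrib sum_subtractf sum_distrib_left mult.assoc)
        finally have eq: "(\<Sum>i<n. b i * x ^ i) = q d * (\<Sum>i<Suc n. a i * x ^ i) -
            a n * x ^ (n - d) * (\<Sum>i\<le>d. q i * x ^ i)"
          by (simp only: shift)
        have "(\<Sum>i<n. b i * x ^ i) \<in> I"
          unfolding eq by (intro diff_mem mult_mem Suc.prems q)
        moreover have "\<forall>i<n. b i \<in> falg mconst ?T (k + k0)"
        proof (intro allI impI)
          fix i assume i: "i < n"
          have 1: "q d * a i \<in> falg mconst ?T (k + k0)"
            by (intro falg_mult q) (use Suc.prems i in auto)
          have 2: "a n * q (i - (n - d)) \<in> falg mconst ?T (k0 + k)"
            by (intro falg_mult q) (use Suc.prems i dn in auto)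
          show "b i \<in> falg mconst ?T (k + k0)"
            unfolding b_def using 1 2 by (auto intro!: falg_diff falg_0 simp: add.commute)
        qed
        ultimately have "ev w' (\<Sum>i<n. b i * x ^ i) = 0" using Suc.IH by blast
        then have "ev w' (q d) * ev w' (\<Sum>i<Suc n. a i * x ^ i) = 0"
          unfolding eq by (simp only: idc.meval_diff idc.meval_times root mult_zero_right diff_zero)
        then show ?thesis using qd w'eq[OF q(1)] by simp
      qed
    qed
    show "\<exists>w. (\<forall>x\<in>S. ev w x = ev y x) \<and>
      (\<forall>q\<in>I. \<forall>k. q \<in> falg mconst (S \<union> insert x U) k \<longrightarrow> ev w q = 0)"
    proof (intro exI[of _ w'] conjI ballI allI impI)
      show "ev w' z = ev y z" if "z \<in> S" for z using w'T[of z] w(1)[OF that] that by simp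
      fix p k0 assume p: "p \<in> I" "p \<in> falg mconst (S \<union> insert x U) k0"
      then have "p \<in> powers_span ?T x k0" using falg_insert_powers_span by simp
      from powers_span_sum[OF this] obtain a where
        "\<forall>i. a i \<in> falg mconst ?T k0" "p = (\<Sum>i<Suc k0. a i * x ^ i)" by blast
      with kill[of "Suc k0" a k0] p(1) show "ev w' p = 0" by blast
    qed
  qed
qed

text \<open>All remaining variables are lifted at once. In addition \<open>b\<close> has a multiple
  \<open>r\<close> modulo \<open>I\<close> in the subalgebra of \<open>S\<close>; if
  \<open>r\<close> is nonzero at \<open>y\<close>, then \<open>b\<close> is nonzero at the
  lift.\<close>

lemma lifting_point:
  assumes S: "S \<subseteq> range mvar" "alg_indep S" "\<And>x. x \<in> range mvar - S \<Longrightarrow> \<not> alg_indep (insert x S)"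
    and "b \<notin> I"
  shows "\<exists>g. g \<notin> I \<and>
    (\<forall>y. ev y g \<noteq> 0 \<longrightarrow> (\<exists>w. (\<forall>x\<in>S. ev w x = ev y x) \<and> (\<forall>q\<in>I. ev w q = 0) \<and> ev w b \<noteq> 0))"
proof -
  have fin: "finite S" by (rule finite_subset[OF S(1)]) simp
  note gr = growth_range_mvar[OF S]
  have "\<exists>g k. g \<in> falg mconst S k \<and> g \<notin> I \<and>
    (\<forall>y. ev y g \<noteq> 0 \<longrightarrow> (\<exists>w. (\<forall>x\<in>S. ev w x = ev y x) \<and>
      (\<forall>q\<in>I. \<forall>k. q \<in> falg mconst (S \<union> (range mvar - S)) k \<longrightarrow> ev w q = 0)))"
    by (rule lifting[OF S(1,2) gr]) (use algebraic_over_of_dependent[OF S(2) S(3) _ fin] in auto)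
  moreover have "S \<union> (range mvar - S) = range mvar" using S(1) by auto
  ultimately obtain g k where g: "g \<in> falg mconst S k" "g \<notin> I"
    and lift0: "\<And>y. ev y g \<noteq> 0 \<Longrightarrow> \<exists>w. (\<forall>x\<in>S. ev w x = ev y x) \<and>
      (\<forall>q\<in>I. \<forall>k. q \<in> falg mconst (range mvar) k \<longrightarrow> ev w q = 0)" by auto
  have lift: "\<exists>w. (\<forall>x\<in>S. ev w x = ev y x) \<and> (\<forall>q\<in>I. ev w q = 0)" if "ev y g \<noteq> 0" for y
    using lift0[OF that] falg_mvar_exhaust by blast
  obtain k' where "b \<in> falg mconst (range mvar) k'" using falg_mvar_exhaust by blast
  from algebraic_divides[OF S(2) fin gr S(1) this assms(4)]
  obtain r h m where r: "r \<in> falg mconst S m" "r \<notin> I" "r - b * h \<in> I" by blast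
  show ?thesis
  proof (intro exI[of _ "g * r"] conjI allI impI)
    show "g * r \<notin> I" using prime g r by blast
    fix y assume "ev y (g * r) \<noteq> 0"
    then have y: "ev y g \<noteq> 0" "ev y r \<noteq> 0" by (auto simp: idc.meval_simps)
    obtain w where w: "\<And>x. x \<in> S \<Longrightarrow> ev w x = ev y x" "\<And>q. q \<in> I \<Longrightarrow> ev w q = 0"
      using lift[OF y(1)] by blast
    have "ev w r = ev y r" by (rule ev_falg_cong[OF r(1) w(1)])
    moreover have "ev w (r - b * h) = 0" by (rule w(2)[OF r(3)])
    ultimately have "ev w b \<noteq> 0" using y(2) by (auto simp: idc.meval_simps)
    with w show "\<exists>w. (\<forall>x\<in>S. ev w x = ev y x) \<and> (\<forall>q\<in>I. ev w q = 0) \<and> ev w b \<noteq> 0" by blast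
  qed
qed

text \<open>The obstruction \<open>g\<close> to lifting is a nonzero polynomial, so some point
  avoids its zeros, and every such point lifts.\<close>

lemma nullstellensatz:
  assumes "b \<notin> I"
  shows "\<exists>w. (\<forall>q\<in>I. ev w q = 0) \<and> ev w b \<noteq> 0"
proof -
  obtain S where S: "S \<subseteq> range mvar" "alg_indep S" "\<And>x. x \<in> range mvar - S \<Longrightarrow> \<not> alg_indep (insert x S)"
    using exists_maximal_indep[of "{}" "range mvar"] alg_indep_empty by auto
  obtain g where g: "g \<notin> I" "\<And>y. ev y g \<noteq> 0 \<Longrightarrow> \<exists>w. (\<forall>q\<in>I. ev w q = 0) \<and> ev w b \<noteq> 0"
    using lifting_point[OF S assms] by blast
  from g(1) have "g \<noteq> 0" using zero_mem by auto
  then show ?thesis using g(2) mpoly_nonvanishing_point[OF idc.scalars_axioms] by blast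
qed

text \<open>Adjoin \<open>x - c\<close> for the value \<open>c\<close> of the coordinate \<open>x\<close> at a generic point.\<close>

lemma larger_prime_ideal:
  assumes "S \<subseteq> range mvar" "alg_indep S" "x \<in> S" "b \<notin> I"
  shows "\<exists>I'. prime_ideal mconst I' \<and> I \<subset> I' \<and> b \<notin> I' \<and> prime_ideal.alg_indep mconst I' (S - {x})"
proof -
  obtain S' where S': "S \<subseteq> S'" "S' \<subseteq> range mvar" "alg_indep S'"
    "\<And>x. x \<in> range mvar - S' \<Longrightarrow> \<not> alg_indep (insert x S')"
    using exists_maximal_indep[OF assms(1,2)] by auto
  have fin: "finite S" by (rule finite_subset[OF assms(1)]) simp
  obtain g where g: "g \<notin> I" and lift: "\<And>y. ev y g \<noteq> 0 \<Longrightarrow>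
      \<exists>w. (\<forall>x\<in>S'. ev w x = ev y x) \<and> (\<forall>q\<in>I. ev w q = 0) \<and> ev w b \<noteq> 0"
    using lifting_point[OF S'(2-4) assms(4)] by blast
  from g have "g \<noteq> 0" using zero_mem by auto
  then obtain y where y: "ev y g \<noteq> 0" using mpoly_nonvanishing_point[OF idc.scalars_axioms] by blast
  obtain j where j: "x = mvar j" using assms by auto
  define c where "c = y j"
  define A where "A = {p + r * (x - mconst c) |p r. p \<in> I}"
  \<comment> \<open>A prime ideal that avoids \<open>M\<close> excludes \<open>b\<close> and meets
    the subalgebra of \<open>S - {x}\<close> only in zero, so \<open>S - {x}\<close> stays
    independent.\<close>
  define M where "M = {b ^ i * h |i h k. h \<in> falg mconst (S - {x}) k \<and> h \<noteq> 0}"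
  have "\<exists>I'. prime_ideal mconst I' \<and> A \<subseteq> I' \<and> I' \<inter> M = {}"
  proof (rule exists_prime_ideal)
    show "0 \<in> A" unfolding A_def using zero_mem by (intro CollectI exI[of _ 0]) simp
    show "p + q \<in> A" if pq: "p \<in> A" "q \<in> A" for p q
    proof -
      obtain a r a' r' where "p = a + r * (x - mconst c)" "q = a' + r' * (x - mconst c)" "a \<in> I" "a' \<in> I"
        using pq unfolding A_def by blast
      then show ?thesis unfolding A_def
        by (intro CollectI exI[of _ "a + a'"] exI[of _ "r + r'"]) (auto simp: distrib_right intro: add_mem)
    qed
    show "s * p \<in> A" if p: "p \<in> A" for s p
    proof -
      obtain a r where "p = a + r * (x - mconst c)" "a \<in> I" using p unfolding A_def by blast
      then show ?thesis unfolding A_def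
        by (intro CollectI exI[of _ "s * a"] exI[of _ "s * r"]) (auto simp: distrib_left mult.assoc intro: mult_mem)
    qed
    show "1 \<in> M" unfolding M_def
      by (intro CollectI exI[of _ 0] exI[of _ 1]) (auto intro: falg_1)
    show "p * q \<in> M" if pq: "p \<in> M" "q \<in> M" for p q
    proof -
      obtain i h k i' h' k' where *: "p = b ^ i * h" "q = b ^ i' * h'"
        "h \<in> falg mconst (S - {x}) k" "h \<noteq> 0" "h' \<in> falg mconst (S - {x}) k'" "h' \<noteq> 0"
        using pq unfolding M_def by blast
      then have "p * q = b ^ (i + i') * (h * h')" by (simp add: power_add ac_simps)
      moreover have "h * h' \<in> falg mconst (S - {x}) (k + k')" "h * h' \<noteq> 0"
        using * by (auto intro: falg_mult simp: mpoly_mult_neq_0)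
      ultimately show ?thesis unfolding M_def by blast
    qed
    show "A \<inter> M = {}"
    proof (rule ccontr)
      assume "A \<inter> M \<noteq> {}"
      then obtain p r i h k where *: "p \<in> I" "p + r * (x - mconst c) = b ^ i * h"
        "h \<in> falg mconst (S - {x}) k" "h \<noteq> 0" unfolding A_def M_def by blast
      \<comment> \<open>A point with \<open>x = c\<close> at which \<open>g\<close> and
        \<open>h\<close> are both nonzero lifts to a zero of \<open>I\<close> at which the left side
        of the equation vanishes and the right side does not. Both \<open>y\<close> and
        \<open>y1(j := c)\<close> lie in the hyperplane \<open>x = c\<close>, hence so does the line
        joining them.\<close>
      obtain y1 where "ev y1 h \<noteq> 0" using mpoly_nonvanishing_point[OF idc.scalars_axioms *(4)] by blast
      moreover have "ev (y1(j := c)) h = ev y1 h"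
        by (rule ev_falg_cong[OF *(3)]) (use assms(1) j in \<open>auto simp: idc.meval_simps\<close>)
      ultimately have "ev (y1(j := c)) h \<noteq> 0" by simp
      from common_nonvanishing_point[OF y this] obtain s where
        s: "ev (\<lambda>i. y i + s * ((y1(j := c)) i - y i)) g \<noteq> 0"
           "ev (\<lambda>i. y i + s * ((y1(j := c)) i - y i)) h \<noteq> 0" by blast
      define y2 where "y2 = (\<lambda>i. y i + s * ((y1(j := c)) i - y i))"
      have y2: "ev y2 g \<noteq> 0" "ev y2 h \<noteq> 0" "ev y2 x = c"
        using s by (simp_all add: y2_def j c_def idc.meval_simps)
      obtain w where w: "\<And>x. x \<in> S' \<Longrightarrow> ev w x = ev y2 x" "\<And>q. q \<in> I \<Longrightarrow> ev w q = 0" "ev w b \<noteq> 0"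
        using lift[OF y2(1)] by blast
      have "ev w h = ev y2 h" by (rule ev_falg_cong[OF *(3)]) (use w(1) S'(1) in auto)
      moreover have "ev w x = c" using w(1) S'(1) assms(3) y2(3) by auto
      then have "ev w (p + r * (x - mconst c)) = 0" using w(2)[OF *(1)] by (simp add: idc.meval_simps)
      ultimately have "ev w b ^ i * ev y2 h = 0" unfolding *(2) by (simp add: idc.meval_simps)
      with w(3) y2(2) show False by simp
    qed
  qed (rule mconst.scalars_axioms)
  then obtain I' where I': "prime_ideal mconst I'" "A \<subseteq> I'" "I' \<inter> M = {}" by blast
  interpret P: prime_ideal mconst I' by fact
  have "I \<subseteq> A"
  proof
    fix p assume "p \<in> I"
    then show "p \<in> A" unfolding A_def by (intro CollectI exI[of _ p] exI[of _ 0]) simp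
  qed
  have "x - mconst c \<in> A" unfolding A_def
    by (intro CollectI exI[of _ 0] exI[of _ 1]) (simp add: zero_mem)
  moreover have "x - mconst c \<notin> I"
  proof
    assume xc: "x - mconst c \<in> I"
    have "x - mconst c \<in> falg mconst S 1"
      by (intro falg_diff falg_const) (use falg_gen[OF assms(3), of mconst 0] in simp)
    from alg_indep_eq_0[OF assms(2) fin this xc] have "x = mconst c" by simp
    then have "ev (\<lambda>_. c + 1) x = c" by (simp add: idc.meval_simps)
    then show False by (simp add: j idc.meval_simps)
  qed
  ultimately have "I \<subset> I'" using I' \<open>I \<subseteq> A\<close> by blast
  moreover have "b \<in> M" unfolding M_def
    by (intro CollectI exI[of _ 1] exI[of _ 1] conjI exI[of _ 0] falg_1) auto
  then have "b \<notin> I'" using I' by blast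
  moreover have "P.alg_indep (S - {x})"
    unfolding P.alg_indep_def
  proof (intro allI impI)
    fix F d assume F: "finite F" "F \<subseteq> S - {x} \<rightarrow>\<^sub>E UNIV" "monom_sum (S - {x}) F d \<in> I'"
    have "\<exists>k. \<forall>\<alpha>\<in>F. (\<Prod>i\<in>S - {x}. i ^ \<alpha> i) \<in> falg mconst (S - {x}) k"
      by (rule falg_common_degree[OF F(1)]) (use monom_mem_falg in auto)
    then obtain k where k: "\<And>\<alpha>. \<alpha> \<in> F \<Longrightarrow> (\<Prod>i\<in>S - {x}. i ^ \<alpha> i) \<in> falg mconst (S - {x}) k" by blast
    have mem: "monom_sum (S - {x}) F d \<in> falg mconst (S - {x}) (0 + k)"
      unfolding monom_sum_def by (intro falg_sum falg_mult falg_const k)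
    have zero: "monom_sum (S - {x}) F d = 0"
    proof (rule ccontr)
      assume "monom_sum (S - {x}) F d \<noteq> 0"
      with mem have "monom_sum (S - {x}) F d \<in> M" unfolding M_def
        by (intro CollectI exI[of _ 0] exI[of _ "monom_sum (S - {x}) F d"] exI[of _ "0 + k"]) simp
      with F I' show False by blast
    qed
    have "(\<Sum>\<alpha>\<in>F. mconst (d \<alpha>) * (\<Prod>i\<in>S - {x}. i ^ \<alpha> i)) \<in> I"
      using zero zero_mem by (simp add: monom_sum_def)
    then show "\<forall>\<alpha>\<in>F. d \<alpha> = 0"
      using alg_indep_subset[OF assms(2) fin, of "S - {x}"] F unfolding alg_indep_def monom_sum_def by blast
  qed
  ultimately show ?thesis using I'(1) by blast
qed

end

text \<open>Each use of \<open>larger_prime_ideal\<close> consumes one independent variable and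
  keeps \<open>b\<close> outside, so the chain has one strict step for every element of
  \<open>S\<close>.\<close>

lemma prime_ideal_chain:
  fixes I :: "('l::{alg_closed_field, field_char_0}, 'i::finite) mpoly set"
  assumes "prime_ideal mconst I" "S \<subseteq> range mvar" "prime_ideal.alg_indep mconst I S" "b \<notin> I"
  shows "\<exists>Q. Q 0 = I \<and> (\<forall>i\<le>card S. prime_ideal mconst (Q i) \<and> b \<notin> Q i) \<and> (\<forall>i<card S. Q i \<subset> Q (Suc i))"
  using assms
proof (induction "card S" arbitrary: S I)
  case 0
  then show ?case by (intro exI[of _ "\<lambda>_. I"]) auto
next
  case (Suc n)
  interpret affine_prime I by (simp add: affine_prime_def Suc.prems)
  from Suc(2) obtain x where x: "x \<in> S" by fastforce
  obtain I' where I': "prime_ideal mconst I'" "I \<subset> I'" "b \<notin> I'" "prime_ideal.alg_indep mconst I' (S - {x})"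
    using larger_prime_ideal[OF Suc.prems(2,3) x Suc.prems(4)] by blast
  have n: "n = card (S - {x})" using Suc(2) x by simp
  obtain Q where Q: "Q 0 = I'" "\<forall>i\<le>n. prime_ideal mconst (Q i) \<and> b \<notin> Q i" "\<forall>i<n. Q i \<subset> Q (Suc i)"
    using Suc(1)[OF n I'(1) _ I'(4,3)] Suc.prems(2) n by auto
  show ?case
    unfolding Suc(2)[symmetric]
  proof (intro exI[of _ "\<lambda>i. case i of 0 \<Rightarrow> I | Suc i \<Rightarrow> Q i"] conjI allI impI)
    fix i
    show "prime_ideal mconst (case i of 0 \<Rightarrow> I | Suc i \<Rightarrow> Q i)" if "i \<le> Suc n"
      using Suc.prems(1) Q(2) that by (cases i) auto
    show "b \<notin> (case i of 0 \<Rightarrow> I | Suc i \<Rightarrow> Q i)" if "i \<le> Suc n"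
      using Suc.prems(4) Q(2) that by (cases i) auto
    show "(case i of 0 \<Rightarrow> I | Suc i \<Rightarrow> Q i) \<subset> (case Suc i of 0 \<Rightarrow> I | Suc i \<Rightarrow> Q i)" if "i < Suc n"
      using I'(2) Q(1,3) that by (cases i) auto
  qed simp
qed

section \<open>Dimension of trivial line bundles\<close>

definition vanishing :: "('i::finite \<Rightarrow> 'l::field) set \<Rightarrow> ('l, 'i) mpoly set" where
  "vanishing Z = {p. \<forall>z\<in>Z. ev z p = 0}"

lemma closedin_subtopology_zariski:
  "closedin (subtopology zariski Y) Z \<longleftrightarrow> (\<exists>A. Z = Y \<inter> zero_locus A)"
  unfolding closedin_subtopology closedin_zariski by blast

lemma irreducible_closed_zariskiI:
  fixes Y :: "('i::finite \<Rightarrow> 'l::field) set"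
  assumes "Z = Y \<inter> zero_locus A" "Z \<noteq> {}"
    and "\<And>p q. p * q \<in> vanishing Z \<Longrightarrow> p \<in> vanishing Z \<or> q \<in> vanishing Z"
  shows "irreducible_closed (subtopology zariski Y) Z"
  unfolding irreducible_closed_def closedin_subtopology_zariski
proof (intro conjI allI impI)
  fix V V' assume V: "(\<exists>A. V = Y \<inter> zero_locus A) \<and> (\<exists>A. V' = Y \<inter> zero_locus A) \<and> Z = V \<union> V'"
  then obtain B B' where B: "V = Y \<inter> zero_locus B" "V' = Y \<inter> zero_locus B'" by blast
  show "Z = V \<or> Z = V'"
  proof (rule ccontr)
    assume "\<not> ?thesis"
    then obtain z z' where z: "z \<in> Z" "z \<notin> V" "z' \<in> Z" "z' \<notin> V'" using V by blast
    then obtain p q where pq: "p \<in> B" "ev z p \<noteq> 0" "q \<in> B'" "ev z' q \<noteq> 0"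
      using B assms(1) by (auto simp: zero_locus_def)
    have "p * q \<in> vanishing Z"
      using V B pq by (auto simp: vanishing_def zero_locus_def idc.meval_times)
    with assms(3) pq z show False by (auto simp: vanishing_def)
  qed
qed (use assms in auto)

text \<open>If a product vanishes on \<open>Z\<close>, then \<open>Z\<close> is the union of the two
  closed subsets where one factor vanishes, and one of them must be all of \<open>Z\<close>.\<close>

lemma irreducible_closed_zariskiD:
  fixes Y :: "('i::finite \<Rightarrow> 'l::field) set"
  assumes "irreducible_closed (subtopology zariski Y) Z"
  shows "Z = Y \<inter> zero_locus (vanishing Z)" "prime_ideal mconst (vanishing Z)" "Z \<noteq> {}"
proof -
  obtain A where A: "Z = Y \<inter> zero_locus A"
    using assms unfolding irreducible_closed_def closedin_subtopology_zariski by blast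
  then have "A \<subseteq> vanishing Z" by (auto simp: vanishing_def zero_locus_def)
  then show "Z = Y \<inter> zero_locus (vanishing Z)"
    using A by (auto simp: vanishing_def zero_locus_def)
  show ne: "Z \<noteq> {}" using assms by (simp add: irreducible_closed_def)
  have prime: "p \<in> vanishing Z \<or> q \<in> vanishing Z" if pq: "p * q \<in> vanishing Z" for p q
  proof -
    have "closedin (subtopology zariski Y) (Z \<inter> zero_locus {r})" for r
      unfolding closedin_subtopology_zariski A
      by (rule exI[of _ "insert r A"]) (auto simp: zero_locus_def)
    moreover have "Z = (Z \<inter> zero_locus {p}) \<union> (Z \<inter> zero_locus {q})"
      using pq by (auto simp: vanishing_def zero_locus_def idc.meval_times)
    ultimately have "Z = Z \<inter> zero_locus {p} \<or> Z = Z \<inter> zero_locus {q}"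
      using assms unfolding irreducible_closed_def by blast
    then show ?thesis by (auto simp: vanishing_def zero_locus_def)
  qed
  show "prime_ideal mconst (vanishing Z)"
    by standard (use ne prime in \<open>auto simp: vanishing_def idc.meval_simps\<close>)
qed

definition closed_chain :: "('i::finite \<Rightarrow> 'l::field) set \<Rightarrow> nat \<Rightarrow> (nat \<Rightarrow> ('i \<Rightarrow> 'l) set) \<Rightarrow> bool" where
  "closed_chain Y d Z \<longleftrightarrow> (\<forall>i\<le>d. irreducible_closed (subtopology zariski Y) (Z i)) \<and> (\<forall>i<d. Z i \<subset> Z (Suc i))"

lemma alg_dim_eq: "alg_dim Y = Sup {ereal (real d) |d. \<exists>Z. closed_chain Y d Z}"
  unfolding alg_dim_def krull_dim_def closed_chain_def ..

lemma alg_dim_eqI: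
  assumes "closed_chain Y n Z" "\<And>d Z. closed_chain Y d Z \<Longrightarrow> d \<le> n"
  shows "alg_dim Y = ereal (real n)"
  unfolding alg_dim_eq by (rule Sup_eqI) (use assms in auto)

lemma alg_dim_eqD:
  assumes "alg_dim Y = ereal (real n)"
  shows "\<exists>Z. closed_chain Y n Z" "closed_chain Y d Z \<Longrightarrow> d \<le> n"
proof -
  have le: "d \<le> n" if "closed_chain Y d Z" for d Z
  proof -
    have "ereal (real d) \<le> alg_dim Y" unfolding alg_dim_eq by (rule Sup_upper) (use that in auto)
    with assms show ?thesis by simp
  qed
  then show "closed_chain Y d Z \<Longrightarrow> d \<le> n" .
  show "\<exists>Z. closed_chain Y n Z"
  proof (rule ccontr)
    assume "\<not> ?thesis"
    then have less: "d < n" if "closed_chain Y d Z" for d Z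
      using le[OF that] that by (cases "d = n") auto
    \<comment> \<open>Lengths are integers, so a supremum not attained at \<open>n\<close> is at
      most \<open>n - 1\<close>. For \<open>n = 0\<close> there is no chain at all, and the empty
      supremum is below \<open>-1\<close>.\<close>
    have "alg_dim Y \<le> ereal (real n - 1)"
      unfolding alg_dim_eq
    proof (rule Sup_least)
      fix e assume "e \<in> {ereal (real d) |d. \<exists>Z. closed_chain Y d Z}"
      then obtain d Z where "e = ereal (real d)" "closed_chain Y d Z" by blast
      moreover from less[OF this(2)] have "real d \<le> real n - 1" by linarith
      ultimately show "e \<le> ereal (real n - 1)" by simp
    qed
    with assms show False by simp
  qed
qed

lemma (in prime_ideal) growth_mono:
  assumes "growth C s" "s \<le> s'" shows "growth C s'"
proof -
  obtain B where B: "\<And>k. spans C k (B * (k + 1) ^ s)"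
    using assms(1) unfolding growth_def by blast
  have "B * (k + 1) ^ s \<le> B * (k + 1) ^ s'" for k
    by (intro mult_le_mono2 power_increasing assms) simp
  then show ?thesis using B unfolding growth_def spans_def by (meson le_trans)
qed

lemma falg_meval:
  fixes p :: "'i::finite \<Rightarrow> ('l::field, 'j::finite) mpoly"
  assumes "q \<in> falg mconst C k"
  shows "meval mconst p q \<in> falg mconst (meval mconst p ` C) k"
  using assms by induction (auto simp: mconst.meval_simps intro: falg_intros)

text \<open>The Nullstellensatz for \<open>q * b\<close> recovers each prime from its zeros in
  \<open>U\<close>, so strict inclusions of primes give strict inclusions of irreducible closed
  sets. Larger primes have smaller zero sets, hence the reversal \<open>s - i\<close>.\<close>

lemma closed_chain_of_primes:
  fixes b :: "('l::{alg_closed_field, field_char_0}, 'i::finite) mpoly"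
  assumes U: "U = zero_locus A \<inter> {z. ev z b \<noteq> 0}" and A: "A \<subseteq> Q 0"
    and Q: "\<And>i. i \<le> s \<Longrightarrow> prime_ideal mconst (Q i)" "\<And>i. i \<le> s \<Longrightarrow> b \<notin> Q i" "\<And>i. i < s \<Longrightarrow> Q i \<subset> Q (Suc i)"
  shows "\<exists>Z. closed_chain U s Z"
proof -
  define V where "V i = U \<inter> zero_locus (Q i)" for i
  have Q0: "Q 0 \<subseteq> Q i" if "i \<le> s" for i
    using that
  proof (induction i)
    case (Suc i)
    then show ?case using Q(3)[of i] by auto
  qed simp
  have van: "vanishing (V i) = Q i" if i: "i \<le> s" for i
  proof
    interpret affine_prime "Q i" using Q(1)[OF i] by (simp add: affine_prime_def)
    show "Q i \<subseteq> vanishing (V i)" by (auto simp: V_def vanishing_def zero_locus_def)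
    show "vanishing (V i) \<subseteq> Q i"
    proof (rule ccontr)
      assume "\<not> ?thesis"
      then obtain q where q: "q \<in> vanishing (V i)" "q \<notin> Q i" by blast
      then have "q * b \<notin> Q i" using prime Q(2)[OF i] by blast
      from nullstellensatz[OF this] obtain w where w: "\<forall>r\<in>Q i. ev w r = 0" "ev w (q * b) \<noteq> 0" by blast
      then have "w \<in> V i" using A Q0[OF i] by (auto simp: V_def U zero_locus_def idc.meval_times)
      with q w show False by (auto simp: vanishing_def idc.meval_times)
    qed
  qed
  have irr: "irreducible_closed (subtopology zariski U) (V i)" if "i \<le> s" for i
  proof (rule irreducible_closed_zariskiI)
    interpret prime_ideal mconst "Q i" using Q(1)[OF that] .
    show "V i = U \<inter> zero_locus (Q i)" by (rule V_def)
    show "V i \<noteq> {}"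
    proof
      assume "V i = {}"
      then have "1 \<in> vanishing (V i)" by (simp add: vanishing_def)
      with van[OF that] one_notin show False by simp
    qed
    show "p * q \<in> vanishing (V i) \<Longrightarrow> p \<in> vanishing (V i) \<or> q \<in> vanishing (V i)" for p q
      unfolding van[OF that] by (rule prime)
  qed
  have "V (Suc i) \<subset> V i" if "i < s" for i
  proof -
    have "V (Suc i) \<subseteq> V i" using Q(3)[OF that] by (auto simp: V_def zero_locus_def)
    moreover have "V (Suc i) \<noteq> V i" using van[of i] van[of "Suc i"] Q(3)[OF that] that by auto
    ultimately show ?thesis by blast
  qed
  then have "V (s - i) \<subset> V (s - Suc i)" if "i < s" for i
    using that by (metis Suc_diff_Suc diff_less zero_less_Suc less_le_trans nat_le_linear not_less diff_le_self Suc_leI)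
  with irr have "closed_chain U s (\<lambda>i. V (s - i))"
    by (auto simp: closed_chain_def)
  then show ?thesis by blast
qed

text \<open>A trivial line bundle \<open>W \<cong> U \<times> L\<close> over a locally closed set \<open>U\<close>, with projection \<open>proj\<close>
  given by the polynomials \<open>p\<close>, fibre coordinate \<open>\<tau>\<close> and inverse map \<open>sec\<close>, which is
  regular on \<open>U\<close> because \<open>b\<close> is invertible there.\<close>

locale line_bundle =
  fixes U :: "('i::finite \<Rightarrow> 'l::{alg_closed_field, field_char_0}) set" and b :: "('l, 'i) mpoly"
    and A :: "('l, 'i) mpoly set"
    and W :: "('j::finite \<Rightarrow> 'l) set" and p :: "'i \<Rightarrow> ('l, 'j) mpoly" and t \<tau> :: "('l, 'j) mpoly"
    and sec :: "('i \<Rightarrow> 'l) \<Rightarrow> 'l \<Rightarrow> 'j \<Rightarrow> 'l"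
  assumes U: "U = zero_locus A \<inter> {z. ev z b \<noteq> 0}"
    and W_U: "w \<in> W \<Longrightarrow> (\<lambda>i. ev w (p i)) \<in> U"
    and W_t: "w \<in> W \<Longrightarrow> ev w t * ev (\<lambda>i. ev w (p i)) b = 1"
    and sec_W: "u \<in> U \<Longrightarrow> sec u s \<in> W"
    and sec_p: "u \<in> U \<Longrightarrow> (\<lambda>i. ev (sec u s) (p i)) = u"
    and sec_\<tau>: "u \<in> U \<Longrightarrow> ev (sec u s) \<tau> = s"
    and sec_inverse: "w \<in> W \<Longrightarrow> sec (\<lambda>i. ev w (p i)) (ev w \<tau>) = w"
    and sec_regular: "\<exists>N q. \<forall>u\<in>U. ev u b ^ N * sec u s j = ev u q"
    and sec_poly: "u \<in> U \<Longrightarrow> \<exists>Q. \<forall>s. sec u s j = poly Q s"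
    and coords: "\<exists>k. mvar j \<in> falg mconst (insert \<tau> (insert t (range p))) k"
begin

abbreviation "proj w \<equiv> (\<lambda>i. ev w (p i))"
abbreviation "\<phi> \<equiv> meval mconst p"

lemma ev_\<phi>: "ev w (\<phi> q) = ev (proj w) q"
  by (rule idc.meval_subst)

lemma b_nonzero: "u \<in> U \<Longrightarrow> ev u b \<noteq> 0"
  by (simp add: U)

text \<open>At a constant height \<open>s\<close>, polynomials on \<open>W\<close> become functions
  on \<open>U\<close> with powers of \<open>b\<close> as denominators, since such functions are
  closed under sums and products.\<close>

lemma ev_sec_regular: "\<exists>N q. \<forall>u\<in>U. ev u b ^ N * ev (sec u s) r = ev u q"
proof (induction r rule: mpoly_generators_induct)
  case (const c)
  show ?case by (intro exI[of _ 0] exI[of _ "mconst c"]) (simp add: idc.meval_simps)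
next
  case (var j)
  show ?case using sec_regular by (simp add: idc.meval_simps)
next
  case (add r r')
  then obtain N q N' q' where *: "\<And>u. u \<in> U \<Longrightarrow> ev u b ^ N * ev (sec u s) r = ev u q"
    "\<And>u. u \<in> U \<Longrightarrow> ev u b ^ N' * ev (sec u s) r' = ev u q'" by blast
  have "ev u b ^ (N + N') * ev (sec u s) (r + r') = ev u (b ^ N' * q + b ^ N * q')" if "u \<in> U" for u
    using *[OF that, symmetric] by (simp add: idc.meval_simps power_add algebra_simps)
  then show ?case by blast
next
  case (mult r r')
  then obtain N q N' q' where *: "\<And>u. u \<in> U \<Longrightarrow> ev u b ^ N * ev (sec u s) r = ev u q"
    "\<And>u. u \<in> U \<Longrightarrow> ev u b ^ N' * ev (sec u s) r' = ev u q'" by blast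
  have "ev u b ^ (N + N') * ev (sec u s) (r * r') = ev u (q * q')" if "u \<in> U" for u
    using *[OF that, symmetric] by (simp add: idc.meval_simps power_add algebra_simps)
  then show ?case by blast
qed

lemma ev_sec_poly: "u \<in> U \<Longrightarrow> \<exists>Q. \<forall>s. ev (sec u s) r = poly Q s"
proof (induction r rule: mpoly_generators_induct)
  case (const c)
  show ?case by (rule exI[of _ "[:c:]"]) (simp add: idc.meval_simps)
next
  case (var j)
  then show ?case using sec_poly by (simp add: idc.meval_simps)
next
  case (add r r')
  then obtain P Q where "\<forall>s. ev (sec u s) r = poly P s" "\<forall>s. ev (sec u s) r' = poly Q s" by blast
  then show ?case by (intro exI[of _ "P + Q"]) (simp add: idc.meval_simps)
next
  case (mult r r')
  then obtain P Q where "\<forall>s. ev (sec u s) r = poly P s" "\<forall>s. ev (sec u s) r' = poly Q s" by blast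
  then show ?case by (intro exI[of _ "P * Q"]) (simp add: idc.meval_simps)
qed

text \<open>After powers of \<open>b\<close> are cleared, \<open>q\<close> and \<open>q'\<close>
  restricted to the section at height \<open>s\<close> become polynomials on \<open>U\<close> whose
  product lies in the prime ideal of \<open>Z\<close>.\<close>

lemma prime_on_fibre:
  assumes Z: "irreducible_closed (subtopology zariski U) Z"
    and "\<And>u. u \<in> Z \<Longrightarrow> ev (sec u s) q * ev (sec u s) q' = 0"
  shows "(\<forall>u\<in>Z. ev (sec u s) q = 0) \<or> (\<forall>u\<in>Z. ev (sec u s) q' = 0)"
proof -
  interpret prime_ideal mconst "vanishing Z" by (rule irreducible_closed_zariskiD[OF Z])
  have ZU: "Z \<subseteq> U" using irreducible_closed_zariskiD[OF Z] by blast
  obtain N r N' r' where *: "\<And>u. u \<in> U \<Longrightarrow> ev u b ^ N * ev (sec u s) q = ev u r"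
    "\<And>u. u \<in> U \<Longrightarrow> ev u b ^ N' * ev (sec u s) q' = ev u r'"
    using ev_sec_regular[of s q] ev_sec_regular[of s q'] by blast
  have "ev u (r * r') = 0" if "u \<in> Z" for u
    using assms(2)[OF that] *[of u, symmetric] that ZU by (auto simp: idc.meval_simps)
  then have "r \<in> vanishing Z \<or> r' \<in> vanishing Z" using prime by (auto simp: vanishing_def)
  then show ?thesis using * ZU b_nonzero by (force simp: vanishing_def)
qed

text \<open>At every height \<open>s\<close> one of the two factors vanishes over all of
  \<open>Z\<close>. One of them does so for infinitely many \<open>s\<close>; on each fibre it is a
  polynomial in \<open>s\<close>, hence zero on the whole preimage. On the zero section the single
  height \<open>0\<close> suffices.\<close>

lemma irreducible_preimage:
  assumes Z: "irreducible_closed (subtopology zariski U) Z"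
  shows "irreducible_closed (subtopology zariski W) {w\<in>W. proj w \<in> Z}"
    and "irreducible_closed (subtopology zariski W) {w\<in>W. proj w \<in> Z \<and> ev w \<tau> = 0}"
proof -
  note Zeq = irreducible_closed_zariskiD(1)[OF Z]
  obtain u0 where u0: "u0 \<in> Z" using irreducible_closed_zariskiD(3)[OF Z] by blast
  then have u0U: "u0 \<in> U" using Zeq by blast
  show "irreducible_closed (subtopology zariski W) {w\<in>W. proj w \<in> Z}"
  proof (rule irreducible_closed_zariskiI)
    show "{w\<in>W. proj w \<in> Z} = W \<inter> zero_locus (\<phi> ` vanishing Z)"
      by (subst Zeq) (auto simp: zero_locus_def ev_\<phi> dest: W_U)
    show "{w\<in>W. proj w \<in> Z} \<noteq> {}"
      using sec_W[OF u0U, of 0] sec_p[OF u0U, of 0] u0 by auto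
    fix q q' assume qq: "q * q' \<in> vanishing {w\<in>W. proj w \<in> Z}"
    have secZ: "sec u s \<in> {w\<in>W. proj w \<in> Z}" if "u \<in> Z" for u s
    proof -
      have "u \<in> U" using that Zeq by blast
      from sec_W[OF this, of s] sec_p[OF this, of s] that show ?thesis by simp
    qed
    have alt: "(\<forall>u\<in>Z. ev (sec u s) q = 0) \<or> (\<forall>u\<in>Z. ev (sec u s) q' = 0)" for s
    proof (rule prime_on_fibre[OF Z])
      show "ev (sec u s) q * ev (sec u s) q' = 0" if "u \<in> Z" for u
        using qq secZ[OF that] unfolding vanishing_def by (auto simp: idc.meval_simps)
    qed
    have van: "r \<in> vanishing {w\<in>W. proj w \<in> Z}" if inf: "infinite {s. \<forall>u\<in>Z. ev (sec u s) r = 0}" for r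
      unfolding vanishing_def
    proof (intro CollectI ballI)
      fix w assume w: "w \<in> {w\<in>W. proj w \<in> Z}"
      obtain Q where Q: "\<And>s. ev (sec (proj w) s) r = poly Q s"
        using ev_sec_poly W_U w by blast
      have "{s. \<forall>u\<in>Z. ev (sec u s) r = 0} \<subseteq> {s. poly Q s = 0}" using w Q by auto
      with inf have "infinite {s. poly Q s = 0}" using finite_subset by blast
      then have "Q = 0" using poly_roots_finite by blast
      then show "ev w r = 0" using Q[of "ev w \<tau>"] sec_inverse w by simp
    qed
    let ?F = "\<lambda>r. {s. \<forall>u\<in>Z. ev (sec u s) r = 0}"
    have "s \<in> ?F q \<union> ?F q'" for s using alt[of s] by simp
    then have "infinite (?F q \<union> ?F q')"
      using infinite_UNIV_char_0[where 'a = 'l] finite_subset[of UNIV "?F q \<union> ?F q'"] by blast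
    then have "infinite (?F q) \<or> infinite (?F q')" by (simp only: finite_Un) blast
    then show "q \<in> vanishing {w\<in>W. proj w \<in> Z} \<or> q' \<in> vanishing {w\<in>W. proj w \<in> Z}"
      using van by blast
  qed
  show "irreducible_closed (subtopology zariski W) {w\<in>W. proj w \<in> Z \<and> ev w \<tau> = 0}"
  proof (rule irreducible_closed_zariskiI)
    show "{w\<in>W. proj w \<in> Z \<and> ev w \<tau> = 0} = W \<inter> zero_locus (insert \<tau> (\<phi> ` vanishing Z))"
      by (subst Zeq) (auto simp: zero_locus_def ev_\<phi> dest: W_U)
    show "{w\<in>W. proj w \<in> Z \<and> ev w \<tau> = 0} \<noteq> {}"
    proof -
      have "sec u0 0 \<in> {w\<in>W. proj w \<in> Z \<and> ev w \<tau> = 0}"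
        using sec_W[OF u0U, of 0] sec_p[OF u0U, of 0] sec_\<tau>[OF u0U, of 0] u0 by simp
      then show ?thesis by blast
    qed
    fix q q' assume qq: "q * q' \<in> vanishing {w\<in>W. proj w \<in> Z \<and> ev w \<tau> = 0}"
    have secZ: "sec u 0 \<in> {w\<in>W. proj w \<in> Z \<and> ev w \<tau> = 0}" if "u \<in> Z" for u
    proof -
      have "u \<in> U" using that Zeq by blast
      from sec_W[OF this, of 0] sec_p[OF this, of 0] sec_\<tau>[OF this, of 0] that show ?thesis by simp
    qed
    have "(\<forall>u\<in>Z. ev (sec u 0) q = 0) \<or> (\<forall>u\<in>Z. ev (sec u 0) q' = 0)"
    proof (rule prime_on_fibre[OF Z])
      show "ev (sec u 0) q * ev (sec u 0) q' = 0" if "u \<in> Z" for u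
        using qq secZ[OF that] unfolding vanishing_def by (auto simp: idc.meval_simps)
    qed
    moreover have "r \<in> vanishing {w\<in>W. proj w \<in> Z \<and> ev w \<tau> = 0}" if r: "\<forall>u\<in>Z. ev (sec u 0) r = 0" for r
      unfolding vanishing_def
    proof (intro CollectI ballI)
      fix w assume w: "w \<in> {w\<in>W. proj w \<in> Z \<and> ev w \<tau> = 0}"
      have "sec (proj w) 0 = w" using sec_inverse[of w] w by simp
      moreover have "ev (sec (proj w) 0) r = 0" using r w by blast
      ultimately show "ev w r = 0" by simp
    qed
    ultimately show "q \<in> vanishing {w\<in>W. proj w \<in> Z \<and> ev w \<tau> = 0} \<or>
        q' \<in> vanishing {w\<in>W. proj w \<in> Z \<and> ev w \<tau> = 0}" by blast
  qed
qed

text \<open>The preimages form a chain of the same length. The zero section over \<open>Z 0\<close>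
  is irreducible, closed and properly contained in the first preimage, which supplies the additional
  step.\<close>

lemma closed_chain_lift:
  assumes "closed_chain U d Z"
  shows "\<exists>Z'. closed_chain W (Suc d) Z'"
proof (intro exI[of _ "\<lambda>i. case i of 0 \<Rightarrow> {w\<in>W. proj w \<in> Z 0 \<and> ev w \<tau> = 0} | Suc i \<Rightarrow> {w\<in>W. proj w \<in> Z i}"])
  let ?Z = "\<lambda>i. case i of 0 \<Rightarrow> {w\<in>W. proj w \<in> Z 0 \<and> ev w \<tau> = 0} | Suc i \<Rightarrow> {w\<in>W. proj w \<in> Z i}"
  have irr: "irreducible_closed (subtopology zariski U) (Z i)" if "i \<le> d" for i
    using assms that by (simp add: closed_chain_def)
  have ZU: "Z i \<subseteq> U" if "i \<le> d" for i using irreducible_closed_zariskiD(1)[OF irr[OF that]] by blast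
  show "closed_chain W (Suc d) ?Z"
    unfolding closed_chain_def
  proof (intro conjI allI impI)
    show "irreducible_closed (subtopology zariski W) (?Z i)" if "i \<le> Suc d" for i
      using irreducible_preimage[OF irr] that by (cases i) auto
    show "?Z i \<subset> ?Z (Suc i)" if i: "i < Suc d" for i
    proof (cases i)
      case 0
      obtain u where u: "u \<in> Z 0" using irreducible_closed_zariskiD(3)[OF irr[of 0]] by auto
      then have "u \<in> U" using ZU[of 0] by auto
      then have "sec u 1 \<in> ?Z 1" "sec u 1 \<notin> ?Z 0"
        using sec_W[of u 1] sec_p[of u 1] sec_\<tau>[of u 1] u by auto
      with 0 show ?thesis by auto
    next
      case (Suc k)
      have "Z k \<subset> Z (Suc k)" using assms i Suc by (simp add: closed_chain_def)
      then obtain u where u: "u \<in> Z (Suc k)" "u \<notin> Z k" "Z k \<subseteq> Z (Suc k)" by blast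
      then have "u \<in> U" using ZU[of "Suc k"] i Suc by auto
      then have "sec u 0 \<in> ?Z (Suc i)" "sec u 0 \<notin> ?Z i"
        using sec_W[of u 0] sec_p[of u 0] u Suc by auto
      with u(3) Suc show ?thesis by auto
    qed
  qed
qed

end

context line_bundle
begin

text \<open>The chain gives \<open>e\<close> independent elements modulo the ideal \<open>J\<close>
  of its largest member. A maximal independent set \<open>S\<close> of variables modulo the
  contraction \<open>I\<close> of \<open>J\<close> gives a chain of length \<open>card S\<close> in
  \<open>U\<close>. Modulo \<open>J\<close> the coordinates of \<open>W\<close> have growth exponent
  at most \<open>card S + 1\<close>, since only \<open>\<tau>\<close> adds to it.\<close>

lemma closed_chain_descend:
  assumes "closed_chain W e Z"
  shows "\<exists>d Z'. closed_chain U d Z' \<and> e \<le> Suc d"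
proof -
  have irr: "irreducible_closed (subtopology zariski W) (Z i)" if "i \<le> e" for i
    using assms that by (simp add: closed_chain_def)
  note van = irreducible_closed_zariskiD[OF irr]
  define J where "J = vanishing (Z e)"
  interpret J: prime_ideal mconst J unfolding J_def by (rule van) simp
  have ZW: "Z e \<subseteq> W" using van(1)[of e] by blast
  have "\<exists>S. finite S \<and> card S = e \<and> J.alg_indep S"
    unfolding J_def
  proof (rule alg_indep_of_chain)
    show "prime_ideal mconst (vanishing (Z i))" if "i \<le> e" for i using van(2)[OF that] .
    show "vanishing (Z (Suc i)) \<subset> vanishing (Z i)" if "i < e" for i
    proof -
      have sub: "Z i \<subset> Z (Suc i)" using assms that by (simp add: closed_chain_def)
      then have "vanishing (Z (Suc i)) \<subseteq> vanishing (Z i)" by (auto simp: vanishing_def)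
      moreover have "vanishing (Z (Suc i)) \<noteq> vanishing (Z i)"
      proof
        assume eq: "vanishing (Z (Suc i)) = vanishing (Z i)"
        have "Z i = W \<inter> zero_locus (vanishing (Z i))" by (rule van(1)) (use that in simp)
        also have "\<dots> = Z (Suc i)"
          unfolding eq[symmetric] by (rule van(1)[symmetric]) (use that in simp)
        finally show False using sub by simp
      qed
      ultimately show ?thesis by blast
    qed
  qed
  then obtain S' where S': "finite S'" "card S' = e" "J.alg_indep S'" by blast
  define I where "I = {q. \<phi> q \<in> J}"
  have "prime_ideal mconst I"
  proof
    show "0 \<in> I" "1 \<notin> I" by (simp_all add: I_def mconst.meval_simps J.zero_mem J.one_notin)
    show "x + y \<in> I" if "x \<in> I" "y \<in> I" for x y
      using J.add_mem that by (simp add: I_def mconst.meval_add)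
    show "r * x \<in> I" if "x \<in> I" for r x
      using J.mult_mem that by (simp add: I_def mconst.meval_times)
    show "x \<in> I \<or> y \<in> I" if "x * y \<in> I" for x y
      using J.prime that by (simp add: I_def mconst.meval_times)
  qed
  then interpret I: affine_prime I by (simp add: affine_prime_def)
  obtain S where S: "S \<subseteq> range mvar" "I.alg_indep S" "\<And>x. x \<in> range mvar - S \<Longrightarrow> \<not> I.alg_indep (insert x S)"
    using I.exists_maximal_indep[of "{}" "range mvar"] I.alg_indep_empty by auto
  have finS: "finite S" by (rule finite_subset[OF S(1)]) simp
  have tb: "t * \<phi> b - 1 \<in> J"
    using W_t ZW by (auto simp: J_def vanishing_def idc.meval_simps ev_\<phi>)
  have \<phi>b: "\<phi> b \<notin> J"
  proof
    assume "\<phi> b \<in> J"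
    from J.diff_mem[OF J.mult_mem[OF this, of t] tb] J.one_notin show False by simp
  qed
  then have b: "b \<notin> I" by (simp add: I_def)
  have A: "A \<subseteq> I"
    using W_U ZW by (auto simp: I_def J_def vanishing_def ev_\<phi> U zero_locus_def)
  from prime_ideal_chain[OF I.prime_ideal_axioms S(1,2) b] obtain Q where
    Q: "Q 0 = I" "\<forall>i\<le>card S. prime_ideal mconst (Q i) \<and> b \<notin> Q i" "\<forall>i<card S. Q i \<subset> Q (Suc i)"
    by blast
  have "\<exists>Z'. closed_chain U (card S) Z'"
  proof (rule closed_chain_of_primes[where Q = Q, OF U])
    show "A \<subseteq> Q 0" using A Q(1) by simp
    show "prime_ideal mconst (Q i)" "b \<notin> Q i" if "i \<le> card S" for i using Q(2) that by simp_all
    show "Q i \<subset> Q (Suc i)" if "i < card S" for i using Q(3) that by simp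
  qed
  then obtain Z' where Z': "closed_chain U (card S) Z'" by blast
  have alg\<phi>: "J.algebraic_over (\<phi> ` S) (\<phi> x)" if "x \<in> range mvar - S" for x
  proof -
    have "I.algebraic_over S x"
      by (rule I.algebraic_over_of_dependent) (use S(2,3) that finS in auto)
    then obtain D d q where "\<forall>i\<le>d. q i \<in> falg mconst S D" "q d \<notin> I" "(\<Sum>i\<le>d. q i * x ^ i) \<in> I"
      unfolding I.algebraic_over_def by blast
    then have "(\<forall>i\<le>d. \<phi> (q i) \<in> falg mconst (\<phi> ` S) D) \<and> \<phi> (q d) \<notin> J \<and> (\<Sum>i\<le>d. \<phi> (q i) * \<phi> x ^ i) \<in> J"
      by (auto simp: I_def mconst.meval_simps intro: falg_meval)
    then show ?thesis unfolding J.algebraic_over_def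
      by (intro exI[of _ D] exI[of _ d] exI[of _ "\<lambda>i. \<phi> (q i)"])
  qed
  have "J.growth (\<phi> ` S) (card S)"
    by (rule J.growth_mono[OF J.growth_finite[OF finite_imageI[OF finS]] card_image_le[OF finS]])
  then have "J.growth (\<phi> ` (range mvar - S) \<union> \<phi> ` S) (card S)"
  proof (rule J.growth_Un_algebraic[rotated])
    show "finite (\<phi> ` (range mvar - S))" by simp
    show "J.algebraic_over (\<phi> ` S) c" if "c \<in> \<phi> ` (range mvar - S)" for c
      using that alg\<phi> by blast
  qed
  moreover have "\<phi> ` (range mvar - S) \<union> \<phi> ` S = range p"
  proof -
    have "\<phi> ` (range mvar - S) \<union> \<phi> ` S = \<phi> ` (range mvar - S \<union> S)" by (rule image_Un[symmetric])
    also have "range mvar - S \<union> S = range mvar" using S(1) by auto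
    also have "\<phi> ` range mvar = range p" by (simp only: image_image mconst.meval_mvar)
    finally show ?thesis .
  qed
  ultimately have "J.growth (range p) (card S)" by simp
  \<comment> \<open>Modulo \<open>J\<close>, \<open>t\<close> is inverse to \<open>\<phi> b\<close>;
    this is a linear relation with coefficients \<open>- 1\<close> and
    \<open>\<phi> b\<close>.\<close>
  moreover have "J.algebraic_over (range p) t"
  proof -
    obtain k where "b \<in> falg mconst (range mvar) k" using falg_mvar_exhaust by blast
    from falg_meval[OF this, of p] have "\<phi> b \<in> falg mconst (range p) k"
      by (simp only: image_image mconst.meval_mvar)
    moreover have "- 1 \<in> falg mconst (range p) k" by (intro mconst.falg_uminus mconst.falg_1)
    ultimately show ?thesis
      unfolding J.algebraic_over_def using \<phi>b tb
      by (intro exI[of _ k] exI[of _ 1] exI[of _ "\<lambda>i. if i = 0 then - 1 else \<phi> b"]) (simp add: mult.commute)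
  qed
  ultimately have gr: "J.growth (insert \<tau> (insert t (range p))) (Suc (card S))"
    by (intro J.growth_insert J.growth_insert_algebraic)
  have "\<exists>D. \<forall>x\<in>S'. x \<in> falg mconst (insert \<tau> (insert t (range p))) D"
  proof (rule J.falg_common_degree[OF S'(1), of "\<lambda>x. x"])
    fix x :: "('l, 'j) mpoly"
    obtain k where k: "x \<in> falg mconst (range mvar) k" using falg_mvar_exhaust by blast
    show "\<exists>k. x \<in> falg mconst (insert \<tau> (insert t (range p))) k"
    proof (rule mconst.falg_trans[OF k])
      fix c assume "c \<in> range (mvar :: 'j \<Rightarrow> ('l, 'j) mpoly)"
      then obtain j where "c = mvar j" by blast
      with coords[of j] show "\<exists>k. c \<in> falg mconst (insert \<tau> (insert t (range p))) k" by simp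
    qed
  qed
  then obtain D where "\<And>x. x \<in> S' \<Longrightarrow> x \<in> falg mconst (insert \<tau> (insert t (range p))) D" by blast
  from J.alg_indep_card_le[OF gr S'(3,1) this] have "e \<le> Suc (card S)" using S'(2) by simp
  with Z' show ?thesis by blast
qed

theorem alg_dim_total_space:
  assumes "alg_dim U = ereal (real n)"
  shows "alg_dim W = ereal (real (Suc n))"
proof -
  obtain Z where "closed_chain U n Z" using alg_dim_eqD(1)[OF assms] by blast
  then obtain Z' where "closed_chain W (Suc n) Z'" using closed_chain_lift by blast
  then show ?thesis
  proof (rule alg_dim_eqI)
    fix e Z assume "closed_chain W e Z"
    then show "e \<le> Suc n" using closed_chain_descend alg_dim_eqD(2)[OF assms] by (meson Suc_le_mono le_trans)
  qed
qed

end

section \<open>Symbols of differential operators\<close>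

lemma normal_ordered_total_symbol: "normal_ordered (total_symbol P) = P"
  unfolding total_symbol_def by (rule theI'[OF ex1_total_symbol])

lemma total_symbol_eqI: "normal_ordered p = P \<Longrightarrow> total_symbol P = p"
  unfolding total_symbol_def by (rule the1_equality[OF ex1_total_symbol])

lemma total_symbol_add: "total_symbol (P + Q) = total_symbol P + total_symbol Q"
  by (rule total_symbol_eqI) (simp add: normal_ordered_add normal_ordered_total_symbol)

lemma total_symbol_0: "total_symbol 0 = 0"
  using total_symbol_add[of 0 0] by simp

text \<open>\<open>subst_ordered G \<theta> p\<close> is \<open>p(x, \<theta>)\<close>, where the ring homomorphism \<open>G\<close> tells how to read
  polynomials in \<open>x\<close>.\<close>

locale weyl_relations =
  fixes G :: "('k::field_char_0, 'n::finite) mpoly \<Rightarrow> 'r::ring_1" and \<theta> :: "'n \<Rightarrow> 'r"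
  assumes G_add: "G (g + h) = G g + G h" and G_mult: "G (g * h) = G g * G h" and G_1: "G 1 = 1"
    and \<theta>_commute: "\<theta> i * \<theta> j = \<theta> j * \<theta> i"
    and \<theta>_G: "\<theta> i * G g = G g * \<theta> i + G (mpderiv i g)"
begin

lemma G_0: "G 0 = 0"
  using G_add[of 0 0] by simp

definition subst_ordered :: "('k, 'n + 'n) mpoly \<Rightarrow> 'r" where
  "subst_ordered p = (\<Sum>m\<in>Poly_Mapping.keys p.
     G (Poly_Mapping.single (of_exponents (\<lambda>i. Poly_Mapping.lookup m (Inl i))) (Poly_Mapping.lookup p m)) *
     npow \<theta> (\<lambda>i. Poly_Mapping.lookup m (Inr i)))"

lemma subst_ordered_add: "subst_ordered (p + q) = subst_ordered p + subst_ordered q"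
  unfolding subst_ordered_def
  by (rule keys_sum_add) (simp_all add: G_0 single_add G_add distrib_right)

lemma subst_ordered_single: "subst_ordered (Poly_Mapping.single m c) =
    G (Poly_Mapping.single (of_exponents (\<lambda>i. Poly_Mapping.lookup m (Inl i))) c) *
     npow \<theta> (\<lambda>i. Poly_Mapping.lookup m (Inr i))"
  by (cases "c = 0") (simp_all add: subst_ordered_def G_0)

lemma subst_ordered_mult_left:
  "subst_ordered (meval mconst (\<lambda>i. mvar (Inl i)) g * q) = G g * subst_ordered q"
proof (induction g arbitrary: q rule: mpoly_generators_induct)
  case (const c)
  show ?case
  proof (induction q rule: mpoly_induct)
    case (single m d)
    show ?case unfolding mconst.meval_mconst
      by (simp add: mconst_def mult_single subst_ordered_single flip: mult.assoc G_mult)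
  qed (simp add: distrib_left subst_ordered_add)
next
  case (var i)
  show ?case
  proof (induction q rule: mpoly_induct)
    case (single m d)
    have "of_exponents (\<lambda>j. Poly_Mapping.lookup (Poly_Mapping.single (Inl i) 1 + m) (Inl j)) =
        Poly_Mapping.single i 1 + of_exponents (\<lambda>j. Poly_Mapping.lookup m (Inl j))"
      by (rule poly_mapping_eqI) (simp add: lookup_add lookup_single when_def)
    moreover have "(\<lambda>j. Poly_Mapping.lookup (Poly_Mapping.single (Inl i) 1 + m) (Inr j)) =
        (\<lambda>j. Poly_Mapping.lookup m (Inr j))"
      by (simp add: fun_eq_iff lookup_add lookup_single)
    ultimately show ?case unfolding mconst.meval_mvar
      by (simp add: mvar_def mult_single subst_ordered_single flip: mult.assoc G_mult)
  qed (simp add: distrib_left subst_ordered_add)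
qed (simp_all add: mconst.meval_simps distrib_right subst_ordered_add G_add G_mult mult.assoc)

text \<open>Moving \<open>\<theta> i\<close> past the polynomial in \<open>x\<close> produces the
  Leibniz term \<open>mpderiv (Inl i) q\<close>, and the result is ordered again. With
  \<open>subst_ordered_mult_left\<close> this describes left multiplication by generators, for
  \<open>normal_ordered\<close> and \<open>tau\<close> alike.\<close>

lemma subst_ordered_\<theta>:
  "subst_ordered (mvar (Inr i) * q + mpderiv (Inl i) q) = \<theta> i * subst_ordered q"
proof (induction q rule: mpoly_induct)
  case (single m c)
  let ?ex = "\<lambda>m :: 'n + 'n \<Rightarrow>\<^sub>0 nat. of_exponents (\<lambda>j. Poly_Mapping.lookup m (Inl j))"
  let ?ez = "\<lambda>m :: 'n + 'n \<Rightarrow>\<^sub>0 nat. \<lambda>j. Poly_Mapping.lookup m (Inr j)"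
  have 1: "?ex (Poly_Mapping.single (Inr i) 1 + m) = ?ex m"
    by (rule poly_mapping_eqI) (simp add: lookup_add lookup_single)
  have 2: "?ez (Poly_Mapping.single (Inr i) 1 + m) = (?ez m)(i := Suc (?ez m i))"
    by (simp add: fun_eq_iff lookup_add lookup_single when_def)
  have 3: "?ex (m - Poly_Mapping.single (Inl i) 1) = ?ex m - Poly_Mapping.single i 1"
    by (rule poly_mapping_eqI) (simp add: lookup_minus lookup_single when_def)
  have 4: "?ez (m - Poly_Mapping.single (Inl i) 1) = ?ez m"
    by (simp add: fun_eq_iff lookup_minus lookup_single)
  let ?g = "Poly_Mapping.single (?ex m) c"
  have 5: "mpderiv i ?g = Poly_Mapping.single (?ex m - Poly_Mapping.single i 1)
      (of_nat (Poly_Mapping.lookup m (Inl i)) * c)"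
    by (simp add: mpderiv_single)
  have "subst_ordered (mvar (Inr i) * Poly_Mapping.single m c) = G ?g * (\<theta> i * npow \<theta> (?ez m))"
    unfolding mvar_def mult_single mult_1 subst_ordered_single 1 2
    by (simp only: npow_Suc[where \<theta> = \<theta> and j = i and e = "?ez m", OF \<theta>_commute])
  moreover have "subst_ordered (mpderiv (Inl i) (Poly_Mapping.single m c)) = G (mpderiv i ?g) * npow \<theta> (?ez m)"
    unfolding mpderiv_single subst_ordered_single 3 4 5[unfolded mpderiv_single] by simp
  ultimately show ?case
    unfolding subst_ordered_add subst_ordered_single
    by (simp only: mult.assoc[symmetric] \<theta>_G distrib_right)
next
  case (add p q)
  have "mvar (Inr i) * (p + q) + mpderiv (Inl i) (p + q) =
      (mvar (Inr i) * p + mpderiv (Inl i) p) + (mvar (Inr i) * q + mpderiv (Inl i) q)"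
    by (simp add: mpderiv_add algebra_simps)
  then show ?case using add by (simp only: subst_ordered_add distrib_left)
qed

end

lemma weyl_relations_weyl: "weyl_relations weyl_poly (weyl_pd :: 'n::finite \<Rightarrow> ('k::field_char_0, 'n) weyl)"
  by standard (simp_all add: weyl_poly_add weyl_poly_mult weyl_poly_1 weyl_pd_poly weyl_pd_commute)

lemma subst_ordered_weyl:
  "weyl_relations.subst_ordered weyl_poly (weyl_pd :: 'n::finite \<Rightarrow> ('k::field_char_0, 'n) weyl) = normal_ordered"
  by (rule ext) (simp add: weyl_relations.subst_ordered_def[OF weyl_relations_weyl] normal_ordered_alt)

lemmas normal_ordered_mult_left =
  weyl_relations.subst_ordered_mult_left[OF weyl_relations_weyl, unfolded subst_ordered_weyl]

lemmas normal_ordered_pd =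
  weyl_relations.subst_ordered_\<theta>[OF weyl_relations_weyl, unfolded subst_ordered_weyl]

definition embed_x :: "('k::field, 'n::finite) mpoly \<Rightarrow> ('k, 'n + 'n) mpoly" where
  "embed_x g = meval mconst (\<lambda>i. mvar (Inl i)) g"

lemma total_symbol_poly_mult: "total_symbol (weyl_poly g * Q) = embed_x g * total_symbol Q"
  by (rule total_symbol_eqI) (simp add: embed_x_def normal_ordered_mult_left normal_ordered_total_symbol)

lemma total_symbol_pd_mult:
  "total_symbol (weyl_pd i * Q) = mvar (Inr i) * total_symbol Q + mpderiv (Inl i) (total_symbol Q)"
  by (rule total_symbol_eqI) (simp add: normal_ordered_pd normal_ordered_total_symbol)

section \<open>Homogeneous parts in the cotangent variables\<close>

definition xi_degree :: "('n + 'n \<Rightarrow>\<^sub>0 nat) \<Rightarrow> int" where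
  "xi_degree m = (\<Sum>i\<in>UNIV. int (Poly_Mapping.lookup m (Inr i)))"

definition xi_part :: "int \<Rightarrow> ('k::comm_ring_1, 'n + 'n) mpoly \<Rightarrow> ('k, 'n + 'n) mpoly" where
  "xi_part k p = (\<Sum>m\<in>{m \<in> Poly_Mapping.keys p. xi_degree m = k}. Poly_Mapping.single m (Poly_Mapping.lookup p m))"

lemma symbol_eq_xi_part: "symbol k P = xi_part k (total_symbol P)"
  by (simp add: symbol_def xi_part_def xi_degree_def)

lemma lookup_xi_part: "Poly_Mapping.lookup (xi_part k p) m = (if xi_degree m = k then Poly_Mapping.lookup p m else 0)"
proof -
  have "Poly_Mapping.lookup (xi_part k p) m =
      (\<Sum>m'\<in>{m \<in> Poly_Mapping.keys p. xi_degree m = k}. if m' = m then Poly_Mapping.lookup p m' else 0)"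
    unfolding xi_part_def lookup_sum by (rule sum.cong) (auto simp: lookup_single when_def)
  also have "\<dots> = (if xi_degree m = k then Poly_Mapping.lookup p m else 0)"
    by (auto simp: in_keys_iff)
  finally show ?thesis .
qed

lemma xi_part_add: "xi_part k (p + q) = xi_part k p + xi_part k q"
  by (rule poly_mapping_eqI) (simp add: lookup_xi_part lookup_add)

lemma xi_part_0: "xi_part k 0 = 0"
  by (rule poly_mapping_eqI) (simp add: lookup_xi_part)

lemma xi_part_single: "xi_part k (Poly_Mapping.single m c) = (if xi_degree m = k then Poly_Mapping.single m c else 0)"
  by (rule poly_mapping_eqI) (auto simp: lookup_xi_part lookup_single when_def)

lemma xi_degree_add: "xi_degree (m + m') = xi_degree m + xi_degree m'"
  by (simp add: xi_degree_def lookup_add sum.distrib)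

lemma xi_degree_Inl: "xi_degree (Poly_Mapping.single (Inl i) n) = 0"
  by (simp add: xi_degree_def lookup_single)

lemma xi_degree_Inr: "xi_degree (Poly_Mapping.single (Inr (i :: 'n::finite)) n) = int n"
proof -
  have "xi_degree (Poly_Mapping.single (Inr i) n) = (\<Sum>j\<in>UNIV. if j = i then int n else 0)"
    unfolding xi_degree_def by (rule sum.cong) (auto simp: lookup_single when_def)
  then show ?thesis by simp
qed

lemma xi_part_embed_x: "xi_part k (embed_x g * q) = embed_x g * xi_part k q"
  unfolding embed_x_def
proof (induction g arbitrary: q rule: mpoly_generators_induct)
  case (const c)
  show ?case
  proof (induction q rule: mpoly_induct)
    case (single m d)
    show ?case unfolding mconst.meval_mconst by (simp add: mconst_def mult_single xi_part_single)
  qed (simp add: distrib_left xi_part_add)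
next
  case (var i)
  show ?case
  proof (induction q rule: mpoly_induct)
    case (single m d)
    show ?case unfolding mconst.meval_mvar by (simp add: mvar_def mult_single xi_part_single xi_degree_add xi_degree_Inl[of i 1, simplified])
  qed (simp add: distrib_left xi_part_add)
qed (simp_all add: mconst.meval_simps distrib_right xi_part_add mult.assoc)

lemma xi_part_Inr: "xi_part (k + 1) (mvar (Inr i) * q) = mvar (Inr (i :: 'n::finite)) * xi_part k q"
proof (induction q rule: mpoly_induct)
  case (single m d)
  show ?case by (simp add: mvar_def mult_single xi_part_single xi_degree_add xi_degree_Inr[of i 1, simplified] add.commute)
qed (simp add: distrib_left xi_part_add)

lemma mpderiv_0: "mpderiv i 0 = 0"
  by (simp add: mpderiv_def)

lemma xi_part_mpderiv: "xi_part k (mpderiv (Inl i) q) = mpderiv (Inl i) (xi_part k q)"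
proof (induction q rule: mpoly_induct)
  case (single m d)
  have "xi_degree (m - Poly_Mapping.single (Inl i) 1) = xi_degree m"
    by (simp add: xi_degree_def lookup_minus lookup_single)
  then show ?case unfolding mpderiv_single xi_part_single by (simp add: mpderiv_single mpderiv_0)
qed (simp add: mpderiv_add xi_part_add)

lemma symbol_poly_mult: "symbol k (weyl_poly g * Q) = embed_x g * symbol k Q"
  by (simp add: symbol_eq_xi_part total_symbol_poly_mult xi_part_embed_x)

text \<open>Differentiation in \<open>x\<close> keeps the degree in \<open>\<xi>\<close>. The
  Leibniz term therefore comes from degree \<open>k + 1\<close> of \<open>Q\<close> and disappears
  when \<open>Q\<close> has order at most \<open>k\<close>.\<close>

lemma symbol_pd_mult:
  "symbol (k + 1) (weyl_pd i * Q) = mvar (Inr i) * symbol k Q + mpderiv (Inl i) (symbol (k + 1) Q)"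
  by (simp add: symbol_eq_xi_part total_symbol_pd_mult xi_part_add xi_part_Inr xi_part_mpderiv)

lemma symbol_add: "symbol k (P + Q) = symbol k P + symbol k Q"
  by (simp add: symbol_eq_xi_part total_symbol_add xi_part_add)

lemma symbol_0: "symbol k 0 = 0"
  by (simp add: symbol_eq_xi_part total_symbol_0 xi_part_0)

lemma symbol_uminus: "symbol k (- P) = - symbol k P"
  using symbol_add[of k P "- P"] by (simp add: symbol_0 eq_neg_iff_add_eq_0 add.commute)

lemma symbol_diff: "symbol k (P - Q) = symbol k P - symbol k Q"
  using symbol_add[of k P "- Q"] by (simp add: symbol_uminus)

lemma order_filtration_iff: "P \<in> order_filtration k \<longleftrightarrow> (\<forall>j>k. symbol j P = 0)"
proof
  assume P: "P \<in> order_filtration k"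
  show "\<forall>j>k. symbol j P = 0"
  proof (intro allI impI poly_mapping_eqI)
    fix j m assume "j > k"
    with P show "Poly_Mapping.lookup (symbol j P) m = Poly_Mapping.lookup 0 m"
      by (force simp: order_filtration_def symbol_eq_xi_part lookup_xi_part xi_degree_def in_keys_iff)
  qed
next
  assume *: "\<forall>j>k. symbol j P = 0"
  show "P \<in> order_filtration k"
    unfolding order_filtration_def
  proof (intro CollectI ballI)
    fix m assume m: "m \<in> Poly_Mapping.keys (total_symbol P)"
    show "(\<Sum>i\<in>UNIV. int (Poly_Mapping.lookup m (Inr i))) \<le> k"
    proof (rule ccontr)
      assume "\<not> ?thesis"
      then have "symbol (xi_degree m) P = 0" using * by (simp add: xi_degree_def)
      then have "Poly_Mapping.lookup (symbol (xi_degree m) P) m = 0" by simp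
      with m show False by (simp add: symbol_eq_xi_part lookup_xi_part in_keys_iff)
    qed
  qed
qed

lemma order_filtration_add: "P \<in> order_filtration k \<Longrightarrow> Q \<in> order_filtration k \<Longrightarrow> P + Q \<in> order_filtration k"
  by (simp add: order_filtration_iff symbol_add)

lemma order_filtration_diff: "P \<in> order_filtration k \<Longrightarrow> Q \<in> order_filtration k \<Longrightarrow> P - Q \<in> order_filtration k"
  by (simp add: order_filtration_iff symbol_diff)

lemma order_filtration_0: "0 \<in> order_filtration k"
  by (simp add: order_filtration_iff symbol_0)

lemma order_filtration_sum: "(\<And>a. a \<in> A \<Longrightarrow> P a \<in> order_filtration k) \<Longrightarrow> sum P A \<in> order_filtration k"
  by (induction A rule: infinite_finite_induct) (auto intro: order_filtration_0 order_filtration_add)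

lemma order_filtration_mono: "P \<in> order_filtration k \<Longrightarrow> k \<le> l \<Longrightarrow> P \<in> order_filtration l"
  by (auto simp: order_filtration_iff)

lemma order_filtration_pred:
  "P \<in> order_filtration k \<Longrightarrow> symbol k P = 0 \<Longrightarrow> P \<in> order_filtration (k - 1)"
  unfolding order_filtration_iff by (metis less_irrefl linorder_neqE zle_diff1_eq not_less)

lemma order_filtration_exhaust: "\<exists>k\<ge>0. P \<in> order_filtration k"
proof -
  let ?k = "Max (insert 0 (xi_degree ` Poly_Mapping.keys (total_symbol P)))"
  have "P \<in> order_filtration ?k"
    unfolding order_filtration_def xi_degree_def[symmetric] by auto
  then show ?thesis by (intro exI[of _ ?k]) auto
qed

text \<open>\<open>P\<close> has order at most \<open>j\<close> and symbol \<open>s\<close>, tested by left multiplication; see \<open>has_symbol_iff\<close>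
  below.\<close>

definition has_symbol :: "int \<Rightarrow> ('k, 'n + 'n) mpoly \<Rightarrow> ('k::field_char_0, 'n::finite) weyl \<Rightarrow> bool" where
  "has_symbol j s P \<longleftrightarrow> (\<forall>k. \<forall>Q\<in>order_filtration k.
     P * Q \<in> order_filtration (j + k) \<and> symbol (j + k) (P * Q) = s * symbol k Q)"

section \<open>Calculus of orders and symbols\<close>

lemma has_symbol_poly: "has_symbol 0 (embed_x g) (weyl_poly g)"
  by (auto simp: has_symbol_def order_filtration_iff symbol_poly_mult)

lemma has_symbol_pd: "has_symbol 1 (mvar (Inr i)) (weyl_pd i)"
  unfolding has_symbol_def
proof (intro allI ballI conjI)
  fix k :: int and Q :: "('b, 'a) weyl" assume Q: "Q \<in> order_filtration k"
  show "weyl_pd i * Q \<in> order_filtration (1 + k)"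
    unfolding order_filtration_iff
  proof (intro allI impI)
    fix j assume "j > 1 + k"
    then have "symbol j Q = 0" "symbol (j - 1) Q = 0" using Q by (simp_all add: order_filtration_iff)
    then show "symbol j (weyl_pd i * Q) = 0"
      using symbol_pd_mult[of "j - 1" i Q] by (simp add: mpderiv_0)
  qed
  have "symbol (k + 1) Q = 0" using Q by (simp add: order_filtration_iff)
  then show "symbol (1 + k) (weyl_pd i * Q) = mvar (Inr i) * symbol k Q"
    using symbol_pd_mult[of k i Q] by (simp add: mpderiv_0 add.commute)
qed

lemma has_symbol_add: "has_symbol j s P \<Longrightarrow> has_symbol j s' P' \<Longrightarrow> has_symbol j (s + s') (P + P')"
  by (auto simp: has_symbol_def distrib_right symbol_add intro: order_filtration_add)

lemma has_symbol_0: "has_symbol j 0 0"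
  by (simp add: has_symbol_def order_filtration_0 symbol_0)

lemma has_symbol_1: "has_symbol 0 1 1"
  by (simp add: has_symbol_def)

lemma has_symbol_uminus: "has_symbol j s P \<Longrightarrow> has_symbol j (- s) (- P)"
  by (auto simp: has_symbol_def order_filtration_iff symbol_uminus)

lemma has_symbol_diff: "has_symbol j s P \<Longrightarrow> has_symbol j s' P' \<Longrightarrow> has_symbol j (s - s') (P - P')"
  using has_symbol_add[OF _ has_symbol_uminus] by fastforce

text \<open>Left multiplications compose, so multiplicativity is immediate for the test in
  \<open>has_symbol\<close>; \<open>has_symbol_iff\<close> then carries it over to
  \<open>symbol\<close>.\<close>

lemma has_symbol_mult: "has_symbol j s P \<Longrightarrow> has_symbol j' s' P' \<Longrightarrow> has_symbol (j + j') (s * s') (P * P')"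
  by (simp add: has_symbol_def mult.assoc add.assoc)

lemma has_symbol_sum:
  "(\<And>a. a \<in> A \<Longrightarrow> has_symbol j (s a) (P a)) \<Longrightarrow> has_symbol j (sum s A) (sum P A)"
  by (induction A rule: infinite_finite_induct) (auto intro: has_symbol_0 has_symbol_add)

lemma has_symbol_power: "has_symbol j s P \<Longrightarrow> has_symbol (int n * j) (s ^ n) (P ^ n)"
proof (induction n)
  case (Suc n)
  then show ?case using has_symbol_mult[of j s P "int n * j" "s ^ n" "P ^ n"] by (simp add: algebra_simps)
qed (simp add: has_symbol_1)

lemma has_symbol_raise: "has_symbol j s P \<Longrightarrow> j < j' \<Longrightarrow> has_symbol j' 0 P"
  by (fastforce simp: has_symbol_def order_filtration_iff)

lemma has_symbolD:
  fixes P :: "('k::field_char_0, 'n::finite) weyl"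
  assumes "has_symbol j s P"
  shows "P \<in> order_filtration j" "symbol j P = s"
proof -
  \<comment> \<open>The operator \<open>1\<close> has order and symbol known exactly, so the test
    with \<open>Q = 1\<close> reads off those of \<open>P\<close>.\<close>
  have "total_symbol (1 :: ('k, 'n) weyl) = 1"
    by (rule total_symbol_eqI)
      (simp add: normal_ordered_single[of 0 1, simplified] npow_0 weyl_poly_1 of_exponents_def)
  then have "symbol k (1 :: ('k, 'n) weyl) = (if k = 0 then 1 else 0)" for k
    using xi_part_single[of k "0 :: 'n + 'n \<Rightarrow>\<^sub>0 nat" "1 :: 'k"] by (simp add: symbol_eq_xi_part xi_degree_def single_one)
  moreover from this have "1 \<in> (order_filtration 0 :: ('k, 'n) weyl set)" by (simp add: order_filtration_iff)
  ultimately show "P \<in> order_filtration j" "symbol j P = s"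
    using assms unfolding has_symbol_def by fastforce+
qed

lemma has_symbol_npow:
  assumes "\<And>i j. \<theta> i * \<theta> j = \<theta> j * \<theta> i" "\<And>i. has_symbol 1 (s i) (\<theta> i)"
  shows "has_symbol (\<Sum>i\<in>UNIV. int (e i)) (\<Prod>i\<in>UNIV. s i ^ e i) (npow \<theta> e)"
proof -
  interpret comp_fun_commute "\<lambda>i A. \<theta> i ^ e i * A" by (rule nfold_commute[OF assms(1)])
  have "has_symbol (\<Sum>i\<in>B. int (e i)) (\<Prod>i\<in>B. s i ^ e i) (Finite_Set.fold (\<lambda>i A. \<theta> i ^ e i * A) 1 B)"
    if "finite B" for B
    using that
  proof induction
    case (insert i B)
    then show ?case
      using has_symbol_mult[OF has_symbol_power[OF assms(2), of "e i" i] insert.IH] by simp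
  qed (simp add: has_symbol_1)
  from this[OF finite] show ?thesis unfolding npow_def .
qed

lemma (in weyl_relations) subst_ordered_alt:
  "subst_ordered p = (\<Sum>m\<in>Poly_Mapping.keys p. subst_ordered (Poly_Mapping.single m (Poly_Mapping.lookup p m)))"
  unfolding subst_ordered_single subst_ordered_def[of p] ..

text \<open>Each monomial of \<open>p\<close> becomes a product of operators with known symbols, and
  those of \<open>\<xi>\<close>-degree below \<open>j\<close> contribute zero. Applied to
  \<open>weyl_pd\<close> it yields \<open>has_symbol_iff\<close>, applied to
  \<open>vartheta f\<close> it yields \<open>has_symbol_tau\<close>.\<close>

lemma has_symbol_subst_ordered:
  fixes G :: "('k::field_char_0, 'n::finite) mpoly \<Rightarrow> ('k, 'r::finite) weyl"
  assumes "weyl_relations G \<theta>" "\<And>g. has_symbol 0 (meval mconst x g) (G g)" "\<And>i. has_symbol 1 (s i) (\<theta> i)"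
    and p: "\<And>k. k > j \<Longrightarrow> xi_part k p = 0"
  shows "has_symbol j (meval mconst (case_sum x s) (xi_part j p)) (weyl_relations.subst_ordered G \<theta> p)"
proof -
  interpret weyl_relations G \<theta> by fact
  have "has_symbol j (meval mconst (case_sum x s) (xi_part j (Poly_Mapping.single m (Poly_Mapping.lookup p m))))
      (subst_ordered (Poly_Mapping.single m (Poly_Mapping.lookup p m)))" if "m \<in> Poly_Mapping.keys p" for m
  proof -
    let ?c = "Poly_Mapping.lookup p m"
    have le: "xi_degree m \<le> j"
    proof (rule ccontr)
      assume "\<not> ?thesis"
      then have "Poly_Mapping.lookup (xi_part (xi_degree m) p) m = 0" using p[of "xi_degree m"] by simp
      with that show False by (simp add: lookup_xi_part in_keys_iff)
    qed
    have "has_symbol (0 + xi_degree m)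
       (meval mconst x (Poly_Mapping.single (of_exponents (\<lambda>i. Poly_Mapping.lookup m (Inl i))) ?c) *
        (\<Prod>i\<in>UNIV. s i ^ Poly_Mapping.lookup m (Inr i))) (subst_ordered (Poly_Mapping.single m ?c))"
      unfolding subst_ordered_single xi_degree_def
      by (intro has_symbol_mult assms(2) has_symbol_npow \<theta>_commute assms(3))
    moreover have "(\<Prod>i\<in>UNIV. case_sum x s i ^ Poly_Mapping.lookup m i) =
       (\<Prod>i\<in>UNIV. x i ^ Poly_Mapping.lookup m (Inl i)) * (\<Prod>i\<in>UNIV. s i ^ Poly_Mapping.lookup m (Inr i))"
      using prod.Plus[of UNIV UNIV "\<lambda>i. case_sum x s i ^ Poly_Mapping.lookup m i"]
      by (simp add: UNIV_Plus_UNIV comp_def)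
    ultimately have "has_symbol (xi_degree m) (meval mconst (case_sum x s) (Poly_Mapping.single m ?c))
        (subst_ordered (Poly_Mapping.single m ?c))"
      by (simp add: mconst.meval_single mult.assoc)
    with le show ?thesis
      by (cases "xi_degree m = j") (auto simp: xi_part_single mconst.meval_0 intro: has_symbol_raise)
  qed
  then have "has_symbol j (\<Sum>m\<in>Poly_Mapping.keys p. meval mconst (case_sum x s) (xi_part j (Poly_Mapping.single m (Poly_Mapping.lookup p m))))
      (subst_ordered p)"
    unfolding subst_ordered_alt[of p] by (rule has_symbol_sum)
  moreover have "(\<Sum>m\<in>Poly_Mapping.keys p. xi_part j (Poly_Mapping.single m (Poly_Mapping.lookup p m))) = xi_part j p"
  proof (rule poly_mapping_eqI)
    fix m
    show "Poly_Mapping.lookup (\<Sum>m\<in>Poly_Mapping.keys p. xi_part j (Poly_Mapping.single m (Poly_Mapping.lookup p m))) m =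
        Poly_Mapping.lookup (xi_part j p) m"
      by (simp add: lookup_sum lookup_xi_part lookup_single when_def in_keys_iff sum.delta)
  qed
  ultimately show ?thesis by (metis (no_types) mconst.meval_sum)
qed

lemma has_symbol_iff:
  fixes P :: "('k::field_char_0, 'n::finite) weyl"
  shows "has_symbol j s P \<longleftrightarrow> P \<in> order_filtration j \<and> symbol j P = s"
proof
  assume *: "P \<in> order_filtration j \<and> symbol j P = s"
  have "has_symbol j (meval mconst (case_sum (\<lambda>i. mvar (Inl i)) (\<lambda>i. mvar (Inr i))) (xi_part j (total_symbol P)))
     (weyl_relations.subst_ordered weyl_poly weyl_pd (total_symbol P))"
    by (rule has_symbol_subst_ordered[OF weyl_relations_weyl])
      (use * in \<open>auto simp: order_filtration_iff symbol_eq_xi_part has_symbol_poly[unfolded embed_x_def] has_symbol_pd\<close>)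
  moreover have "meval mconst (case_sum (\<lambda>i. mvar (Inl i)) (\<lambda>i. mvar (Inr i))) p = p"
    for p :: "('k, 'n + 'n) mpoly"
    by (induction p rule: mpoly_generators_induct) (auto simp: mconst.meval_simps split: sum.splits)
  ultimately show "has_symbol j s P"
    using * by (simp add: subst_ordered_weyl normal_ordered_total_symbol symbol_eq_xi_part)
qed (use has_symbolD in blast)

lemma order_filtration_mult:
  assumes "P \<in> order_filtration j" "Q \<in> order_filtration k"
  shows "P * Q \<in> order_filtration (j + k)" "symbol (j + k) (P * Q) = symbol j P * symbol k Q"
  using has_symbol_mult[of j _ P k _ Q] assms by (simp_all add: has_symbol_iff)

lemma order_filtration_power:
  assumes "P \<in> order_filtration j"
  shows "P ^ n \<in> order_filtration (int n * j)" "symbol (int n * j) (P ^ n) = symbol j P ^ n"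
  using has_symbol_power[of j _ P n] assms by (simp_all add: has_symbol_iff)

text \<open>Symbols multiply in a commutative ring, so the leading parts of the two products
  cancel.\<close>

lemma order_filtration_commutator:
  assumes "P \<in> order_filtration j" "Q \<in> order_filtration k"
  shows "P * Q - Q * P \<in> order_filtration (j + k - 1)"
proof (rule order_filtration_pred)
  show "P * Q - Q * P \<in> order_filtration (j + k)"
    using order_filtration_mult(1)[OF assms] order_filtration_mult(1)[OF assms(2,1)]
    by (auto intro: order_filtration_diff simp: add.commute)
  show "symbol (j + k) (P * Q - Q * P) = 0"
    using order_filtration_mult(2)[OF assms] order_filtration_mult(2)[OF assms(2,1)]
    by (simp add: symbol_diff add.commute mult.commute)
qed

section \<open>The operators \<open>\<vartheta>\<^sub>i\<close> and the ideal \<open>J\<close>\<close>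

definition pull :: "('k::field, 'n::finite) mpoly \<Rightarrow> ('k, 'n option) mpoly" where
  "pull g = meval mconst (\<lambda>i. mvar (Some i)) g"

lemma weyl_pullback_pull: "weyl_pullback g = weyl_poly (pull g)"
  by (simp add: weyl_pullback_def pull_def)

lemma mpderiv_mconst: "mpderiv i (mconst c) = 0"
  by (simp add: mconst_def mpderiv_single)

lemma mpderiv_mvar: "mpderiv i (mvar j) = (if i = j then 1 else 0)"
  by (auto simp: mvar_def mpderiv_single lookup_single)

lemma mpderiv_pull: "mpderiv (Some i) (pull g) = pull (mpderiv i g)"
  unfolding pull_def
  by (induction g rule: mpoly_generators_induct)
    (auto simp: mconst.meval_simps mpderiv_mconst mpderiv_mvar mpderiv_add mpderiv_mult)

lemma mpderiv_None_pull: "mpderiv None (pull g) = 0"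
  unfolding pull_def
  by (induction g rule: mpoly_generators_induct)
    (auto simp: mconst.meval_simps mpderiv_mconst mpderiv_mvar mpderiv_add mpderiv_mult)

lemma weyl_poly_commute: "weyl_poly g * weyl_poly h = weyl_poly h * weyl_poly g"
  by (simp add: mult.commute flip: weyl_poly_mult)

lemma weyl_pullback_add: "weyl_pullback (g + h) = weyl_pullback g + weyl_pullback h"
  and weyl_pullback_mult: "weyl_pullback (g * h) = weyl_pullback g * weyl_pullback h"
  and weyl_pullback_1: "weyl_pullback 1 = 1"
  by (simp_all add: weyl_pullback_pull pull_def mconst.meval_simps weyl_poly_add weyl_poly_mult weyl_poly_1)

lemma pd_Some_pullback:
  "weyl_pd (Some i) * weyl_pullback g = weyl_pullback g * weyl_pd (Some i) + weyl_pullback (mpderiv i g)"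
  by (simp add: weyl_pullback_pull weyl_pd_poly mpderiv_pull)

lemma pd_None_pullback: "weyl_pd None * weyl_pullback g = weyl_pullback g * weyl_pd None"
  by (simp add: weyl_pullback_pull weyl_pd_poly mpderiv_None_pull weyl_poly_0)

lemma t_pullback: "weyl_t * weyl_pullback g = weyl_pullback g * weyl_t"
  unfolding weyl_pullback_pull by (rule weyl_poly_commute)

lemma pd_Some_t: "weyl_pd (Some i) * weyl_t = weyl_t * weyl_pd (Some i)"
  by (simp add: weyl_pd_poly mpderiv_mvar weyl_poly_0)

lemma pd_None_t: "weyl_pd None * weyl_t = weyl_t * weyl_pd None + 1"
  by (simp add: weyl_pd_poly mpderiv_mvar weyl_poly_1)

lemma mpderiv_commute:
  "mpderiv i (mpderiv j g) = mpderiv j (mpderiv i (g :: ('k::field_char_0, 'n) mpoly))"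
proof -
  have "weyl_apply (weyl_pd i * weyl_pd j) g = weyl_apply (weyl_pd j * weyl_pd i) g"
    by (simp only: weyl_pd_commute[of i j])
  then show ?thesis by (simp add: weyl_apply_simps)
qed

text \<open>The operator \<open>E\<close>, that is \<open>\<partial>\<^sub>t t\<^sup>2\<close>,
  commutes with every \<open>weyl_pullback g\<close> and every \<open>weyl_pd (Some i)\<close>. So
  it behaves like a scalar in \<open>\<partial>\<^sub>i - f\<^sub>i E\<close>, and commutation comes
  down to the symmetry of the second derivatives of \<open>f\<close>.\<close>

lemma weyl_relations_vartheta:
  fixes f :: "('k::field_char_0, 'n::finite) mpoly"
  shows "weyl_relations weyl_pullback (vartheta f)"
proof
  define E :: "('k, 'n option) weyl" where "E = weyl_pd None * weyl_t ^ 2"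
  have th: "vartheta f i = weyl_pd (Some i) - weyl_pullback (mpderiv i f) * E" for i
    by (simp add: vartheta_def E_def mult.assoc)
  have EG: "E * weyl_pullback g = weyl_pullback g * E" for g :: "('k, 'n) mpoly"
  proof -
    have "weyl_t ^ 2 * weyl_pullback g = weyl_pullback g * weyl_t ^ 2"
      unfolding weyl_pullback_pull weyl_poly_power[symmetric] by (rule weyl_poly_commute)
    then have "E * weyl_pullback g = (weyl_pd None * weyl_pullback g) * weyl_t ^ 2"
      by (simp only: E_def mult.assoc)
    then show ?thesis by (simp only: pd_None_pullback E_def mult.assoc)
  qed
  have GE: "E * (weyl_pullback g * z) = weyl_pullback g * (E * z)" for g :: "('k, 'n) mpoly" and z
    by (simp only: mult.assoc[symmetric] EG)
  have DE: "weyl_pd (Some i) * E = E * weyl_pd (Some i)" for i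
  proof -
    have t2: "weyl_pd (Some i) * weyl_t ^ 2 = (weyl_t ^ 2 * weyl_pd (Some i) :: ('k, 'n option) weyl)"
      using power_commute_aux[of "weyl_pd (Some i)" "weyl_t :: ('k, 'n option) weyl" 1 2, OF pd_Some_t] by simp
    have "weyl_pd (Some i) * E = (weyl_pd (Some i) * weyl_pd None) * weyl_t ^ 2"
      by (simp only: E_def mult.assoc)
    also have "\<dots> = weyl_pd None * (weyl_pd (Some i) * weyl_t ^ 2)"
      by (simp only: weyl_pd_commute[of "Some i"] mult.assoc)
    also have "\<dots> = E * weyl_pd (Some i)"
      by (simp only: t2 E_def mult.assoc)
    finally show ?thesis .
  qed
  show "vartheta f i * weyl_pullback g = weyl_pullback g * vartheta f i + weyl_pullback (mpderiv i g)" for i g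
  proof -
    have "weyl_pullback h * E * weyl_pullback g = weyl_pullback g * (weyl_pullback h * E)"
      for h :: "('k, 'n) mpoly"
    proof -
      have "weyl_pullback h * E * weyl_pullback g = (weyl_pullback h * weyl_pullback g) * E"
        by (simp only: mult.assoc EG)
      also have "weyl_pullback h * weyl_pullback g = weyl_pullback g * weyl_pullback h"
        by (simp only: weyl_pullback_mult[symmetric] mult.commute[of h g])
      finally show ?thesis by (simp only: mult.assoc)
    qed
    then show ?thesis
      by (simp add: th left_diff_distrib right_diff_distrib pd_Some_pullback)
  qed
  show "vartheta f i * vartheta f j = vartheta f j * vartheta f i" for i j
  proof -
    let ?F = "\<lambda>i. weyl_pullback (mpderiv i f)" and ?F2 = "\<lambda>i j. weyl_pullback (mpderiv i (mpderiv j f))"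
    have exp: "vartheta f i * vartheta f j = weyl_pd (Some i) * weyl_pd (Some j)
       - ?F j * E * weyl_pd (Some i) - ?F i * E * weyl_pd (Some j) - ?F2 i j * E + ?F i * ?F j * E * E" for i j
    proof -
      have "weyl_pd (Some i) * (?F j * E) = ?F j * E * weyl_pd (Some i) + ?F2 i j * E"
        by (simp only: mult.assoc[symmetric] pd_Some_pullback distrib_right) (simp only: mult.assoc DE)
      moreover have "?F i * E * (?F j * E) = ?F i * ?F j * E * E"
        by (simp only: mult.assoc GE)
      ultimately show ?thesis
        by (simp add: th left_diff_distrib right_diff_distrib mult.assoc add.assoc diff_diff_eq2 diff_diff_eq)
    qed
    have "?F i * ?F j = ?F j * ?F i" by (simp only: weyl_pullback_mult[symmetric] mult.commute)
    then show ?thesis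
      unfolding exp by (simp add: weyl_pd_commute[of "Some i"] mpderiv_commute[of i j])
  qed
qed (simp_all add: weyl_pullback_add weyl_pullback_mult weyl_pullback_1)

lemma npow_var_Some:
  "npow (\<lambda>i :: 'n::finite. weyl_var (Some i) :: ('k::field_char_0, 'n option) weyl) e =
    weyl_poly (\<Prod>i\<in>UNIV. mvar (Some i) ^ e i)"
proof -
  interpret comp_fun_commute "\<lambda>i A. (weyl_var (Some i) :: ('k, 'n option) weyl) ^ e i * A"
    by (rule nfold_commute) (rule weyl_poly_commute)
  have "Finite_Set.fold (\<lambda>i A. (weyl_var (Some i) :: ('k, 'n option) weyl) ^ e i * A) 1 B =
      weyl_poly (\<Prod>i\<in>B. mvar (Some i) ^ e i)" if "finite B" for B
    using that by (induction B) (simp_all add: weyl_poly_1 weyl_poly_mult weyl_poly_power)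
  then show ?thesis by (simp add: npow_def)
qed

lemma tau_alt: "tau f P = weyl_relations.subst_ordered weyl_pullback (vartheta f) (total_symbol P)"
proof -
  have "weyl_const c * npow (\<lambda>i. weyl_var (Some i)) e = weyl_pullback (Poly_Mapping.single (of_exponents e) c)" for c :: 'a and e :: "'b \<Rightarrow> nat"
    by (simp add: npow_var_Some weyl_pullback_pull pull_def mconst.meval_single flip: weyl_poly_mult)
  then show ?thesis
    unfolding tau_def normal_subst_def weyl_relations.subst_ordered_def[OF weyl_relations_vartheta] by simp
qed

lemma tau_add: "tau f (P + Q) = tau f P + tau f Q"
  by (simp add: tau_alt total_symbol_add weyl_relations.subst_ordered_add[OF weyl_relations_vartheta])

lemma tau_0: "tau f 0 = 0"
  using tau_add[of f 0 0] by simp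

lemma tau_uminus: "tau f (- P) = - tau f P"
  using tau_add[of f P "- P"] by (simp add: tau_0 eq_neg_iff_add_eq_0 add.commute)

lemma tau_poly_mult: "tau f (weyl_poly g * Q) = weyl_pullback g * tau f Q"
  by (simp add: tau_alt total_symbol_poly_mult embed_x_def
      weyl_relations.subst_ordered_mult_left[OF weyl_relations_vartheta])

lemma tau_pd_mult: "tau f (weyl_pd i * Q) = vartheta f i * tau f Q"
  by (simp add: tau_alt total_symbol_pd_mult weyl_relations.subst_ordered_\<theta>[OF weyl_relations_vartheta])

text \<open>The symbols of \<open>x\<^sub>i\<close> and \<open>\<vartheta>\<^sub>i\<close>.\<close>

definition cotangent_subst :: "('k::field, 'n::finite) mpoly \<Rightarrow> 'n + 'n \<Rightarrow> ('k, 'n option + 'n option) mpoly" where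
  "cotangent_subst f = case_sum (\<lambda>i. mvar (Inl (Some i)))
     (\<lambda>i. mvar (Inr (Some i)) - embed_x (pull (mpderiv i f)) * (mvar (Inr None) * mvar (Inl None) ^ 2))"

lemma embed_x_pull: "embed_x (pull g) = meval mconst (\<lambda>i. mvar (Inl (Some i))) g"
  unfolding embed_x_def pull_def by (simp add: mconst.meval_subst mconst.meval_mvar)

lemma has_symbol_var: "has_symbol 0 (mvar (Inl i)) (weyl_var i)"
  using has_symbol_poly[of "mvar i"] by (simp add: embed_x_def mconst.meval_mvar)

lemma has_symbol_vartheta:
  "has_symbol 1 (mvar (Inr (Some i)) - embed_x (pull (mpderiv i f)) * (mvar (Inr None) * mvar (Inl None) ^ 2))
     (vartheta f i)"
proof -
  have "has_symbol (0 + (1 + int 2 * 0)) (embed_x (pull (mpderiv i f)) * (mvar (Inr None) * mvar (Inl None) ^ 2))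
      (weyl_pullback (mpderiv i f) * (weyl_pd None * weyl_t ^ 2))"
    unfolding weyl_pullback_pull
    by (intro has_symbol_mult has_symbol_power has_symbol_poly has_symbol_pd has_symbol_var)
  then show ?thesis
    unfolding vartheta_def mult.assoc by (intro has_symbol_diff has_symbol_pd) simp
qed

lemma has_symbol_tau:
  assumes "P \<in> order_filtration j"
  shows "has_symbol j (meval mconst (cotangent_subst f) (symbol j P)) (tau f P)"
  unfolding tau_alt cotangent_subst_def symbol_eq_xi_part
proof (rule has_symbol_subst_ordered[OF weyl_relations_vartheta _ has_symbol_vartheta])
  show "has_symbol 0 (meval mconst (\<lambda>i. mvar (Inl (Some i))) g) (weyl_pullback g)" for g
    unfolding weyl_pullback_pull embed_x_pull[symmetric] by (rule has_symbol_poly)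
  show "xi_part k (total_symbol P) = 0" if "k > j" for k
    using assms that by (simp add: order_filtration_iff symbol_eq_xi_part)
qed

section \<open>Left ideals of Weyl algebras\<close>

lemma left_ideal_hull: "left_ideal (left_ideal hull S)"
  by (rule hull_in) (unfold left_ideal_def, blast)

lemma left_ideal_weylI:
  fixes L :: "('k::field_char_0, 'n::finite) weyl set"
  assumes "0 \<in> L" "\<And>a b. a \<in> L \<Longrightarrow> b \<in> L \<Longrightarrow> a + b \<in> L"
    and poly: "\<And>g a. a \<in> L \<Longrightarrow> weyl_poly g * a \<in> L" and pd: "\<And>i a. a \<in> L \<Longrightarrow> weyl_pd i * a \<in> L"
  shows "left_ideal L"
proof -
  have "Weyl A * a \<in> L" if "A \<in> weyl_ops" "a \<in> L" for A a
    using that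
  proof (induction A arbitrary: a rule: weyl_ops.induct)
    case (mult g)
    then show ?case using poly[of a g] by (simp add: weyl_poly_def)
  next
    case (pderiv i)
    then show ?case using pd[of a i] by (simp add: weyl_pd_def)
  next
    case (add A B)
    have "Weyl (\<lambda>h. A h + B h) = Weyl A + Weyl B"
      by (rule plus_weyl.abs_eq[symmetric]) (simp_all add: eq_onp_def add.hyps)
    then show ?case using add assms(2) by (simp add: distrib_right)
  next
    case (comp A B)
    have "Weyl (\<lambda>h. A (B h)) = Weyl A * Weyl B"
      by (rule times_weyl.abs_eq[symmetric]) (simp_all add: eq_onp_def comp.hyps)
    then show ?case using comp by (simp add: mult.assoc)
  qed
  then have "r * a \<in> L" if "a \<in> L" for r a
    using that by (metis weyl_apply weyl_apply_inverse)
  with assms(1,2) show ?thesis by (simp add: left_ideal_def)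
qed

text \<open>The preimage of \<open>J\<close> under \<open>tau f\<close> is stable under left
  multiplication by the generators of \<open>D\<^sub>X\<close>, because these turn into
  \<open>weyl_pullback g\<close> and \<open>vartheta f i\<close>.\<close>

lemma tau_mem_left_ideal:
  assumes "left_ideal J" "tau f ` G \<subseteq> J" "P \<in> left_ideal hull G"
  shows "tau f P \<in> J"
proof -
  have "left_ideal {P. tau f P \<in> J}"
    by (rule left_ideal_weylI)
      (use assms(1) in \<open>auto simp: left_ideal_def tau_0 tau_add tau_poly_mult tau_pd_mult\<close>)
  then have "left_ideal hull G \<subseteq> {P. tau f P \<in> J}"
    by (intro hull_minimal) (use assms(2) in auto)
  with assms(3) show ?thesis by blast
qed

text \<open>\<open>\<partial>\<^sub>t\<close> is written to the left of \<open>t\<close>, so that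
  \<open>t ^ l\<close> meets the generator of the direct image first and acts there as the inverse
  of \<open>f ^ l\<close>, separately for each power of \<open>\<partial>\<^sub>t\<close>.\<close>

definition tau_monom :: "('k::field_char_0, 'n::finite) mpoly \<Rightarrow> nat \<Rightarrow> nat \<Rightarrow> ('k, 'n) weyl \<Rightarrow> ('k, 'n option) weyl" where
  "tau_monom f k l P = weyl_pd None ^ k * weyl_t ^ l * tau f P"

lemma tau_monom_add: "tau_monom f k l (P + Q) = tau_monom f k l P + tau_monom f k l Q"
  by (simp add: tau_monom_def tau_add distrib_left)

lemma tau_monom_0: "tau_monom f k l 0 = 0"
  by (simp add: tau_monom_def tau_0)

lemma tau_monom_uminus: "tau_monom f k l (- P) = - tau_monom f k l P"
  by (simp add: tau_monom_def tau_uminus)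

lemma pullback_tau_monom:
  fixes f g :: "('k::field_char_0, 'n::finite) mpoly"
  shows "weyl_pullback g * tau_monom f k l P = tau_monom f k l (weyl_poly g * P)"
proof -
  let ?D = "weyl_pd None :: ('k, 'n option) weyl" and ?t = "weyl_t :: ('k, 'n option) weyl"
  have 1: "?t ^ l * weyl_pullback g = weyl_pullback g * ?t ^ l"
    using power_commute_aux[of ?t "weyl_pullback g" l 1, OF t_pullback] by simp
  have 2: "?D ^ k * weyl_pullback g = weyl_pullback g * ?D ^ k"
    using power_commute_aux[of ?D "weyl_pullback g" k 1, OF pd_None_pullback] by simp
  have "tau_monom f k l (weyl_poly g * P) = ?D ^ k * (?t ^ l * weyl_pullback g) * tau f P"
    by (simp only: tau_monom_def tau_poly_mult mult.assoc)
  also have "\<dots> = (?D ^ k * weyl_pullback g) * (?t ^ l * tau f P)"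
    by (simp only: 1 mult.assoc)
  also have "\<dots> = weyl_pullback g * tau_monom f k l P"
    by (simp only: 2 tau_monom_def mult.assoc)
  finally show ?thesis by (rule sym)
qed

lemma pd_tau_monom: "weyl_pd None * tau_monom f k l P = tau_monom f (Suc k) l P"
  by (simp add: tau_monom_def mult.assoc)

text \<open>For \<open>k = 0\<close> the truncated exponent \<open>k - 1\<close> is harmless, since
  its coefficient is zero.\<close>

lemma t_pd_power:
  "weyl_t * weyl_pd None ^ k = weyl_pd None ^ k * weyl_t - of_nat k * (weyl_pd None ^ (k - 1) :: ('k::field_char_0, 'n::finite option) weyl)"
proof (induction k)
  case (Suc k)
  let ?D = "weyl_pd None :: ('k, 'n option) weyl" and ?t = "weyl_t :: ('k, 'n option) weyl"
  have "?t * ?D ^ Suc k = (?t * ?D ^ k) * ?D" by (simp add: mult.assoc power_commutes)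
  also have "\<dots> = ?D ^ k * (?t * ?D) - of_nat k * (?D ^ (k - 1) * ?D)"
    unfolding Suc.IH by (simp add: left_diff_distrib mult.assoc)
  also have "?t * ?D = ?D * ?t - 1" by (simp add: pd_None_t)
  also have "of_nat k * (?D ^ (k - 1) * ?D) = of_nat k * ?D ^ k"
    by (cases k) (simp_all add: power_commutes)
  also have "?D ^ k * (?D * ?t - 1) - of_nat k * ?D ^ k = ?D ^ Suc k * ?t - of_nat (Suc k) * ?D ^ k"
    by (simp add: right_diff_distrib distrib_right mult.assoc[symmetric] power_commutes)
  finally show ?case by simp
qed simp

lemma t_power_pd:
  "weyl_t ^ l * weyl_pd None = weyl_pd None * weyl_t ^ l - of_nat l * (weyl_t ^ (l - 1) :: ('k::field_char_0, 'n::finite option) weyl)"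
proof (induction l)
  case (Suc l)
  let ?D = "weyl_pd None :: ('k, 'n option) weyl" and ?t = "weyl_t :: ('k, 'n option) weyl"
  have ofn: "?t * of_nat l = of_nat l * ?t"
    by (induction l) (simp_all add: distrib_left distrib_right)
  have "?t ^ Suc l * ?D = ?t * (?t ^ l * ?D)" by (simp add: mult.assoc)
  also have "\<dots> = (?t * ?D) * ?t ^ l - of_nat l * (?t * ?t ^ (l - 1))"
    unfolding Suc.IH right_diff_distrib by (simp only: mult.assoc[symmetric] ofn)
  also have "?t * ?D = ?D * ?t - 1" by (simp add: pd_None_t)
  also have "of_nat l * (?t * ?t ^ (l - 1)) = of_nat l * ?t ^ l"
    by (cases l) simp_all
  also have "(?D * ?t - 1) * ?t ^ l - of_nat l * ?t ^ l = ?D * ?t ^ Suc l - of_nat (Suc l) * ?t ^ l"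
    by (simp add: left_diff_distrib distrib_right mult.assoc)
  finally show ?case by simp
qed simp

lemma t_tau_monom: "weyl_t * tau_monom f k l P = tau_monom f k (Suc l) P - of_nat k * tau_monom f (k - 1) l P"
proof -
  have "weyl_t * tau_monom f k l P = (weyl_t * weyl_pd None ^ k) * (weyl_t ^ l * tau f P)"
    by (simp add: tau_monom_def mult.assoc)
  then show ?thesis
    unfolding t_pd_power by (simp add: tau_monom_def left_diff_distrib mult.assoc)
qed

text \<open>Here \<open>\<partial>\<^sub>i\<close> is \<open>vartheta f i\<close> plus
  \<open>f\<^sub>i \<partial>\<^sub>t t\<^sup>2\<close>. Bringing the new
  \<open>\<partial>\<^sub>t\<close> to the left past \<open>t ^ l\<close> produces the last summand,
  where for positive \<open>l\<close> the powers \<open>t ^ (l - 1)\<close> and \<open>t ^ 2\<close>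
  combine to \<open>t ^ Suc l\<close>.\<close>

lemma pd_Some_tau_monom:
  fixes f :: "('k::field_char_0, 'n::finite) mpoly"
  shows "weyl_pd (Some i) * tau_monom f k l P = tau_monom f k l (weyl_pd i * P) +
    tau_monom f (Suc k) (l + 2) (weyl_poly (mpderiv i f) * P) -
    of_nat l * tau_monom f k (Suc l) (weyl_poly (mpderiv i f) * P)"
proof -
  let ?D = "weyl_pd None :: ('k, 'n option) weyl" and ?t = "weyl_t :: ('k, 'n option) weyl"
  let ?Q = "weyl_poly (mpderiv i f) * P"
  have 1: "weyl_pd (Some i) * ?D ^ k = ?D ^ k * weyl_pd (Some i)"
    using power_commute_aux[of "weyl_pd (Some i)" ?D 1 k, OF weyl_pd_commute] by simp
  have 2: "weyl_pd (Some i) * ?t ^ l = ?t ^ l * weyl_pd (Some i)"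
    using power_commute_aux[of "weyl_pd (Some i)" ?t 1 l, OF pd_Some_t] by simp
  have "weyl_pd (Some i) * tau_monom f k l P = ?D ^ k * (?t ^ l * (weyl_pd (Some i) * tau f P))"
  proof -
    have "weyl_pd (Some i) * tau_monom f k l P = (weyl_pd (Some i) * ?D ^ k) * (?t ^ l * tau f P)"
      by (simp only: tau_monom_def mult.assoc)
    also have "\<dots> = ?D ^ k * ((weyl_pd (Some i) * ?t ^ l) * tau f P)"
      by (simp only: 1 mult.assoc)
    finally show ?thesis by (simp only: 2 mult.assoc)
  qed
  also have "weyl_pd (Some i) * tau f P =
      tau f (weyl_pd i * P) + ?D * (?t ^ 2 * tau f ?Q)"
  proof -
    have "?D * (?t ^ 2 * (weyl_pullback (mpderiv i f) * tau f P)) = weyl_pullback (mpderiv i f) * (?D * (?t ^ 2 * tau f P))"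
      using pullback_tau_monom[of "mpderiv i f" f 1 2 P] by (simp add: tau_monom_def tau_poly_mult mult.assoc)
    then have "(vartheta f i + weyl_pullback (mpderiv i f) * ?D * ?t ^ 2) * tau f P =
        tau f (weyl_pd i * P) + ?D * (?t ^ 2 * tau f ?Q)"
      by (simp add: distrib_right tau_pd_mult tau_poly_mult mult.assoc)
    then show ?thesis by (simp add: vartheta_def)
  qed
  also have "?D ^ k * (?t ^ l * (tau f (weyl_pd i * P) + ?D * (?t ^ 2 * tau f ?Q))) =
      tau_monom f k l (weyl_pd i * P) + ?D ^ k * ((?t ^ l * ?D) * (?t ^ 2 * tau f ?Q))"
    by (simp add: tau_monom_def distrib_left mult.assoc)
  also have "?D ^ k * ((?t ^ l * ?D) * (?t ^ 2 * tau f ?Q)) =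
      ?D ^ k * (?D * (?t ^ l * (?t ^ 2 * tau f ?Q))) - ?D ^ k * (of_nat l * (?t ^ (l - 1) * (?t ^ 2 * tau f ?Q)))"
    unfolding t_power_pd by (simp add: left_diff_distrib right_diff_distrib mult.assoc)
  also have "?D ^ k * (?D * (?t ^ l * (?t ^ 2 * tau f ?Q))) = tau_monom f (Suc k) (l + 2) ?Q"
    by (simp only: tau_monom_def power_add power_Suc2 mult.assoc)
  also have "?D ^ k * (of_nat l * (?t ^ (l - 1) * (?t ^ 2 * tau f ?Q))) = of_nat l * tau_monom f k (Suc l) ?Q"
  proof -
    have ofn: "z * of_nat l = of_nat l * z" for z :: "('k, 'n option) weyl"
      by (induction l) (simp_all add: distrib_left distrib_right)
    show ?thesis
    proof (cases l)
      case (Suc l')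
      have "?t ^ (l - 1) * ?t ^ 2 = ?t ^ Suc l"
        unfolding Suc by (simp flip: power_add)
      then have "?t ^ (l - 1) * (?t ^ 2 * tau f ?Q) = ?t ^ Suc l * tau f ?Q"
        by (simp only: mult.assoc[symmetric])
      then show ?thesis
        unfolding tau_monom_def by (simp only: mult.assoc[symmetric] ofn)
    qed simp
  qed
  finally show ?thesis by (simp add: add_diff_eq)
qed

text \<open>The relations \<open>P u = 0\<close> for \<open>P \<in> I\<close> and \<open>t f u = u\<close>, multiplied by \<open>\<partial>\<^sub>t\<^sup>k t\<^sup>l\<close> from the left.
  They already span a left ideal.\<close>

inductive_set tau_span ::
    "('k::field_char_0, 'n::finite) mpoly \<Rightarrow> ('k, 'n) weyl set \<Rightarrow> ('k, 'n option) weyl set" for f I where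
  zero: "0 \<in> tau_span f I"
| ideal: "P \<in> I \<Longrightarrow> tau_monom f k l P \<in> tau_span f I"
| unit: "tau_monom f k (Suc l) (weyl_poly f * R) - tau_monom f k l R \<in> tau_span f I"
| add: "x \<in> tau_span f I \<Longrightarrow> y \<in> tau_span f I \<Longrightarrow> x + y \<in> tau_span f I"

lemma left_ideal_uminus: "left_ideal I \<Longrightarrow> P \<in> I \<Longrightarrow> - P \<in> I"
  unfolding left_ideal_def by (metis mult_minus1)

lemma tau_span_uminus:
  assumes "left_ideal I" "x \<in> tau_span f I" shows "- x \<in> tau_span f I"
  using assms(2)
proof induction
  case (ideal P k l)
  then show ?case using tau_span.ideal[OF left_ideal_uminus[OF assms(1)]] by (simp flip: tau_monom_uminus)
next
  case (unit k l R)
  then show ?case using tau_span.unit[of f k l "- R" I] by (simp add: tau_monom_uminus)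
next
  case (add x y)
  then show ?case using tau_span.add[of "- x" f I "- y"] by (simp add: add.commute)
qed (simp add: tau_span.zero)

lemma tau_span_diff:
  "left_ideal I \<Longrightarrow> x \<in> tau_span f I \<Longrightarrow> y \<in> tau_span f I \<Longrightarrow> x - y \<in> tau_span f I"
  using tau_span.add[OF _ tau_span_uminus] by fastforce

lemma tau_span_of_nat: "x \<in> tau_span f I \<Longrightarrow> of_nat n * x \<in> tau_span f I"
  by (induction n) (auto simp: distrib_right intro: tau_span.zero tau_span.add)

lemma left_ideal_mult: "left_ideal I \<Longrightarrow> P \<in> I \<Longrightarrow> r * P \<in> I"
  by (simp add: left_ideal_def)

lemma tau_span_pullback:
  assumes I: "left_ideal I" and x: "x \<in> tau_span f I"
  shows "weyl_pullback g * x \<in> tau_span f I"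
  using x
proof induction
  case (ideal P k l)
  then show ?case
    unfolding pullback_tau_monom by (intro tau_span.ideal left_ideal_mult[OF I])
next
  case (unit k l R)
  have "weyl_poly g * (weyl_poly f * R) = weyl_poly f * (weyl_poly g * R)"
    by (simp only: mult.assoc[symmetric] weyl_poly_commute[of g])
  then show ?case
    unfolding right_diff_distrib pullback_tau_monom using tau_span.unit[of f k l "weyl_poly g * R" I] by simp
qed (auto simp: distrib_left intro: tau_span.zero tau_span.add)

lemma tau_span_t:
  assumes I: "left_ideal I" and x: "x \<in> tau_span f I"
  shows "weyl_t * x \<in> tau_span f I"
  using x
proof induction
  case (ideal P k l)
  then show ?case
    unfolding t_tau_monom by (intro tau_span_diff[OF I] tau_span_of_nat tau_span.ideal)
next
  case (unit k l R)
  have "weyl_t * (tau_monom f k (Suc l) (weyl_poly f * R) - tau_monom f k l R) =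
      (tau_monom f k (Suc (Suc l)) (weyl_poly f * R) - tau_monom f k (Suc l) R) -
      of_nat k * (tau_monom f (k - 1) (Suc l) (weyl_poly f * R) - tau_monom f (k - 1) l R)"
    by (simp add: t_tau_monom right_diff_distrib)
  also have "\<dots> \<in> tau_span f I"
    by (intro tau_span_diff[OF I] tau_span_of_nat tau_span.unit)
  finally show ?case .
qed (auto simp: distrib_left intro: tau_span.zero tau_span.add)

lemma tau_span_pd_None:
  assumes x: "x \<in> tau_span f I"
  shows "weyl_pd None * x \<in> tau_span f I"
  using x
  by induction (auto simp: distrib_left right_diff_distrib pd_tau_monom intro: tau_span.intros)

lemma tau_span_pd_Some:
  assumes I: "left_ideal I" and x: "x \<in> tau_span f I"
  shows "weyl_pd (Some i) * x \<in> tau_span f I"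
  using x
proof induction
  case (ideal P k l)
  then show ?case
    unfolding pd_Some_tau_monom
    by (intro tau_span_diff[OF I] tau_span.add tau_span_of_nat tau_span.ideal left_ideal_mult[OF I])
next
  case (unit k l R)
  let ?f = "weyl_poly f" and ?fi = "weyl_poly (mpderiv i f)" and ?d = "weyl_pd i"
  have 1: "?d * (?f * R) = ?f * (?d * R) + ?fi * R"
    by (simp add: weyl_pd_poly distrib_right flip: mult.assoc)
  have 2: "?fi * (?f * R) = ?f * (?fi * R)"
    by (simp only: mult.assoc[symmetric] weyl_poly_commute[of _ f])
  \<comment> \<open>The Leibniz term of \<open>1\<close> raises the coefficient of
    \<open>tau_monom f k (Suc l) (?fi * R)\<close> from \<open>l\<close> to \<open>Suc l\<close>,
    which is what completes the third unit relation.\<close>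
  have "weyl_pd (Some i) * (tau_monom f k (Suc l) (?f * R) - tau_monom f k l R) =
      ((tau_monom f k (Suc l) (?f * (?d * R)) - tau_monom f k l (?d * R)) +
       (tau_monom f (Suc k) (Suc (l + 2)) (?f * (?fi * R)) - tau_monom f (Suc k) (l + 2) (?fi * R))) -
       of_nat (Suc l) * (tau_monom f k (Suc (Suc l)) (?f * (?fi * R)) - tau_monom f k (Suc l) (?fi * R))"
    unfolding right_diff_distrib pd_Some_tau_monom 1 2 tau_monom_add
    by (simp add: algebra_simps)
  also have "\<dots> \<in> tau_span f I"
    by (intro tau_span_diff[OF I] tau_span_of_nat tau_span.unit tau_span.add)
  finally show ?case .
qed (auto simp: distrib_left intro: tau_span.zero tau_span.add)

lemma left_ideal_tau_span:
  fixes f :: "('k::field_char_0, 'n::finite) mpoly"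
  assumes I: "left_ideal I"
  shows "left_ideal (tau_span f I)"
proof (rule left_ideal_weylI)
  show "weyl_pd i * a \<in> tau_span f I" if "a \<in> tau_span f I" for i a
    using tau_span_pd_None[OF that] tau_span_pd_Some[OF I that] by (cases i) auto
  show "weyl_poly g * a \<in> tau_span f I" if "a \<in> tau_span f I" for g a
    using that
  proof (induction g arbitrary: a rule: mpoly_generators_induct)
    case (const c)
    have "weyl_poly (mconst c) = weyl_pullback (mconst c :: ('k, 'n) mpoly)"
      by (simp add: weyl_pullback_pull pull_def mconst.meval_mconst)
    with tau_span_pullback[OF I const] show ?case by simp
  next
    case (var i)
    show ?case
    proof (cases i)
      case None
      with tau_span_t[OF I var] show ?thesis by simp
    next
      case (Some j)
      have "weyl_var (Some j) = weyl_pullback (mvar j :: ('k, 'n) mpoly)"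
        by (simp add: weyl_pullback_pull pull_def mconst.meval_mvar)
      with tau_span_pullback[OF I var] Some show ?thesis by simp
    qed
  next
    case (add p q)
    then show ?case by (simp add: weyl_poly_add distrib_right tau_span.add)
  next
    case (mult p q)
    then show ?case by (simp add: weyl_poly_mult mult.assoc)
  qed
qed (auto intro: tau_span.zero tau_span.add)

lemma total_symbol_1: "total_symbol (1 :: ('k::field_char_0, 'n::finite) weyl) = 1"
  by (rule total_symbol_eqI)
    (simp add: normal_ordered_single[of 0 1, simplified] npow_0 weyl_poly_1 of_exponents_def)

lemma tau_1: "tau f 1 = 1"
proof -
  have "weyl_relations.subst_ordered weyl_pullback (vartheta f) (Poly_Mapping.single 0 1) = 1"
    unfolding weyl_relations.subst_ordered_single[OF weyl_relations_vartheta]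
    by (simp add: of_exponents_def weyl_pullback_1 npow_0)
  then show ?thesis unfolding tau_alt total_symbol_1 single_one .
qed

lemma hull_subset_tau_span:
  assumes "left_ideal I" "G \<subseteq> I"
  shows "left_ideal hull (tau f ` G \<union> {weyl_t * weyl_pullback f - 1}) \<subseteq> tau_span f I"
proof (rule hull_minimal)
  have "tau_monom f 0 (Suc 0) (weyl_poly f * 1) - tau_monom f 0 0 1 = weyl_t * weyl_pullback f - 1"
    unfolding tau_monom_def tau_poly_mult by (simp add: tau_1)
  then have "weyl_t * weyl_pullback f - 1 \<in> tau_span f I"
    using tau_span.unit[of f 0 0 1 I] by simp
  moreover have "tau f P \<in> tau_span f I" if "P \<in> G" for P
    using tau_span.ideal[of P I f 0 0] assms(2) that by (auto simp: tau_monom_def)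
  ultimately show "tau f ` G \<union> {weyl_t * weyl_pullback f - 1} \<subseteq> tau_span f I" by blast
qed (rule left_ideal_tau_span[OF assms(1)])

text \<open>The coefficient of \<open>\<partial>\<^sub>t\<^sup>k\<close> lies in \<open>I\<close> after \<open>t\<close> is replaced by \<open>1/f\<close> and the denominators are
  cleared.\<close>

definition tau_rep :: "('k::field_char_0, 'n::finite) mpoly \<Rightarrow> ('k, 'n) weyl set \<Rightarrow> nat \<Rightarrow>
    (nat \<Rightarrow> nat \<Rightarrow> ('k, 'n) weyl) \<Rightarrow> ('k, 'n option) weyl \<Rightarrow> bool" where
  "tau_rep f I N b x \<longleftrightarrow> (\<forall>k l. N \<le> k \<or> N \<le> l \<longrightarrow> b k l = 0) \<and>
     x = (\<Sum>k<N. \<Sum>l<N. tau_monom f k l (b k l)) \<and> (\<forall>k. (\<Sum>l<N. weyl_poly (f ^ (N - l)) * b k l) \<in> I)"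

text \<open>Raising \<open>N\<close> multiplies the cleared coefficients by \<open>f\<close>, under
  which \<open>I\<close> is stable. So the representations of two summands can be brought to a
  common \<open>N\<close>.\<close>

lemma tau_rep_Suc:
  assumes I: "left_ideal I" and rep: "tau_rep f I N b x"
  shows "tau_rep f I (Suc N) b x"
  unfolding tau_rep_def
proof (intro conjI allI impI)
  have b0: "\<And>k l. N \<le> k \<or> N \<le> l \<Longrightarrow> b k l = 0" using rep by (auto simp: tau_rep_def)
  show "b k l = 0" if "Suc N \<le> k \<or> Suc N \<le> l" for k l using b0 that by auto
  show "x = (\<Sum>k<Suc N. \<Sum>l<Suc N. tau_monom f k l (b k l))"
    using rep b0 by (simp add: tau_rep_def tau_monom_0)
  fix k
  have "(\<Sum>l<Suc N. weyl_poly (f ^ (Suc N - l)) * b k l) = (\<Sum>l<N. weyl_poly (f ^ (Suc N - l)) * b k l)"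
    using b0 by simp
  also have "\<dots> = weyl_poly f * (\<Sum>l<N. weyl_poly (f ^ (N - l)) * b k l)"
    unfolding sum_distrib_left
  proof (rule sum.cong)
    fix l assume "l \<in> {..<N}"
    then have "Suc N - l = Suc (N - l)" by auto
    then show "weyl_poly (f ^ (Suc N - l)) * b k l = weyl_poly f * (weyl_poly (f ^ (N - l)) * b k l)"
      by (simp add: weyl_poly_mult mult.assoc)
  qed simp
  finally show "(\<Sum>l<Suc N. weyl_poly (f ^ (Suc N - l)) * b k l) \<in> I"
    using rep left_ideal_mult[OF I] by (simp add: tau_rep_def)
qed

lemma tau_rep_mono:
  assumes "left_ideal I" "tau_rep f I N b x" "N \<le> N'"
  shows "tau_rep f I N' b x"
  using assms(3) by (induction rule: dec_induct) (use assms(1,2) tau_rep_Suc in auto)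

definition single_coeff :: "nat \<Rightarrow> nat \<Rightarrow> 'a \<Rightarrow> nat \<Rightarrow> nat \<Rightarrow> 'a::zero" where
  "single_coeff k l P = (\<lambda>k' l'. if k' = k \<and> l' = l then P else 0)"

lemma sum_single_coeff:
  fixes h :: "nat \<Rightarrow> nat \<Rightarrow> 'a::zero \<Rightarrow> 'b::comm_monoid_add"
  assumes "\<And>k l. h k l 0 = 0" "l < N"
  shows "(\<Sum>l'<N. h k' l' (single_coeff k l P k' l')) = (if k' = k then h k l P else 0)"
proof -
  have "(\<Sum>l'<N. h k' l' (single_coeff k l P k' l')) = (\<Sum>l'<N. if l' = l then (if k' = k then h k l P else 0) else 0)"
    by (rule sum.cong) (auto simp: single_coeff_def assms(1))
  also have "\<dots> = (if k' = k then h k l P else 0)" using assms(2) by (subst sum.delta) auto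
  finally show ?thesis .
qed

lemma sum_sum_single_coeff:
  fixes h :: "nat \<Rightarrow> nat \<Rightarrow> 'a::zero \<Rightarrow> 'b::comm_monoid_add"
  assumes "\<And>k l. h k l 0 = 0" "l < N" "k < N"
  shows "(\<Sum>k'<N. \<Sum>l'<N. h k' l' (single_coeff k l P k' l')) = h k l P"
  using assms by (simp add: sum_single_coeff[where h = h])

lemma tau_rep_exists:
  assumes I: "left_ideal I" and x: "x \<in> tau_span f I"
  shows "\<exists>N b. tau_rep f I N b x"
  using x
proof induction
  case zero
  have "tau_rep f I 0 (\<lambda>_ _. 0) 0" using I by (simp add: tau_rep_def left_ideal_def)
  then show ?case by blast
next
  case (ideal P k l)
  let ?N = "Suc (k + l)"
  have "(\<Sum>l'<?N. weyl_poly (f ^ (?N - l')) * single_coeff k l P k' l') \<in> I" for k'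
    using I ideal by (subst sum_single_coeff[where h = "\<lambda>k' l' b. weyl_poly (f ^ (?N - l')) * b"])
      (auto simp: left_ideal_def)
  moreover have "(\<Sum>k'<?N. \<Sum>l'<?N. tau_monom f k' l' (single_coeff k l P k' l')) = tau_monom f k l P"
    by (rule sum_sum_single_coeff) (auto simp: tau_monom_0)
  ultimately have "tau_rep f I ?N (single_coeff k l P) (tau_monom f k l P)"
    by (auto simp: tau_rep_def single_coeff_def)
  then show ?case by blast
next
  case (unit k l R)
  let ?N = "Suc (Suc (k + l))"
  let ?b = "\<lambda>k' l'. single_coeff k (Suc l) (weyl_poly f * R) k' l' + single_coeff k l (- R) k' l'"
  let ?h = "\<lambda>k' l' b. weyl_poly (f ^ (?N - l')) * b"
  have "(\<Sum>l'<?N. ?h k' l' (?b k' l')) \<in> I" for k'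
  proof -
    have "(\<Sum>l'<?N. ?h k' l' (?b k' l')) = (\<Sum>l'<?N. ?h k' l' (single_coeff k (Suc l) (weyl_poly f * R) k' l')) +
       (\<Sum>l'<?N. ?h k' l' (single_coeff k l (- R) k' l'))"
      by (simp only: distrib_left sum.distrib)
    also have "\<dots> = (if k' = k then ?h k (Suc l) (weyl_poly f * R) else 0) + (if k' = k then ?h k l (- R) else 0)"
      by (intro arg_cong2[of _ _ _ _ "(+)"] sum_single_coeff) auto
    \<comment> \<open>A unit relation vanishes under \<open>t = 1/f\<close>: one factor
      \<open>f\<close> is the difference between clearing \<open>t ^ l\<close> and clearing
      \<open>t ^ Suc l\<close>.\<close>
    also have "\<dots> = 0"
    proof -
      have "?N - l = Suc (?N - Suc l)" by simp
      then have "weyl_poly (f ^ (?N - l)) = weyl_poly (f ^ (?N - Suc l)) * weyl_poly f"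
        by (simp only: power_Suc2 weyl_poly_mult)
      then show ?thesis by (simp add: mult.assoc del: diff_Suc_Suc)
    qed
    finally show ?thesis using I by (simp add: left_ideal_def)
  qed
  moreover have "(\<Sum>k'<?N. \<Sum>l'<?N. tau_monom f k' l' (?b k' l')) =
      tau_monom f k (Suc l) (weyl_poly f * R) - tau_monom f k l R"
  proof -
    have "(\<Sum>k'<?N. \<Sum>l'<?N. tau_monom f k' l' (?b k' l')) =
        (\<Sum>k'<?N. \<Sum>l'<?N. tau_monom f k' l' (single_coeff k (Suc l) (weyl_poly f * R) k' l')) +
        (\<Sum>k'<?N. \<Sum>l'<?N. tau_monom f k' l' (single_coeff k l (- R) k' l'))"
      by (simp only: tau_monom_add sum.distrib)
    also have "\<dots> = tau_monom f k (Suc l) (weyl_poly f * R) + tau_monom f k l (- R)"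
      by (intro arg_cong2[of _ _ _ _ "(+)"] sum_sum_single_coeff) (auto simp: tau_monom_0)
    finally show ?thesis by (simp add: tau_monom_uminus)
  qed
  moreover have "?b k' l' = 0" if "?N \<le> k' \<or> ?N \<le> l'" for k' l'
    using that by (auto simp: single_coeff_def)
  ultimately have "tau_rep f I ?N ?b (tau_monom f k (Suc l) (weyl_poly f * R) - tau_monom f k l R)"
    unfolding tau_rep_def by simp
  then show ?case by blast
next
  case (add x y)
  then obtain N b N' b' where "tau_rep f I N b x" "tau_rep f I N' b' y" by blast
  then have "tau_rep f I (max N N') b x" "tau_rep f I (max N N') b' y"
    using tau_rep_mono[OF I] by auto
  then have "tau_rep f I (max N N') (\<lambda>k l. b k l + b' k l) (x + y)"
    using I by (simp add: tau_rep_def tau_monom_add sum.distrib distrib_left left_ideal_def)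
  then show ?case by blast
qed

text \<open>\<open>cotangent_map f w\<close> is \<open>(x, \<xi> - t\<^sup>2 \<tau> df)\<close> for \<open>w = (x, t, \<xi>, \<tau>)\<close>.\<close>

definition cotangent_map ::
    "('k::field, 'n::finite) mpoly \<Rightarrow> ('k, 'n option + 'n option) point \<Rightarrow> ('k, 'n + 'n) point" where
  "cotangent_map f w = (\<lambda>i. meval to_ac w (cotangent_subst f i))"

section \<open>Leading symbols of normal forms\<close>

lemma has_symbol_tau_sum:
  assumes "\<And>k l. k < N \<Longrightarrow> l < N \<Longrightarrow> b k l \<in> order_filtration (j - int k)"
  shows "has_symbol j (\<Sum>k<N. \<Sum>l<N. mvar (Inr None) ^ k * mvar (Inl None) ^ l *
       meval mconst (cotangent_subst f) (symbol (j - int k) (b k l))) (\<Sum>k<N. \<Sum>l<N. tau_monom f k l (b k l))"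
proof (intro has_symbol_sum)
  fix k l assume kl: "k \<in> {..<N}" "l \<in> {..<N}"
  have "has_symbol (int k * 1 + int l * 0 + (j - int k)) (mvar (Inr None) ^ k * mvar (Inl None) ^ l *
       meval mconst (cotangent_subst f) (symbol (j - int k) (b k l))) (tau_monom f k l (b k l))"
    unfolding tau_monom_def
    by (intro has_symbol_mult has_symbol_power has_symbol_pd has_symbol_var has_symbol_tau assms) (use kl in auto)
  then show "has_symbol j (mvar (Inr None) ^ k * mvar (Inl None) ^ l *
       meval mconst (cotangent_subst f) (symbol (j - int k) (b k l))) (tau_monom f k l (b k l))" by simp
qed

lemma symbol_tau_sum:
  assumes "\<And>k l. k < N \<Longrightarrow> l < N \<Longrightarrow> b k l \<in> order_filtration (j - int k)"
  shows "meval to_ac w (symbol j (\<Sum>k<N. \<Sum>l<N. tau_monom f k l (b k l))) =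
    (\<Sum>k<N. \<Sum>l<N. w (Inr None) ^ k * w (Inl None) ^ l * meval to_ac (cotangent_map f w) (symbol (j - int k) (b k l)))"
proof -
  have eq: "symbol j (\<Sum>k<N. \<Sum>l<N. tau_monom f k l (b k l)) = (\<Sum>k<N. \<Sum>l<N. mvar (Inr None) ^ k * mvar (Inl None) ^ l *
       meval mconst (cotangent_subst f) (symbol (j - int k) (b k l)))"
    using has_symbol_tau_sum[OF assms] by (simp add: has_symbol_iff)
  show ?thesis
    unfolding eq by (simp add: ac.meval_simps ac.meval_subst cotangent_map_def)
qed

lemma polyfun_coeffs_eq_0:
  fixes c :: "nat \<Rightarrow> 'l::field_char_0"
  assumes "\<And>s. (\<Sum>k<N. c k * s ^ k) = 0" "k < N"
  shows "c k = 0"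
proof -
  define P where "P = (\<Sum>k<N. monom (c k) k)"
  have "poly P s = 0" for s using assms(1)[of s] by (simp add: P_def poly_sum poly_monom)
  then have "P = 0" by (simp add: poly_all_0_iff_0[symmetric])
  moreover have "coeff P k = (\<Sum>k'<N. if k' = k then c k' else 0)" by (simp add: P_def coeff_sum)
  then have "coeff P k = c k" using assms(2) by simp
  ultimately show ?thesis by simp
qed

text \<open>This inverts \<open>cotangent_map f\<close> once \<open>t\<close> and its dual
  coordinate \<open>s\<close> are prescribed. Their free choice separates the terms in
  \<open>tau_sum_order\<close>; the choice \<open>t = 1/f\<close> gives the section of the line
  bundle.\<close>

definition cotangent_lift :: "('k::field, 'n::finite) mpoly \<Rightarrow> ('k, 'n + 'n) point \<Rightarrow> 'k alg_closure \<Rightarrow> 'k alg_closure \<Rightarrow>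
    ('k, 'n option + 'n option) point" where
  "cotangent_lift f v t s = case_sum (case_option t (\<lambda>i. v (Inl i)))
     (case_option s (\<lambda>i. v (Inr i) + meval to_ac (\<lambda>i. v (Inl i)) (mpderiv i f) * s * t ^ 2))"

lemma cotangent_lift_None:
  "cotangent_lift f v t s (Inl None) = t" "cotangent_lift f v t s (Inr None) = s"
  by (simp_all add: cotangent_lift_def)

lemma cotangent_map_apply:
  "cotangent_map f w (Inl i) = w (Inl (Some i))"
  "cotangent_map f w (Inr i) = w (Inr (Some i)) - meval to_ac (\<lambda>i. w (Inl (Some i))) (mpderiv i f) * w (Inr None) * w (Inl None) ^ 2"
  by (simp_all add: cotangent_map_def cotangent_subst_def ac.meval_simps embed_x_pull ac.meval_subst mult.assoc)

lemma cotangent_map_lift: "cotangent_map f (cotangent_lift f v t s) = v"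
proof
  show "cotangent_map f (cotangent_lift f v t s) i = v i" for i
    by (cases i) (simp_all add: cotangent_map_apply cotangent_lift_def)
qed

lemma cotangent_lift_map:
  "cotangent_lift f (cotangent_map f w) (w (Inl None)) (w (Inr None)) = w"
proof
  show "cotangent_lift f (cotangent_map f w) (w (Inl None)) (w (Inr None)) i = w i" for i
    by (auto simp: cotangent_map_apply cotangent_lift_def split: sum.splits option.splits)
qed

text \<open>Leading symbols cannot cancel. At \<open>cotangent_lift f v t s\<close> the symbol is a
  polynomial in \<open>s\<close> and \<open>t\<close> whose coefficients are the values at
  \<open>v\<close> of the symbols of the \<open>b k l\<close>. If it vanishes identically, all of
  these do.\<close>

lemma tau_sum_order:
  fixes f :: "('k::field_char_0, 'n::finite) mpoly"
  assumes x: "(\<Sum>k<N. \<Sum>l<N. tau_monom f k l (b k l)) \<in> order_filtration j" (is "?x \<in> _") and "k < N" "l < N"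
  shows "b k l \<in> order_filtration (j - int k)"
proof -
  have step: "\<forall>k<N. \<forall>l<N. b k l \<in> order_filtration (i - 1 - int k)"
    if i: "i > j" "\<forall>k<N. \<forall>l<N. b k l \<in> order_filtration (i - int k)" for i
  proof (intro allI impI)
    fix k l assume kl: "k < N" "l < N"
    have zero: "symbol i ?x = 0" using x i by (simp add: order_filtration_iff)
    have "symbol (i - int k) (b k l) = 0"
    proof (rule ccontr)
      assume "symbol (i - int k) (b k l) \<noteq> 0"
      then obtain v where v: "meval to_ac v (symbol (i - int k) (b k l)) \<noteq> 0"
        using mpoly_nonvanishing_point[OF ac.scalars_axioms] by blast
      let ?c = "\<lambda>k l. meval to_ac v (symbol (i - int k) (b k l))"
      have eq: "(\<Sum>k<N. \<Sum>l<N. s ^ k * t ^ l * ?c k l) = 0" for s t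
        using symbol_tau_sum[of N b i "cotangent_lift f v t s" f] i(2) zero
        by (simp add: cotangent_map_lift ac.meval_0 cotangent_lift_None)
      have "(\<Sum>l<N. ?c k l * t ^ l) = 0" for t
      proof (rule polyfun_coeffs_eq_0[OF _ kl(1)])
        show "(\<Sum>k<N. (\<Sum>l<N. ?c k l * t ^ l) * s ^ k) = 0" for s
          using eq[of s t] by (simp add: sum_distrib_left sum_distrib_right ac_simps)
      qed
      from polyfun_coeffs_eq_0[OF this kl(2)] v show False by simp
    qed
    then have "b k l \<in> order_filtration (i - int k - 1)"
      using i(2) kl by (intro order_filtration_pred) auto
    then show "b k l \<in> order_filtration (i - 1 - int k)" by (simp add: algebra_simps)
  qed
  have "\<forall>k l. \<exists>d. b k l \<in> order_filtration d" using order_filtration_exhaust by blast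
  then obtain d where d: "\<And>k l. b k l \<in> order_filtration (d k l)" by metis
  \<comment> \<open>\<open>m\<close> bounds the excess of the orders of the \<open>b k l\<close>
    over the claim, so \<open>m\<close> applications of \<open>step\<close> suffice.\<close>
  define m where "m = Max (insert 0 ((\<lambda>(k, l). nat (d k l + int k - j)) ` ({..<N} \<times> {..<N})))"
  have le: "nat (d k l + int k - j) \<le> m" if "k < N" "l < N" for k l
    unfolding m_def using that by (intro Max_ge) auto
  have "\<forall>k<N. \<forall>l<N. b k l \<in> order_filtration (j + int (m - n) - int k)" if "n \<le> m" for n
    using that
  proof (induction n)
    case 0
    show ?case
    proof (intro allI impI)
      fix k l assume "k < N" "l < N"
      from le[OF this] show "b k l \<in> order_filtration (j + int (m - 0) - int k)"
        by (intro order_filtration_mono[OF d]) linarith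
    qed
  next
    case (Suc n)
    then have eq: "j + int (m - n) - 1 = j + int (m - Suc n)" and gt: "j + int (m - n) > j" by auto
    from Suc have "\<forall>k<N. \<forall>l<N. b k l \<in> order_filtration (j + int (m - n) - int k)" by simp
    from step[OF gt this] show ?case unfolding eq .
  qed
  from this[of m] assms(2,3) show ?thesis by simp
qed

definition symbol_zeros :: "('k::field_char_0, 'n::finite) weyl set \<Rightarrow> ('k, 'n + 'n) point set" where
  "symbol_zeros I = {z. \<forall>j. \<forall>Q\<in>I \<inter> order_filtration j. meval to_ac z (symbol j Q) = 0}"

lemma symbol_zerosD:
  "z \<in> symbol_zeros I \<Longrightarrow> Q \<in> I \<Longrightarrow> has_symbol j s Q \<Longrightarrow> meval to_ac z s = 0"
  by (auto simp: symbol_zeros_def has_symbol_iff)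

text \<open>The symbols of \<open>t f - 1\<close> and of the \<open>tau f P\<close> with
  \<open>P\<close> in \<open>I\<close> give one inclusion. For the other,
  \<open>tau_sum_order\<close> allows the symbol of an element of \<open>J\<close> to be computed
  from a normal form, and the part with \<open>\<partial>\<^sub>t ^ k\<close> vanishes because its
  cleared coefficient lies in \<open>I\<close>.\<close>

theorem symbol_zeros_tau:
  fixes f :: "('k::field_char_0, 'n::finite) mpoly"
  assumes I: "left_ideal hull G = I" and J: "J = left_ideal hull (tau f ` G \<union> {weyl_t * weyl_pullback f - 1})"
  shows "symbol_zeros J = {w. w (Inl None) * meval to_ac (\<lambda>i. w (Inl (Some i))) f = 1 \<and>
    cotangent_map f w \<in> symbol_zeros I}"
proof (intro equalityI subsetI CollectI conjI)
  have I': "left_ideal I" using left_ideal_hull I by blast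
  have J': "left_ideal J" unfolding J by (rule left_ideal_hull)
  have sub: "tau f ` G \<union> {weyl_t * weyl_pullback f - 1} \<subseteq> J" unfolding J by (rule hull_subset)
  {
    fix w assume w: "w \<in> symbol_zeros J"
    have "has_symbol (0 + 0) (mvar (Inl None) * embed_x (pull f)) (weyl_t * weyl_pullback f)"
      unfolding weyl_pullback_pull by (intro has_symbol_mult has_symbol_var has_symbol_poly)
    then have "has_symbol 0 (mvar (Inl None) * embed_x (pull f) - 1) (weyl_t * weyl_pullback f - 1)"
      by (intro has_symbol_diff has_symbol_1) simp
    from symbol_zerosD[OF w _ this] sub
    have "meval to_ac w (mvar (Inl None) * embed_x (pull f) - 1) = 0" by blast
    then show "w (Inl None) * meval to_ac (\<lambda>i. w (Inl (Some i))) f = 1"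
      by (simp add: ac.meval_simps embed_x_pull ac.meval_subst)
    show "cotangent_map f w \<in> symbol_zeros I"
      unfolding symbol_zeros_def
    proof (intro CollectI allI ballI)
      fix j P assume P: "P \<in> I \<inter> order_filtration j"
      then have "has_symbol j (meval mconst (cotangent_subst f) (symbol j P)) (tau f P)"
        by (intro has_symbol_tau) simp
      moreover have "tau f P \<in> J"
        using tau_mem_left_ideal[OF J', of f G P] sub P I by auto
      ultimately have "meval to_ac w (meval mconst (cotangent_subst f) (symbol j P)) = 0"
        using symbol_zerosD[OF w] by blast
      then show "meval to_ac (cotangent_map f w) (symbol j P) = 0"
        by (simp add: ac.meval_subst cotangent_map_def)
    qed
  }
  fix w assume w: "w \<in> {w. w (Inl None) * meval to_ac (\<lambda>i. w (Inl (Some i))) f = 1 \<and> cotangent_map f w \<in> symbol_zeros I}"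
  let ?v = "cotangent_map f w" and ?t = "w (Inl None)"
  define \<phi> where "\<phi> = meval to_ac (\<lambda>i. w (Inl (Some i))) f"
  have t\<phi>: "?t * \<phi> = 1" using w by (simp add: \<phi>_def)
  show "w \<in> symbol_zeros J"
    unfolding symbol_zeros_def
  proof (intro CollectI allI ballI)
    fix j Q assume Q: "Q \<in> J \<inter> order_filtration j"
    have "G \<subseteq> I" using hull_subset[of G left_ideal] I by simp
    from hull_subset_tau_span[OF I' this] Q J have "Q \<in> tau_span f I" by blast
    from tau_rep_exists[OF I' this] obtain N b where rep: "tau_rep f I N b Q" by blast
    then have Qeq: "Q = (\<Sum>k<N. \<Sum>l<N. tau_monom f k l (b k l))"
      and mem: "\<And>k. (\<Sum>l<N. weyl_poly (f ^ (N - l)) * b k l) \<in> I" by (auto simp: tau_rep_def)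
    have b: "b k l \<in> order_filtration (j - int k)" if "k < N" "l < N" for k l
      by (rule tau_sum_order[OF _ that]) (use Q Qeq in auto)
    have row: "(\<Sum>l<N. ?t ^ l * meval to_ac ?v (symbol (j - int k) (b k l))) = 0" if k: "k < N" for k
    proof -
      let ?S = "\<Sum>l<N. weyl_poly (f ^ (N - l)) * b k l"
      have "has_symbol (j - int k) (\<Sum>l<N. embed_x (f ^ (N - l)) * symbol (j - int k) (b k l)) ?S"
      proof (rule has_symbol_sum)
        fix l assume "l \<in> {..<N}"
        then have "has_symbol (0 + (j - int k)) (embed_x (f ^ (N - l)) * symbol (j - int k) (b k l)) (weyl_poly (f ^ (N - l)) * b k l)"
          by (intro has_symbol_mult has_symbol_poly) (use b[OF k] in \<open>auto simp: has_symbol_iff\<close>)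
        then show "has_symbol (j - int k) (embed_x (f ^ (N - l)) * symbol (j - int k) (b k l)) (weyl_poly (f ^ (N - l)) * b k l)"
          by simp
      qed
      then have "meval to_ac ?v (\<Sum>l<N. embed_x (f ^ (N - l)) * symbol (j - int k) (b k l)) = 0"
        using symbol_zerosD[of ?v I, OF _ mem[of k]] w by blast
      moreover have "meval to_ac ?v (embed_x (f ^ n)) = \<phi> ^ n" for n
        by (simp add: embed_x_def ac.meval_subst ac.meval_simps cotangent_map_apply \<phi>_def)
      ultimately have "(\<Sum>l<N. \<phi> ^ (N - l) * meval to_ac ?v (symbol (j - int k) (b k l))) = 0"
        by (simp add: ac.meval_sum ac.meval_times)
      \<comment> \<open>Multiplication by \<open>?t ^ N\<close> undoes the clearing of denominators:
        by \<open>t\<phi>\<close> the factor \<open>\<phi> ^ (N - l)\<close> turns into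
        \<open>?t ^ l\<close>.\<close>
      then have "?t ^ N * (\<Sum>l<N. \<phi> ^ (N - l) * meval to_ac ?v (symbol (j - int k) (b k l))) = 0" by simp
      also have "?t ^ N * (\<Sum>l<N. \<phi> ^ (N - l) * meval to_ac ?v (symbol (j - int k) (b k l))) =
          (\<Sum>l<N. ?t ^ l * meval to_ac ?v (symbol (j - int k) (b k l)))"
        unfolding sum_distrib_left
      proof (rule sum.cong)
        fix l assume "l \<in> {..<N}"
        then have "?t ^ N * \<phi> ^ (N - l) = ?t ^ l * (?t * \<phi>) ^ (N - l)"
          by (simp add: power_mult_distrib mult.assoc[symmetric] flip: power_add)
        then show "?t ^ N * (\<phi> ^ (N - l) * meval to_ac ?v (symbol (j - int k) (b k l))) =
            ?t ^ l * meval to_ac ?v (symbol (j - int k) (b k l))"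
          by (simp add: t\<phi> mult.assoc[symmetric])
      qed simp
      finally show ?thesis .
    qed
    have "meval to_ac w (symbol j Q) =
      (\<Sum>k<N. w (Inr None) ^ k * (\<Sum>l<N. ?t ^ l * meval to_ac ?v (symbol (j - int k) (b k l))))"
      unfolding Qeq by (subst symbol_tau_sum) (use b in \<open>auto simp: sum_distrib_left mult.assoc\<close>)
    also have "\<dots> = 0" using row by (simp add: sum.neutral)
    finally show "meval to_ac w (symbol j Q) = 0" .
  qed
qed

section \<open>Characteristic varieties of cyclic modules\<close>

context left_module
begin

lemma smult_zero_l: "x \<in> carrier M \<Longrightarrow> 0 \<odot> x = \<zero>"
  using smult_l_distr[of x 0 0] smult_closed[of x 0] by (simp add: add.l_cancel_one)

lemma smult_zero_r: "a \<odot> \<zero> = \<zero>"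
  using smult_r_distr[of \<zero> \<zero> a] smult_closed[of \<zero> a] by (simp add: add.l_cancel_one)

lemma smult_diff_eq_zero:
  assumes "x \<in> carrier M" "a \<odot> x = b \<odot> x"
  shows "(a - b) \<odot> x = \<zero>"
proof -
  have "(a - b) \<odot> x = a \<odot> x \<oplus> (- b) \<odot> x"
    using smult_l_distr[OF assms(1), of a "- b"] by simp
  also have "\<dots> = (b + - b) \<odot> x"
    unfolding assms(2) by (rule smult_l_distr[OF assms(1), symmetric])
  finally show ?thesis by (simp add: smult_zero_l assms(1))
qed

lemma smult_finsum:
  assumes "finite S" "h \<in> S \<rightarrow> carrier M"
  shows "a \<odot> (\<Oplus>s\<in>S. h s) = (\<Oplus>s\<in>S. a \<odot> h s)"
  using assms
proof (induction S rule: finite_induct)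
  case (insert s S)
  then have "h s \<in> carrier M" "h \<in> S \<rightarrow> carrier M" by auto
  with insert show ?case
    by (simp add: smult_r_distr smult_closed Pi_iff)
qed (simp add: smult_zero_r)

lemma finsum_smult_sum:
  assumes "finite S" "x \<in> carrier M"
  shows "(\<Oplus>s\<in>S. a s \<odot> x) = sum a S \<odot> x"
  using assms(1)
  by (induction S rule: finite_induct) (simp_all add: assms(2) smult_zero_l smult_l_distr smult_closed Pi_iff)

lemma combinationsE:
  assumes "x \<in> combinations M F S"
  obtains P where "P \<in> S \<rightarrow> F" "x = (\<Oplus>s\<in>S. P s \<odot> s)"
  using assms by (auto simp: combinations_def)

lemma smult_combinations:
  assumes "finite S" "S \<subseteq> carrier M" "x \<in> combinations M F S" "\<And>P. P \<in> F \<Longrightarrow> a * P \<in> F'"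
  shows "a \<odot> x \<in> combinations M F' S"
proof -
  obtain P where P: "P \<in> S \<rightarrow> F" "x = (\<Oplus>s\<in>S. P s \<odot> s)" using combinationsE[OF assms(3)] .
  have "a \<odot> x = (\<Oplus>s\<in>S. a \<odot> (P s \<odot> s))"
    unfolding P(2) by (rule smult_finsum) (use assms smult_closed in auto)
  also have "\<dots> = (\<Oplus>s\<in>S. (a * P s) \<odot> s)"
    by (rule add.finprod_cong) (use assms(2) in \<open>auto simp: smult_assoc smult_closed simp_implies_def\<close>)
  finally show ?thesis
    unfolding combinations_def
    by (intro CollectI exI[of _ "\<lambda>s. a * P s"] conjI) (use P(1) assms(4) in auto)
qed

lemma combination_of_generator:
  assumes "finite S" "u \<in> carrier M" "\<And>s. s \<in> S \<Longrightarrow> s = R s \<odot> u" "S \<subseteq> carrier M"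
  shows "(\<Oplus>s\<in>S. P s \<odot> s) = (\<Sum>s\<in>S. P s * R s) \<odot> u"
proof -
  have "(\<Oplus>s\<in>S. P s \<odot> s) = (\<Oplus>s\<in>S. (P s * R s) \<odot> u)"
  proof (rule add.finprod_cong')
    show "(\<lambda>s. (P s * R s) \<odot> u) \<in> S \<rightarrow> carrier M" using assms(2) smult_closed by auto
    fix s assume "s \<in> S"
    then have "P s \<odot> s = P s \<odot> (R s \<odot> u)" by (rule arg_cong[OF assms(3)])
    then show "P s \<odot> s = (P s * R s) \<odot> u" by (simp only: smult_assoc[OF assms(2)])
  qed simp
  also have "\<dots> = (\<Sum>s\<in>S. P s * R s) \<odot> u"
    by (rule finsum_smult_sum[OF assms(1,2)])
  finally show ?thesis .
qed

end

lemma order_filtration_common: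
  assumes "finite S"
  shows "\<exists>c::nat. \<forall>s\<in>S. R s \<in> order_filtration (int c)"
  using assms
proof (induction S rule: finite_induct)
  case (insert s S)
  then obtain c where c: "\<forall>s\<in>S. R s \<in> order_filtration (int c)" by blast
  obtain d where d: "d \<ge> 0" "R s \<in> order_filtration d" using order_filtration_exhaust by blast
  have "\<forall>s\<in>insert s S. R s \<in> order_filtration (int (c + nat d))"
    using c d by (auto intro: order_filtration_mono)
  then show ?case by blast
qed simp

text \<open>Two generating sets give filtrations that differ by a bounded shift \<open>2c\<close>; hence the
  \<open>(2c + 1)\<close>-st powers of the symbols agree.\<close>

theorem char_variety_cyclic:
  fixes M :: "(('k::field_char_0, 'n::finite) weyl, 'm) module"
  assumes "left_module M" "u \<in> carrier M" "carrier M = {P \<odot>\<^bsub>M\<^esub> u |P. True}"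
  shows "char_variety M = symbol_zeros (annihilator M u)" "\<exists>S. generating_set M S"
proof -
  interpret left_module M by fact
  have "(\<Oplus>\<^bsub>M\<^esub>s\<in>{u}. P s \<odot>\<^bsub>M\<^esub> s) = P u \<odot>\<^bsub>M\<^esub> u" for P
    using assms(2) by (simp add: smult_closed)
  then have "combinations M UNIV {u} = {P u \<odot>\<^bsub>M\<^esub> u |P. True}"
    by (simp add: combinations_def)
  also have "\<dots> = {P \<odot>\<^bsub>M\<^esub> u |P. True}" by (auto intro: exI[of _ "\<lambda>_. _"])
  finally have "carrier M = combinations M UNIV {u}" using assms(3) by (rule trans[OF _ sym, rotated])
  then have gen_u: "generating_set M {u}" using assms(2) by (simp add: generating_set_def)
  then show "\<exists>S. generating_set M S" by blast
  define S where "S = (SOME S. generating_set M S)"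
  have "generating_set M S" unfolding S_def using gen_u by (rule someI)
  then have S: "finite S" "S \<subseteq> carrier M" "carrier M = combinations M UNIV S"
    by (auto simp: generating_set_def)
  have "\<forall>s\<in>S. \<exists>R. s = R \<odot>\<^bsub>M\<^esub> u" using S(2) assms(3) by blast
  then obtain R where R: "\<And>s. s \<in> S \<Longrightarrow> s = R s \<odot>\<^bsub>M\<^esub> u" by metis
  obtain U where U: "u = (\<Oplus>\<^bsub>M\<^esub>s\<in>S. U s \<odot>\<^bsub>M\<^esub> s)"
    using assms(2) S(3) combinationsE by blast
  obtain c1 c2 where c1: "\<forall>s\<in>S. R s \<in> order_filtration (int c1)" and c2: "\<forall>s\<in>S. U s \<in> order_filtration (int c2)"
    using order_filtration_common[OF S(1)] by metis
  define c where "c = c1 + c2"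
  have Rc: "R s \<in> order_filtration (int c)" and Uc: "U s \<in> order_filtration (int c)" if "s \<in> S" for s
    using c1 c2 that by (auto simp: c_def intro: order_filtration_mono)
  have to_u: "\<exists>B\<in>order_filtration (k + int c). x = B \<odot>\<^bsub>M\<^esub> u"
    if "x \<in> combinations M (order_filtration k) S" for x k
  proof -
    obtain P where P: "P \<in> S \<rightarrow> order_filtration k" "x = (\<Oplus>\<^bsub>M\<^esub>s\<in>S. P s \<odot>\<^bsub>M\<^esub> s)"
      using combinationsE[OF \<open>x \<in> combinations M (order_filtration k) S\<close>] .
    have "(\<Sum>s\<in>S. P s * R s) \<in> order_filtration (k + int c)"
      using P(1) by (intro order_filtration_sum order_filtration_mult Rc) auto
    moreover have "x = (\<Sum>s\<in>S. P s * R s) \<odot>\<^bsub>M\<^esub> u"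
      unfolding P(2) by (rule combination_of_generator[OF S(1) assms(2) R S(2)])
    ultimately show ?thesis by blast
  qed
  have u_S: "u \<in> combinations M (order_filtration (int c)) S"
    unfolding combinations_def using U Uc by blast
  have smult_S: "A \<odot>\<^bsub>M\<^esub> x \<in> combinations M (order_filtration (j + k)) S"
    if "A \<in> order_filtration j" "x \<in> combinations M (order_filtration k) S" for A j x k
    by (rule smult_combinations[OF S(1,2) that(2)]) (rule order_filtration_mult(1)[OF that(1)])
  have comb_carrier: "x \<in> carrier M" if "x \<in> combinations M F S" for x F
    using that S(3) by (auto simp: combinations_def)
  \<comment> \<open>Passing from \<open>S\<close> to \<open>u\<close> and back shifts the filtration
    by \<open>c\<close> each time; one more factor yields the drop by one that
    \<open>gr_annihilator\<close> asks for.\<close>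
  define N where "N = 2 * c + 1"
  show "char_variety M = symbol_zeros (annihilator M u)"
    unfolding char_variety_def S_def[symmetric]
  proof (intro equalityI subsetI CollectI ballI)
    fix z assume z: "z \<in> {z. \<forall>a\<in>gr_annihilator M S. meval to_ac z a = 0}"
    show "z \<in> symbol_zeros (annihilator M u)"
      unfolding symbol_zeros_def
    proof (intro CollectI allI ballI)
      fix j Q assume "Q \<in> annihilator M u \<inter> order_filtration j"
      then have Q: "Q \<odot>\<^bsub>M\<^esub> u = \<zero>\<^bsub>M\<^esub>" "Q \<in> order_filtration j" by (auto simp: annihilator_def)
      \<comment> \<open>Since \<open>Q\<close> kills \<open>u\<close>, \<open>Q * B'\<close> acts on
        \<open>u\<close> as the commutator of \<open>Q\<close> and \<open>B'\<close>, whose order is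
        one lower. So every factor \<open>Q\<close> gains one degree.\<close>
      have ad: "\<exists>B'\<in>order_filtration (m + int n * (j - 1)). Q ^ n \<odot>\<^bsub>M\<^esub> (B \<odot>\<^bsub>M\<^esub> u) = B' \<odot>\<^bsub>M\<^esub> u"
        if "B \<in> order_filtration m" for B m n
      proof (induction n)
        case 0
        then show ?case using that smult_closed[OF assms(2)] by (auto simp: smult_one)
      next
        case (Suc n)
        then obtain B' where B': "B' \<in> order_filtration (m + int n * (j - 1))"
          "Q ^ n \<odot>\<^bsub>M\<^esub> (B \<odot>\<^bsub>M\<^esub> u) = B' \<odot>\<^bsub>M\<^esub> u" by blast
        have "(Q * B' - B' * Q) \<odot>\<^bsub>M\<^esub> u = (Q * B') \<odot>\<^bsub>M\<^esub> u"
        proof -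
          have "(B' * Q) \<odot>\<^bsub>M\<^esub> u = \<zero>\<^bsub>M\<^esub>" by (simp add: smult_assoc assms(2) Q(1) smult_zero_r)
          moreover have "(Q * B' - B' * Q) \<odot>\<^bsub>M\<^esub> u \<oplus>\<^bsub>M\<^esub> (B' * Q) \<odot>\<^bsub>M\<^esub> u = (Q * B') \<odot>\<^bsub>M\<^esub> u"
            by (simp flip: smult_l_distr[OF assms(2)])
          ultimately show ?thesis by (simp add: smult_closed assms(2))
        qed
        also have "\<dots> = Q ^ Suc n \<odot>\<^bsub>M\<^esub> (B \<odot>\<^bsub>M\<^esub> u)"
          using B'(2) smult_closed assms(2) by (simp add: smult_assoc)
        finally have "Q ^ Suc n \<odot>\<^bsub>M\<^esub> (B \<odot>\<^bsub>M\<^esub> u) = (Q * B' - B' * Q) \<odot>\<^bsub>M\<^esub> u" by simp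
        moreover have "Q * B' - B' * Q \<in> order_filtration (m + int (Suc n) * (j - 1))"
          using order_filtration_commutator[OF Q(2) B'(1)] by (simp add: algebra_simps)
        ultimately show ?case by blast
      qed
      have "Q ^ N \<odot>\<^bsub>M\<^esub> x \<in> combinations M (order_filtration (k + int N * j - 1)) S"
        if x: "x \<in> combinations M (order_filtration k) S" for k x
      proof -
        obtain B where B: "B \<in> order_filtration (k + int c)" "x = B \<odot>\<^bsub>M\<^esub> u" using to_u[OF x] by blast
        obtain B' where B': "B' \<in> order_filtration (k + int c + int N * (j - 1))" "Q ^ N \<odot>\<^bsub>M\<^esub> x = B' \<odot>\<^bsub>M\<^esub> u"
          using ad[OF B(1)] B(2) by blast
        have "k + int c + int N * (j - 1) + int c = k + int N * j - 1"
          by (simp add: N_def algebra_simps)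
        with smult_S[OF B'(1) u_S] show ?thesis by (simp only: B'(2))
      qed
      then have "symbol (int N * j) (Q ^ N) \<in> gr_annihilator M S"
        unfolding gr_annihilator_def using order_filtration_power(1)[OF Q(2), of N] by blast
      then have "meval to_ac z (symbol j Q) ^ N = 0"
        using z order_filtration_power(2)[OF Q(2), of N] by (auto simp: ac.meval_power)
      then show "meval to_ac z (symbol j Q) = 0" by simp
    qed
  next
    fix z a assume z: "z \<in> symbol_zeros (annihilator M u)" and "a \<in> gr_annihilator M S"
    then obtain j P where P: "a = symbol j P" "P \<in> order_filtration j"
      and PS: "\<And>k x. x \<in> combinations M (order_filtration k) S \<Longrightarrow>
        P \<odot>\<^bsub>M\<^esub> x \<in> combinations M (order_filtration (k + j - 1)) S"
      unfolding gr_annihilator_def by blast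
    \<comment> \<open>Conversely, every application of \<open>P\<close> gains one degree by the
      choice of \<open>P\<close>. So \<open>P ^ N\<close> agrees on \<open>u\<close> with an
      operator of order below \<open>N * j\<close>, and the difference annihilates \<open>u\<close>
      with symbol \<open>a ^ N\<close>.\<close>
    have pow: "P ^ n \<odot>\<^bsub>M\<^esub> u \<in> combinations M (order_filtration (int c + int n * (j - 1))) S" for n
    proof (induction n)
      case 0
      then show ?case using u_S assms(2) by (simp add: smult_one)
    next
      case (Suc n)
      have "int c + int n * (j - 1) + j - 1 = int c + int (Suc n) * (j - 1)" by (simp add: algebra_simps)
      with PS[OF Suc] show ?case by (simp add: smult_assoc assms(2))
    qed
    obtain B where B: "B \<in> order_filtration (int c + int N * (j - 1) + int c)" "P ^ N \<odot>\<^bsub>M\<^esub> u = B \<odot>\<^bsub>M\<^esub> u"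
      using to_u[OF pow[of N]] by blast
    have "int c + int N * (j - 1) + int c = int N * j - 1" by (simp add: N_def algebra_simps)
    with B(1) have B1: "B \<in> order_filtration (int N * j - 1)" by (simp only:)
    have "has_symbol (int N * j) (a ^ N) (P ^ N)"
      unfolding has_symbol_iff P(1) using order_filtration_power[OF P(2), of N] by simp
    moreover have "has_symbol (int N * j) 0 B"
      unfolding has_symbol_iff using B1 order_filtration_mono[OF B1, of "int N * j"]
      by (simp add: order_filtration_iff)
    ultimately have "has_symbol (int N * j) (a ^ N - 0) (P ^ N - B)" by (rule has_symbol_diff)
    moreover have "P ^ N - B \<in> annihilator M u"
      using smult_diff_eq_zero[OF assms(2) B(2)] by (simp add: annihilator_def)
    ultimately have "meval to_ac z (a ^ N - 0) = 0" using symbol_zerosD[OF z] by blast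
    then have "meval to_ac z a ^ N = 0" by (simp only: ac.meval_power diff_zero)
    then show "meval to_ac z a = 0" by simp
  qed
qed

section \<open>The quotient by a left ideal as a cyclic module\<close>

definition left_coset :: "'r::ring_1 set \<Rightarrow> 'r \<Rightarrow> 'r set" where
  "left_coset J a = (\<lambda>j. a + j) ` J"

lemma left_coset_eq_iff:
  assumes "left_ideal J" shows "left_coset J a = left_coset J b \<longleftrightarrow> a - b \<in> J"
proof
  assume "left_coset J a = left_coset J b"
  moreover have "a \<in> left_coset J a" using assms by (force simp: left_coset_def left_ideal_def)
  ultimately show "a - b \<in> J" by (auto simp: left_coset_def)
next
  assume ab: "a - b \<in> J"
  have "left_coset J a \<subseteq> left_coset J b" if "a - b \<in> J" for a b
  proof
    fix x assume "x \<in> left_coset J a"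
    then obtain j where "j \<in> J" "x = a + j" by (auto simp: left_coset_def)
    then have "x = b + ((a - b) + j)" "(a - b) + j \<in> J" using assms that by (auto simp: left_ideal_def)
    then show "x \<in> left_coset J b" unfolding left_coset_def by (rule image_eqI)
  qed
  moreover have "b - a \<in> J" using left_ideal_uminus[OF assms ab] by simp
  ultimately show "left_coset J a = left_coset J b" using ab by blast
qed

context
  fixes J :: "'r::ring_1 set"
  assumes J: "left_ideal J"
begin

lemma quotient_carrier: "carrier (quotient_module J) = range (left_coset J)"
  by (auto simp: quotient_module_def left_coset_def)

lemma quotient_zero: "\<zero>\<^bsub>quotient_module J\<^esub> = left_coset J 0"
  by (simp add: quotient_module_def left_coset_def)

lemma quotient_add: "left_coset J a \<oplus>\<^bsub>quotient_module J\<^esub> left_coset J b = left_coset J (a + b)"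
proof -
  have "{x + y |x y. x \<in> left_coset J a \<and> y \<in> left_coset J b} = left_coset J (a + b)"
  proof (intro equalityI subsetI)
    fix z assume "z \<in> {x + y |x y. x \<in> left_coset J a \<and> y \<in> left_coset J b}"
    then obtain i j where "i \<in> J" "j \<in> J" "z = (a + i) + (b + j)" by (auto simp: left_coset_def)
    then have "z = (a + b) + (i + j)" "i + j \<in> J" using J by (simp_all add: left_ideal_def algebra_simps)
    then show "z \<in> left_coset J (a + b)" unfolding left_coset_def by (rule image_eqI)
  next
    fix z assume "z \<in> left_coset J (a + b)"
    then obtain i where i: "i \<in> J" "z = (a + 0) + (b + i)" by (auto simp: left_coset_def add.assoc)
    have "a + 0 \<in> left_coset J a" "b + i \<in> left_coset J b"
      unfolding left_coset_def using i(1) J by (auto simp: left_ideal_def intro!: imageI image_eqI[of _ _ 0])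
    with i(2) show "z \<in> {x + y |x y. x \<in> left_coset J a \<and> y \<in> left_coset J b}" by blast
  qed
  then show ?thesis by (simp add: quotient_module_def)
qed

lemma quotient_smult: "r \<odot>\<^bsub>quotient_module J\<^esub> left_coset J a = left_coset J (r * a)"
proof -
  have "{r * x + j |x j. x \<in> left_coset J a \<and> j \<in> J} = left_coset J (r * a)"
  proof (intro equalityI subsetI)
    fix z assume "z \<in> {r * x + j |x j. x \<in> left_coset J a \<and> j \<in> J}"
    then obtain i j where "i \<in> J" "j \<in> J" "z = r * (a + i) + j" by (auto simp: left_coset_def)
    then have "z = r * a + (r * i + j)" "r * i + j \<in> J" using J by (simp_all add: left_ideal_def algebra_simps)
    then show "z \<in> left_coset J (r * a)" unfolding left_coset_def by (rule image_eqI)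
  next
    fix z assume "z \<in> left_coset J (r * a)"
    then obtain i where i: "i \<in> J" "z = r * a + i" by (auto simp: left_coset_def)
    have "a \<in> left_coset J a"
      unfolding left_coset_def using J by (intro image_eqI[of _ _ 0]) (auto simp: left_ideal_def)
    with i show "z \<in> {r * x + j |x j. x \<in> left_coset J a \<and> j \<in> J}" by blast
  qed
  then show ?thesis by (simp add: quotient_module_def)
qed

lemma left_module_quotient: "left_module (quotient_module J)"
proof -
  have grp: "abelian_group (quotient_module J)"
  proof (rule abelian_groupI)
    fix x assume "x \<in> carrier (quotient_module J)"
    then obtain a where a: "x = left_coset J a" by (auto simp: quotient_carrier)
    show "\<exists>y\<in>carrier (quotient_module J). y \<oplus>\<^bsub>quotient_module J\<^esub> x = \<zero>\<^bsub>quotient_module J\<^esub>"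
      unfolding a by (rule bexI[of _ "left_coset J (- a)"]) (auto simp: quotient_add quotient_zero quotient_carrier)
  qed (auto simp: quotient_carrier quotient_add quotient_zero ac_simps)
  show ?thesis
    by (intro left_module.intro grp left_module_axioms.intro)
      (auto simp: quotient_carrier quotient_add quotient_smult algebra_simps)
qed

lemma quotient_cyclic:
  "left_coset J 1 \<in> carrier (quotient_module J)"
  "carrier (quotient_module J) = {P \<odot>\<^bsub>quotient_module J\<^esub> left_coset J 1 |P. True}"
  "annihilator (quotient_module J) (left_coset J 1) = J"
  by (auto simp: quotient_carrier quotient_smult quotient_zero annihilator_def left_coset_eq_iff[OF J])

end

section \<open>The line bundle over the part of the characteristic variety above
  \<open>X\<^sub>f\<close>\<close>

definition to_ac_mpoly :: "('k::field, 'i::finite) mpoly \<Rightarrow> ('k alg_closure, 'i) mpoly" where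
  "to_ac_mpoly q = meval (\<lambda>c. mconst (to_ac c)) mvar q"

lemma scalars_mconst_to_ac: "scalars (\<lambda>c. mconst (to_ac c) :: ('k::field alg_closure, 'i) mpoly)"
  by standard (simp_all add: mconst.k_add mconst.k_mult mconst.k_1)

lemma ev_to_ac_mpoly: "ev w (to_ac_mpoly q) = meval to_ac w q"
  unfolding to_ac_mpoly_def
  by (induction q rule: mpoly_generators_induct)
    (simp_all add: scalars.meval_simps[OF scalars_mconst_to_ac] idc.meval_simps ac.meval_simps)

text \<open>On \<open>W\<close> the coordinate t is forced to be 1/f, and
  \<open>cotangent_map f\<close> can be inverted as soon as t and its dual coordinate are known. So
  the latter is the fibre coordinate, and \<open>f\<close> is the function \<open>b\<close> to be
  inverted.\<close>

lemma line_bundle_cotangent: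
  fixes f :: "('k::field_char_0, 'n::finite) mpoly"
  assumes U: "U = symbol_zeros I \<inter> cotangent_proj -` principal_open f"
    and W: "W = {w. w (Inl None) * meval to_ac (\<lambda>i. w (Inl (Some i))) f = 1 \<and> cotangent_map f w \<in> symbol_zeros I}"
  shows "line_bundle U (to_ac_mpoly (embed_x f)) (\<Union>j. (\<lambda>Q. to_ac_mpoly (symbol j Q)) ` (I \<inter> order_filtration j)) W
    (\<lambda>i. to_ac_mpoly (cotangent_subst f i)) (mvar (Inl None)) (mvar (Inr None))
    (\<lambda>u s. cotangent_lift f u (inverse (meval to_ac (\<lambda>i. u (Inl i)) f)) s)"
proof -
  let ?f = "\<lambda>u :: ('k, 'n + 'n) point. meval to_ac (\<lambda>i. u (Inl i)) f"
  have ev_f: "ev u (to_ac_mpoly (embed_x g)) = meval to_ac (\<lambda>i. u (Inl i)) g" for u and g :: "('k, 'n) mpoly"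
    by (simp add: ev_to_ac_mpoly embed_x_def ac.meval_subst ac.meval_mvar)
  have mem: "z \<in> zero_locus (\<Union>j. (\<lambda>Q. to_ac_mpoly (symbol j Q)) ` (I \<inter> order_filtration j)) \<longleftrightarrow> z \<in> symbol_zeros I" for z
    by (auto simp: zero_locus_def symbol_zeros_def ev_to_ac_mpoly)
  have proj: "(\<lambda>i. ev w (to_ac_mpoly (cotangent_subst f i))) = cotangent_map f w" for w
    by (simp add: cotangent_map_def ev_to_ac_mpoly)
  have f_map: "?f (cotangent_map f w) = meval to_ac (\<lambda>i. w (Inl (Some i))) f" for w
    by (simp add: cotangent_map_apply)
  have U': "u \<in> U \<longleftrightarrow> u \<in> symbol_zeros I \<and> ?f u \<noteq> 0" for u
    by (simp add: U principal_open_def cotangent_proj_def)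
  show ?thesis
  proof
    show "U = zero_locus (\<Union>j. (\<lambda>Q. to_ac_mpoly (symbol j Q)) ` (I \<inter> order_filtration j)) \<inter>
        {z. ev z (to_ac_mpoly (embed_x f)) \<noteq> 0}"
      unfolding set_eq_iff by (simp only: Int_iff mem U' mem_Collect_eq ev_f) simp
    show "(\<lambda>i. ev w (to_ac_mpoly (cotangent_subst f i))) \<in> U" if "w \<in> W" for w
      using that unfolding proj U' f_map W by auto
    show "ev w (mvar (Inl None)) * ev (\<lambda>i. ev w (to_ac_mpoly (cotangent_subst f i))) (to_ac_mpoly (embed_x f)) = 1"
      if "w \<in> W" for w
      using that unfolding proj ev_f f_map W by (simp add: idc.meval_mvar)
    fix u :: "('k, 'n + 'n) point" and s
    let ?l = "cotangent_lift f u (inverse (?f u)) s"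
    show "?l \<in> W" if "u \<in> U"
    proof -
      have "meval to_ac (\<lambda>i. ?l (Inl (Some i))) f = ?f u" by (simp add: cotangent_lift_def)
      with that show ?thesis unfolding W U' by (simp add: cotangent_map_lift cotangent_lift_None)
    qed
    show "(\<lambda>i. ev ?l (to_ac_mpoly (cotangent_subst f i))) = u"
      unfolding proj by (rule cotangent_map_lift)
    show "ev ?l (mvar (Inr None)) = s" by (simp add: idc.meval_mvar cotangent_lift_None)
    show "\<exists>Q. \<forall>s. cotangent_lift f u (inverse (?f u)) s j = poly Q s" for j
      by (rule exI[of _ "case_sum (case_option [:inverse (?f u):] (\<lambda>i. [:u (Inl i):]))
          (case_option [:0, 1:] (\<lambda>i. [:u (Inr i), meval to_ac (\<lambda>i. u (Inl i)) (mpderiv i f) * inverse (?f u) ^ 2:])) j"])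
        (auto simp: cotangent_lift_def algebra_simps split: sum.split option.split)
  next
    fix w assume w: "w \<in> W"
    then have "meval to_ac (\<lambda>i. w (Inl (Some i))) f * w (Inl None) = 1"
      unfolding W by (simp add: mult.commute)
    from inverse_unique[OF this] show "cotangent_lift f (\<lambda>i. ev w (to_ac_mpoly (cotangent_subst f i)))
        (inverse (meval to_ac (\<lambda>i. ev w (to_ac_mpoly (cotangent_subst f (Inl i)))) f)) (ev w (mvar (Inr None))) = w"
      using fun_cong[OF proj[of w]] by (simp add: proj idc.meval_mvar cotangent_map_apply cotangent_lift_map)
  next
    fix s and j :: "'n option + 'n option"
    define b where "b = to_ac_mpoly (embed_x f)"
    have fb: "?f u = ev u b" for u by (simp add: b_def ev_f)
    have nz: "ev u b \<noteq> 0" if "u \<in> U" for u using that by (simp add: U' fb)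
    have clear: "z ^ 2 * (v + g * s * inverse z ^ 2) = z ^ 2 * v + g * s" if "z \<noteq> 0"
      for z v g :: "'k alg_closure"
    proof -
      have "z ^ 2 * (v + g * s * inverse z ^ 2) = z ^ 2 * v + g * s * (z * inverse z) ^ 2"
        by (simp only: distrib_left power_mult_distrib mult.left_commute[of "z ^ 2"])
      then show ?thesis using that by simp
    qed
    \<comment> \<open>The section contains 1/f at most to the second power, so \<open>b ^ 2\<close>
      clears the denominators of all coordinates.\<close>
    let ?q = "case_sum (case_option b (\<lambda>i. b ^ 2 * mvar (Inl i))) (case_option (b ^ 2 * mconst s)
      (\<lambda>i. b ^ 2 * mvar (Inr i) + to_ac_mpoly (embed_x (mpderiv i f)) * mconst s)) j"
    have "ev u b ^ 2 * cotangent_lift f u (inverse (?f u)) s j = ev u ?q" if "u \<in> U" for u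
    proof -
      have "ev u b ^ 2 * inverse (ev u b) = ev u b" by (simp add: power2_eq_square nz[OF that])
      then show ?thesis using nz[OF that]
        by (auto simp: cotangent_lift_def idc.meval_simps ev_f fb clear split: sum.splits option.splits)
    qed
    then show "\<exists>N q. \<forall>u\<in>U. ev u (to_ac_mpoly (embed_x f)) ^ N * cotangent_lift f u (inverse (?f u)) s j = ev u q"
      unfolding b_def by blast
  next
    fix j :: "'n option + 'n option"
    let ?C = "insert (mvar (Inr None)) (insert (mvar (Inl None)) (range (\<lambda>i. to_ac_mpoly (cotangent_subst f i)))) ::
      ('k alg_closure, 'n option + 'n option) mpoly set"
    have sub_Inl: "to_ac_mpoly (cotangent_subst f (Inl i)) = mvar (Inl (Some i))" for i
      by (simp add: cotangent_subst_def to_ac_mpoly_def scalars.meval_simps[OF scalars_mconst_to_ac])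
    have in_C: "mvar (Inl (Some i)) \<in> ?C" for i
      using rangeI[of "\<lambda>i. to_ac_mpoly (cotangent_subst f i)" "Inl i"] unfolding sub_Inl by blast
    have gen: "c \<in> falg mconst ?C 1" if "c \<in> ?C" for c using falg_gen[OF that, of mconst 0] by simp
    have x: "\<exists>k. to_ac_mpoly (embed_x (pull g)) \<in> falg mconst ?C k" for g :: "('k, 'n) mpoly"
    proof -
      have "to_ac_mpoly (embed_x (pull g)) = meval (\<lambda>c. mconst (to_ac c)) (\<lambda>i. mvar (Inl (Some i))) g"
        by (simp add: embed_x_pull to_ac_mpoly_def scalars.meval_subst[OF scalars_mconst_to_ac]
            scalars.meval_mvar[OF scalars_mconst_to_ac])
      moreover have "\<exists>k. meval (\<lambda>c. mconst (to_ac c)) (\<lambda>i. mvar (Inl (Some i))) g \<in> falg mconst ?C k"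
        by (intro scalars.meval_mem_falg[OF scalars_mconst_to_ac] rangeI in_C)
      ultimately show ?thesis by (simp only:)
    qed
    show "\<exists>k. mvar j \<in> falg mconst ?C k"
    proof (cases j)
      case (Inl i)
      have "mvar j \<in> ?C"
        using in_C by (cases i) (simp_all only: Inl insert_iff simp_thms)
      then show ?thesis using gen by blast
    next
      case (Inr i)
      show ?thesis
      proof (cases i)
        case None
        then have "mvar j \<in> ?C" by (simp add: Inr)
        then show ?thesis using gen by blast
      next
        case (Some i')
        let ?g = "to_ac_mpoly (embed_x (pull (mpderiv i' f))) :: ('k alg_closure, 'n option + 'n option) mpoly"
        obtain k where k: "?g \<in> falg mconst ?C k" using x by blast
        have "to_ac_mpoly (cotangent_subst f (Inr i')) = mvar (Inr (Some i')) - ?g * (mvar (Inr None) * mvar (Inl None) ^ 2)"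
          by (simp add: cotangent_subst_def to_ac_mpoly_def scalars.meval_simps[OF scalars_mconst_to_ac])
        \<comment> \<open>The definition of \<open>cotangent_subst\<close> is solved for the
          coordinate dual to \<open>x\<^sub>i\<close>; what it subtracts is already in the
          subalgebra.\<close>
        then have eq: "mvar j = to_ac_mpoly (cotangent_subst f (Inr i')) + ?g * (mvar (Inr None) * mvar (Inl None) ^ 2)"
          by (simp add: Inr Some)
        have "?g * (mvar (Inr None) * mvar (Inl None) ^ 2) \<in> falg mconst ?C (k + (1 + 2 * 1))"
          by (intro falg_mult k mconst.falg_power gen) auto
        moreover have "to_ac_mpoly (cotangent_subst f (Inr i')) \<in> falg mconst ?C (k + (1 + 2 * 1))"
          by (rule falg_mono[OF gen subset_refl]) auto
        ultimately have "mvar j \<in> falg mconst ?C (k + (1 + 2 * 1))"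
          unfolding eq by (intro falg_add)
        then show ?thesis by blast
      qed
    qed
  qed
qed

theorem theorem2p14:
  fixes M :: "(('k::field_char_0, 'n::finite) weyl, 'm) module"
    and u :: 'm
    and f :: "('k, 'n) mpoly"
    and G :: "('k, 'n) weyl set"
    and J :: "('k, 'n option) weyl set"
  assumes "left_module M"
    and "u \<in> carrier M"
    and "carrier M = {P \<odot>\<^bsub>M\<^esub> u |P. True}"
    and "f \<noteq> 0"
    and "finite G"
    and "left_ideal hull G = annihilator M u"
    and "J = left_ideal hull (tau f ` G \<union> {weyl_t * weyl_pullback f - 1})"
    and "holonomic_on_open f M"
  shows "holonomic (quotient_module J)"
proof -
  have J: "left_ideal J" unfolding assms(7) by (rule left_ideal_hull)
  note char_M = char_variety_cyclic[OF assms(1-3)]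
  note char_Q = char_variety_cyclic[OF left_module_quotient[OF J] quotient_cyclic(1,2)[OF J]]
  have char_eq: "char_variety (quotient_module J) = symbol_zeros J"
    using char_Q(1) by (simp add: quotient_cyclic(3)[OF J])
  note line = line_bundle.alg_dim_total_space[OF line_bundle_cotangent[OF refl refl, of "annihilator M u" f]]
  \<comment> \<open>The base has dimension exactly \<open>CARD('n)\<close> by
    \<open>holonomic_on_open\<close>; the fibre raises it to the number of variables of
    \<open>Y\<close>.\<close>
  have "alg_dim (char_variety (quotient_module J)) = ereal (real (Suc CARD('n)))"
    unfolding char_eq symbol_zeros_tau[OF assms(6,7)]
    by (rule line) (use assms(8) in \<open>simp add: holonomic_on_open_def char_M(1)\<close>)
  then show ?thesis
    unfolding holonomic_def using left_module_quotient[OF J] char_Q(2) by (simp add: card_UNIV_option)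
qed

end
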